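(* There is a polynomial-time algorithm that, given two (finite, simple) graphs $G$ and $H$, each of clique-width at most three, decides whether $G \cong H$.
   Context: All graphs are finite, without loops or multiple edges. A labeled graph is a graph in which every vertex has exactly one label. A $k$-expression is an algebraic expression built from the following operations using at most $k$ labels: $v(i)$ creates a new vertex $v$ with label $i$; $G_1\oplus\cdots\oplus G_l$ is the disjoint union of labeled graphs; $\eta_{i,j}$ ($i\neq j$) adds all edges between vertices of label $i$ and vertices of label $j$; $\rho_{i\rightarrow j}$ renames label $i$ to label $j$. The clique-width of a graph $G$ is the minimum $k$ such that some $k$-expression produces $G$ (after forgetting labels). $G\cong H$ means $G$ and $H$ are isomorphic graphs. *)

theory Defs
  imports "Graph_Theory.Graph_Theory" "HOL-Computational_Algebra.Polynomial"
begin

section \<open>Clique-width\<close>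

text \<open>
  A finite simple undirected graph is a \<^locale>\<open>pair_graph\<close>: a finite, loop-free, symmetric digraph
  without parallel arcs. Each undirected edge is represented by its two opposite arcs.

  In a \<open>k\<close>-expression, \<open>Create v i\<close> is \<open>v(i)\<close>, \<open>DUnion [G\<^sub>1, \<dots>, G\<^sub>l]\<close> is
  \<open>G\<^sub>1 \<oplus> \<dots> \<oplus> G\<^sub>l\<close>, \<open>Join i j\<close> is \<open>\<eta>\<close> with indices \<open>i, j\<close>, and \<open>Relabel i j\<close> is
  \<open>\<rho>\<close> with index \<open>i \<rightarrow> j\<close>. The empty union is admitted so that the null graph, which
  \<^locale>\<open>pair_graph\<close> allows, has a clique-width as well (namely 0).
\<close>

datatype 'v cw_expr =
    Create 'v nat
  | DUnion "'v cw_expr list"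
  | Join nat nat "'v cw_expr"
  | Relabel nat nat "'v cw_expr"

text \<open>The vertices of the labeled graph denoted by an expression, each paired with its label.\<close>

primrec labeled_verts :: "'v cw_expr \<Rightarrow> ('v \<times> nat) set" where
  "labeled_verts (Create v i) = {(v, i)}"
| "labeled_verts (DUnion es) = (\<Union>L \<in> set (map labeled_verts es). L)"
| "labeled_verts (Join i j e) = labeled_verts e"
| "labeled_verts (Relabel i j e) = (\<lambda>(v, l). (v, if l = i then j else l)) ` labeled_verts e"

primrec expr_arcs :: "'v cw_expr \<Rightarrow> 'v rel" where
  "expr_arcs (Create v i) = {}"
| "expr_arcs (DUnion es) = (\<Union>A \<in> set (map expr_arcs es). A)"
| "expr_arcs (Join i j e) = expr_arcs e \<union>
     {(u, v). (u, i) \<in> labeled_verts e \<and> (v, j) \<in> labeled_verts e} \<union>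
     {(u, v). (u, j) \<in> labeled_verts e \<and> (v, i) \<in> labeled_verts e}"
| "expr_arcs (Relabel i j e) = expr_arcs e"

text \<open>Unions are disjoint, and joins are only between distinct labels.\<close>

fun wf_expr :: "'v cw_expr \<Rightarrow> bool" where
  "wf_expr (Create v i) = True"
| "wf_expr (DUnion es) \<longleftrightarrow> (\<forall>e \<in> set es. wf_expr e) \<and>
     (\<forall>a < length es. \<forall>b < length es. a \<noteq> b \<longrightarrow>
        fst ` labeled_verts (es ! a) \<inter> fst ` labeled_verts (es ! b) = {})"
| "wf_expr (Join i j e) \<longleftrightarrow> i \<noteq> j \<and> wf_expr e"
| "wf_expr (Relabel i j e) \<longleftrightarrow> wf_expr e"

primrec expr_labels :: "'v cw_expr \<Rightarrow> nat set" where
  "expr_labels (Create v i) = {i}"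
| "expr_labels (DUnion es) = (\<Union>L \<in> set (map expr_labels es). L)"
| "expr_labels (Join i j e) = {i, j} \<union> expr_labels e"
| "expr_labels (Relabel i j e) = {i, j} \<union> expr_labels e"

definition k_expr :: "nat \<Rightarrow> 'v cw_expr \<Rightarrow> bool" where
  "k_expr k e \<longleftrightarrow> wf_expr e \<and> card (expr_labels e) \<le> k"

definition forget_labels :: "'v cw_expr \<Rightarrow> 'v pair_pre_digraph" where
  "forget_labels e = \<lparr>pverts = fst ` labeled_verts e, parcs = expr_arcs e\<rparr>"

definition clique_width :: "'v pair_pre_digraph \<Rightarrow> nat" where
  "clique_width G = (LEAST k. \<exists>e. k_expr k e \<and> forget_labels e = G)"

text \<open>Every vertex has exactly one label.\<close>

lemma labeled_verts_functional:
  "wf_expr e \<Longrightarrow> (v, i) \<in> labeled_verts e \<Longrightarrow> (v, j) \<in> labeled_verts e \<Longrightarrow> i = j"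
proof (induction e arbitrary: i j)
  case (DUnion es)
  obtain a b where ab: "a < length es" "b < length es"
    "(v, i) \<in> labeled_verts (es ! a)" "(v, j) \<in> labeled_verts (es ! b)"
    using DUnion.prems(2,3) by (auto simp: in_set_conv_nth)
  then have "v \<in> fst ` labeled_verts (es ! a) \<inter> fst ` labeled_verts (es ! b)"
    by force
  moreover have "\<forall>a < length es. \<forall>b < length es. a \<noteq> b \<longrightarrow>
      fst ` labeled_verts (es ! a) \<inter> fst ` labeled_verts (es ! b) = {}"
    using DUnion.prems(1) by simp
  ultimately have "a = b" using ab(1,2) by blast
  moreover have "es ! a \<in> set es" "wf_expr (es ! a)"
    using DUnion.prems(1) ab(1) by simp_all
  ultimately show ?case using DUnion.IH[of "es ! a"] ab(3,4) by blast
next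
  case (Relabel k l e)
  obtain i' j' where "(v, i') \<in> labeled_verts e" "i = (if i' = k then l else i')"
    "(v, j') \<in> labeled_verts e" "j = (if j' = k then l else j')"
    using Relabel.prems(2,3) by auto
  then show ?case using Relabel.IH[of i' j'] Relabel.prems(1) by simp
qed simp_all

text \<open>Every finite simple graph is produced by some expression, so the minimum exists.\<close>

lemma finite_expr_labels: "finite (expr_labels e)"
  by (induction e) auto

lemma pair_graph_has_expr:
  assumes "pair_graph G"
  shows "\<exists>e. wf_expr e \<and> forget_labels e = G"
proof -
  interpret pair_graph G by fact
  obtain vs where vs: "set vs = pverts G" "distinct vs"
    using finite_distinct_list[OF pair_finite_verts] by blast
  define f where "f = the_inv_into {..<length vs} ((!) vs)"
  have inj: "inj_on ((!) vs) {..<length vs}"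
    using vs(2) by (simp add: inj_on_nth)
  have f: "f (vs ! a) = a" if "a < length vs" for a
    unfolding f_def using that by (intro the_inv_into_f_f[OF inj]) auto
  have f_inj: "u = v" if "u \<in> pverts G" "v \<in> pverts G" "f u = f v" for u v
    using that vs f by (metis in_set_conv_nth)
  define e0 where "e0 = DUnion (map (\<lambda>v. Create v (f v)) vs)"
  have e0: "wf_expr e0" "labeled_verts e0 = (\<lambda>v. (v, f v)) ` pverts G" "expr_arcs e0 = {}"
    using vs by (auto simp: e0_def nth_eq_iff_index_eq)
  have "\<exists>e. wf_expr e \<and> labeled_verts e = labeled_verts e0 \<and> expr_arcs e = A \<union> A\<inverse>"
    if "finite A" "A \<subseteq> parcs G" for A
    using that
  proof (induction A rule: finite_induct)
    case empty
    show ?case using e0 by (intro exI[of _ e0]) simp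
  next
    case (insert x A)
    then obtain e where e: "wf_expr e" "labeled_verts e = labeled_verts e0"
      "expr_arcs e = A \<union> A\<inverse>" by auto
    obtain u v where x: "x = (u, v)" by (cases x)
    have uv: "u \<in> pverts G" "v \<in> pverts G" "u \<noteq> v"
      using insert.prems x pair_no_loops in_arcsD1 in_arcsD2 by fastforce+
    have lab: "(w, f y) \<in> labeled_verts e \<longleftrightarrow> w = y" if "y \<in> pverts G" for w y
      using that f_inj by (auto simp: e(2) e0(2))
    have "f u \<noteq> f v" using f_inj uv by blast
    then show ?case
      using e lab uv
      by (intro exI[of _ "Join (f u) (f v) e"]) (auto simp: x)
  qed
  from this[OF pair_finite_arcs] obtain e where
    e: "wf_expr e" "labeled_verts e = labeled_verts e0" "expr_arcs e = parcs G \<union> (parcs G)\<inverse>"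
    by auto
  have "(parcs G)\<inverse> = parcs G"
    using pair_sym_arcs by (auto simp: symmetric_def dest: symD)
  then have "forget_labels e = G"
    by (simp add: forget_labels_def e e0(2) image_image)
  with e(1) show ?thesis by blast
qed

lemma clique_width_le_iff:
  assumes "pair_graph G"
  shows "clique_width G \<le> k \<longleftrightarrow> (\<exists>e. k_expr k e \<and> forget_labels e = G)"
proof
  have "\<exists>k e. k_expr k e \<and> forget_labels e = G"
    using pair_graph_has_expr[OF assms] unfolding k_expr_def by blast
  from LeastI_ex[OF this, folded clique_width_def]
  show "\<exists>e. k_expr k e \<and> forget_labels e = G" if "clique_width G \<le> k"
    using that by (auto simp: k_expr_def intro: order_trans)
next
  show "clique_width G \<le> k" if "\<exists>e. k_expr k e \<and> forget_labels e = G"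
    unfolding clique_width_def by (rule Least_le) fact
qed

text \<open>On simple graphs, the isomorphism notion of the library is the usual one.\<close>

lemma digraph_iso_pair_graph:
  assumes "pair_graph G" "pair_graph H"
  shows "digraph_iso (with_proj G) (with_proj H) \<longleftrightarrow>
    (\<exists>f. bij_betw f (pverts G) (pverts H) \<and>
      (\<forall>u \<in> pverts G. \<forall>v \<in> pverts G. (u, v) \<in> parcs G \<longleftrightarrow> (f u, f v) \<in> parcs H))"
    (is "?L \<longleftrightarrow> ?R")
proof
  interpret G: pair_graph G by fact
  interpret H: pair_graph H by fact
  show ?R if ?L
  proof -
    from that obtain h where h: "pre_digraph.digraph_isomorphism (with_proj G) h"
      "with_proj H = app_iso h (with_proj G)"
      by (auto simp: digraph_iso_def)
    define f where "f = iso_verts h"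
    have heads: "iso_tail h = fst" "iso_head h = snd"
      using arg_cong[OF h(2), of tail] arg_cong[OF h(2), of head] by simp_all
    have verts: "pverts H = f ` pverts G" and arcs: "parcs H = iso_arcs h ` parcs G"
      using arg_cong[OF h(2), of verts] arg_cong[OF h(2), of arcs] by (simp_all add: f_def)
    have inj: "inj_on f (pverts G)"
      using h(1) by (simp add: pre_digraph.digraph_isomorphism_def f_def)
    have arc: "iso_arcs h e = (f (fst e), f (snd e))" if "e \<in> parcs G" for e
      using h(1) that by (simp add: pre_digraph.digraph_isomorphism_def f_def heads prod_eq_iff)
    have "(u, v) \<in> parcs G \<longleftrightarrow> (f u, f v) \<in> parcs H"
      if uv: "u \<in> pverts G" "v \<in> pverts G" for u v
    proof
      show "(f u, f v) \<in> parcs H" if "(u, v) \<in> parcs G"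
        using arc[OF that] that by (auto simp: arcs intro: rev_image_eqI)
    next
      assume "(f u, f v) \<in> parcs H"
      then obtain e where e: "e \<in> parcs G" "(f u, f v) = iso_arcs h e"
        unfolding arcs by blast
      then have "f u = f (fst e)" "f v = f (snd e)" using arc by simp_all
      moreover have "fst e \<in> pverts G" "snd e \<in> pverts G"
        using e(1) G.arc_fst_in_verts G.arc_snd_in_verts by blast+
      ultimately have "e = (u, v)" using inj uv by (metis inj_onD prod.collapse)
      with e(1) show "(u, v) \<in> parcs G" by simp
    qed
    with inj verts show ?R by (auto simp: bij_betw_def)
  qed
  show ?L if ?R
  proof -
    from that obtain f where f: "inj_on f (pverts G)" "pverts H = f ` pverts G"
      "\<And>u v. u \<in> pverts G \<Longrightarrow> v \<in> pverts G \<Longrightarrow> (u, v) \<in> parcs G \<longleftrightarrow> (f u, f v) \<in> parcs H"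
      unfolding bij_betw_def by metis
    define g where "g = (\<lambda>e. (f (fst e), f (snd e)))"
    define h where "h = \<lparr>iso_verts = f, iso_arcs = g, iso_head = snd, iso_tail = fst\<rparr>"
    have G_arc: "fst e \<in> pverts G" "snd e \<in> pverts G" if "e \<in> parcs G" for e
      using that G.arc_fst_in_verts G.arc_snd_in_verts by blast+
    have arcs: "parcs H = g ` parcs G"
    proof (intro equalityI subsetI)
      fix e assume e: "e \<in> parcs H"
      then have "fst e \<in> f ` pverts G" "snd e \<in> f ` pverts G"
        using H.arc_fst_in_verts H.arc_snd_in_verts f(2) by blast+
      then obtain u v where uv: "u \<in> pverts G" "v \<in> pverts G" "e = (f u, f v)"
        by (metis imageE prod.collapse)
      then have "(u, v) \<in> parcs G" using e f(3) by simp
      then show "e \<in> g ` parcs G" using uv(3) by (auto simp: g_def intro: rev_image_eqI)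
    next
      fix e assume "e \<in> g ` parcs G"
      then obtain d where "d \<in> parcs G" "e = g d" by blast
      then show "e \<in> parcs H" using f(3)[of "fst d" "snd d"] G_arc by (simp add: g_def)
    qed
    have "inj_on g (parcs G)"
    proof (rule inj_onI)
      fix d e assume de: "d \<in> parcs G" "e \<in> parcs G" "g d = g e"
      then have "f (fst d) = f (fst e)" "f (snd d) = f (snd e)" by (simp_all add: g_def)
      then show "d = e" using f(1) G_arc de(1,2) by (metis inj_onD prod_eq_iff)
    qed
    then have "pre_digraph.digraph_isomorphism (with_proj G) h"
      using f(1) G.wf_digraph by (simp add: pre_digraph.digraph_isomorphism_def h_def g_def)
    moreover have "with_proj H = app_iso h (with_proj G)"
      using f(2) arcs by (simp add: app_iso_def with_proj_def h_def)
    ultimately show ?L unfolding digraph_iso_def by blast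
  qed
qed


section \<open>Random access machines and polynomial time\<close>

text \<open>
  The algorithms are structured programs for a random access machine. A machine state consists of
  registers and a memory, both holding natural numbers; \<open>Load\<close> and \<open>Store\<close> address the memory
  indirectly through a register. Every elementary operation and every test takes one time unit.
  Multiplication is deliberately absent: only addition and truncated subtraction are available, so
  the bit length of every stored number and of every address stays linear in the running time, and
  the model is polynomially equivalent to Turing machines.
\<close>

datatype prog =
    Skip
  | Const nat nat
  | Add nat nat nat
  | Sub nat nat nat
  | Load nat nat
  | Store nat nat
  | Seq prog prog
  | Cond nat prog prog
  | While nat prog

type_synonym state = "(nat \<Rightarrow> nat) \<times> (nat \<Rightarrow> nat)"

text \<open>
  \<open>exec c s t s'\<close>: started in \<open>s\<close>, the program \<open>c\<close> terminates in \<open>s'\<close> after exactly \<open>t\<close> steps.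
\<close>

inductive exec :: "prog \<Rightarrow> state \<Rightarrow> nat \<Rightarrow> state \<Rightarrow> bool" where
  Skip: "exec Skip s 1 s"
| Const: "exec (Const x n) (r, m) 1 (r(x := n), m)"
| Add: "exec (Add x y z) (r, m) 1 (r(x := r y + r z), m)"
| Sub: "exec (Sub x y z) (r, m) 1 (r(x := r y - r z), m)"
| Load: "exec (Load x y) (r, m) 1 (r(x := m (r y)), m)"
| Store: "exec (Store x y) (r, m) 1 (r, m(r x := r y))"
| Seq: "exec c s t s' \<Longrightarrow> exec d s' t' s'' \<Longrightarrow> exec (Seq c d) s (t + t') s''"
| CondTrue: "fst s x \<noteq> 0 \<Longrightarrow> exec c s t s' \<Longrightarrow> exec (Cond x c d) s (1 + t) s'"
| CondFalse: "fst s x = 0 \<Longrightarrow> exec d s t s' \<Longrightarrow> exec (Cond x c d) s (1 + t) s'"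
| WhileFalse: "fst s x = 0 \<Longrightarrow> exec (While x c) s 1 s"
| WhileTrue: "fst s x \<noteq> 0 \<Longrightarrow> exec c s t s' \<Longrightarrow> exec (While x c) s' t' s'' \<Longrightarrow>
    exec (While x c) s (1 + t + t') s''"

inductive_cases exec_elims:
  "exec Skip s t s'" "exec (Const x n) s t s'" "exec (Add x y z) s t s'"
  "exec (Sub x y z) s t s'" "exec (Load x y) s t s'" "exec (Store x y) s t s'"
inductive_cases exec_SeqE: "exec (Seq c d) s t s'"
inductive_cases exec_CondE: "exec (Cond x c d) s t s'"
inductive_cases exec_WhileE: "exec (While x c) s t s'"

lemma exec_deterministic:
  "exec c s t s' \<Longrightarrow> exec c s u s'' \<Longrightarrow> u = t \<and> s'' = s'"
proof (induction arbitrary: u s'' rule: exec.induct)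
  case (Seq c s t s' d t' s1)
  obtain v s2 v' where "u = v + v'" "exec c s v s2" "exec d s2 v' s''"
    using Seq.prems by (rule exec_SeqE)
  with Seq.IH show ?case by metis
next
  case (CondTrue s x c t s' d)
  obtain v where "u = Suc v" "exec c s v s''"
    using CondTrue.prems CondTrue.hyps(1) by (elim exec_CondE) simp_all
  with CondTrue.IH show ?case by simp
next
  case (CondFalse s x d t s' c)
  obtain v where "u = Suc v" "exec d s v s''"
    using CondFalse.prems CondFalse.hyps(1) by (elim exec_CondE) simp_all
  with CondFalse.IH show ?case by simp
next
  case (WhileFalse s x c)
  show ?case by (rule exec_WhileE[OF WhileFalse.prems]) (use WhileFalse.hyps(1) in simp_all)
next
  case (WhileTrue s x c t s' t' s1)
  obtain v s2 v' where "u = Suc (v + v')" "exec c s v s2" "exec (While x c) s2 v' s''"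
    by (rule exec_WhileE[OF WhileTrue.prems]) (use WhileTrue.hyps(1) in simp_all)
  with WhileTrue.IH show ?case by (metis add.assoc plus_1_eq_Suc)
qed (erule exec_elims; simp)+

text \<open>The input is a bit string, written to the memory from address 0 on; all else is 0.\<close>

definition initial_state :: "bool list \<Rightarrow> state" where
  "initial_state w =
     ((\<lambda>_. 0), (\<lambda>a. if a < length w then of_bool (w ! a) else 0))"

text \<open>
  The program decides the property \<open>P\<close> in polynomial time for all instances from \<open>D\<close>, presented
  by the encoding \<open>enc\<close>. The answer (1 or 0) is left in register 0. Nothing is required for
  inputs that do not encode an instance from \<open>D\<close>.
\<close>

definition decides_in_poly_time ::
  "prog \<Rightarrow> ('a \<Rightarrow> bool list) \<Rightarrow> 'a set \<Rightarrow> ('a \<Rightarrow> bool) \<Rightarrow> bool" where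
  "decides_in_poly_time c enc D P \<longleftrightarrow>
     (\<exists>p :: nat poly. \<forall>x \<in> D. \<exists>t r m.
        exec c (initial_state (enc x)) t (r, m) \<and> t \<le> poly p (length (enc x)) \<and>
        r 0 = (if P x then 1 else 0))"


section \<open>Graphs as inputs\<close>

text \<open>
  An input graph has the vertices \<open>0, \<dots>, n - 1\<close>. It is encoded by \<open>n\<close> in unary followed by its
  adjacency matrix, row by row. The code is self-delimiting, so pairs are encoded by concatenation.
\<close>

definition input_graph :: "nat pair_pre_digraph \<Rightarrow> bool" where
  "input_graph G \<longleftrightarrow> pair_graph G \<and> (\<exists>n. pverts G = {..<n})"

definition encode_graph :: "nat pair_pre_digraph \<Rightarrow> bool list" where
  "encode_graph G = (let n = card (pverts G) in
     replicate n True @ [False] @ [(u, v) \<in> parcs G. u \<leftarrow> [0..<n], v \<leftarrow> [0..<n]])"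

definition encode_graph_pair :: "nat pair_pre_digraph \<times> nat pair_pre_digraph \<Rightarrow> bool list" where
  "encode_graph_pair = (\<lambda>(G, H). encode_graph G @ encode_graph H)"

end

theory Submission
  imports Defs "HOL-Library.Multiset"
begin

text \<open>
  Weisfeiler-Leman refinement of 22-tuples on the disjoint union of the two graphs decides
  isomorphism. A 3-expression yields a binary decomposition of \<open>G\<close> all of whose parts have at most
  three neighbourhoods outside. Let \<open>A\<close> represent these classes of a part, let \<open>B\<close> consist of outside
  vertices that tell them apart, and draw an arrow from \<open>u\<close> to \<open>w\<close> if the representative of \<open>u\<close>
  disagrees with \<open>u\<close> on the adjacency to \<open>w\<close>. Without an arrow, the adjacency of \<open>u\<close> and \<open>w\<close> is
  determined by their types over \<open>A\<close> and \<open>B\<close>. Between two strongly connected components, arrows go in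
  one direction only, and it is the same direction for vertices of the same types, because these
  reach equally many vertices. So the adjacency between different components is determined by
  types, and it remains to match single components. A component is composed of components of the
  two subparts, once the parameters of the subparts are chosen such that the latter are nested in
  the former. Three parameters on either side of the part and of both subparts, a base vertex, and
  three vertices to follow a path of arrows amount to 22.

  The refinement stabilizes after \<open>n\<^sup>4\<^sup>4\<close> rounds. A round consists of nested sums over the vertices,
  which are compiled to the machine from a language of terms with bounded sums.
\<close>

section \<open>Matching multisets of colours\<close>

text \<open>Only the first side of a comparison carries a decomposition. On the second side nothing
  is known but equality of types, so its components, and the halves of its components, have to be
  recovered from relations that types decide (\<open>pres\<close>). A second obstacle: the map built
  on a component respects adjacency to the parameters, but is not shown to respect types. Edges
  between different components must therefore be predictable from the types of one vertex per
  component together with the adjacency of the end points to the parameters. An arrow marks a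
  failure of the prediction read off the representative, and strong components absorb the pairs with
  arrows in both directions. Three labels yield at most three neighbourhoods, hence three entries of
  \<open>A\<close>; \<open>B\<close> gets one separating vertex for each of the three pairs of
  neighbourhoods. Both graphs share one vertex set, so that a single relation compares tuples within
  a graph and across the graphs; \<open>S\<close> tells the sides apart. The machine cannot
  multiply: products, table addresses and the number of rounds all come from sums and nested
  loops.\<close>

lemma image_mset_bij:
  assumes "bij_betw f A B" "\<And>y. y \<in> A \<Longrightarrow> c' (f y) = c y"
  shows "image_mset c (mset_set A) = image_mset c' (mset_set B)"
proof -
  have "mset_set B = image_mset f (mset_set A)"
    using assms(1) by (metis bij_betw_def image_mset_mset_set)
  moreover have "image_mset c (mset_set A) = image_mset (c' \<circ> f) (mset_set A)"
    by (rule image_mset_cong) (metis assms(2) comp_apply elem_mset_set empty_iff infinite_set_mset_mset_set)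
  ultimately show ?thesis by (simp add: multiset.map_comp)
qed

lemma bij_image_mset:
  assumes "finite A" "finite B" "image_mset c (mset_set A) = image_mset c' (mset_set B)"
  shows "\<exists>f. bij_betw f A B \<and> (\<forall>x \<in> A. c' (f x) = c x)"
  using assms
proof (induction A arbitrary: B rule: finite_induct)
  case empty
  then have "B = {}" by (metis image_mset_empty image_mset_is_empty_iff mset_set.empty mset_set_empty_iff)
  then show ?case by (auto simp: bij_betw_def)
next
  case (insert x A)
  have "c x \<in># image_mset c' (mset_set B)" using insert by (metis finite_insert image_eqI insertI1 finite_set_mset_mset_set set_image_mset)
  then obtain y where y: "y \<in> B" "c' y = c x" using insert.prems by auto
  have "add_mset (c x) (image_mset c (mset_set A)) = add_mset (c' y) (image_mset c' (mset_set (B - {y})))"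
    using insert y by (metis image_mset_add_mset mset_set.insert mset_set.remove)
  then have "image_mset c (mset_set A) = image_mset c' (mset_set (B - {y}))" using y by simp
  then obtain f where f: "bij_betw f A (B - {y})" "\<forall>x \<in> A. c' (f x) = c x"
    using insert.IH[of "B - {y}"] insert.prems by auto
  have "bij_betw (f(x := y)) (insert x A) (insert y (B - {y}))"
    using f(1) insert.hyps(2) by (auto simp: bij_betw_def inj_on_def image_iff)
  moreover have "insert y (B - {y}) = B" using y by blast
  moreover have "\<forall>z \<in> insert x A. c' ((f(x := y)) z) = c z" using f(2) y insert.hyps by auto
  ultimately show ?case by metis
qed

text \<open>Equal colours force classes with equal colour multisets. So if a colour-preserving
  bijection sends \<open>x\<close> to \<open>f x\<close>, the classes of \<open>x\<close> and
  \<open>f x\<close> can be matched with each other; removing both leaves equal multisets and an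
  intact hypothesis. Later the elements are vertices coloured by types, and the classes are
  components.\<close>

lemma class_matching:
  assumes "finite C" "finite C'"
    and "image_mset c (mset_set C) = image_mset c' (mset_set C')"
    and "equivp r" "equivp r'"
    and "\<And>x x'. x \<in> C \<Longrightarrow> x' \<in> C' \<Longrightarrow> c x = c' x' \<Longrightarrow>
      image_mset c (mset_set {y \<in> C. r x y}) = image_mset c' (mset_set {y \<in> C'. r' x' y})"
  shows "\<exists>g. bij_betw g C C' \<and> (\<forall>x \<in> C. c' (g x) = c x) \<and> (\<forall>x \<in> C. \<forall>y \<in> C. r x y \<longleftrightarrow> r' (g x) (g y))"
  using assms(1,2,3,6)
proof (induction C arbitrary: C' rule: finite_psubset_induct)
  case (psubset C)
  note r = equivp_reflp[OF assms(4)] equivp_symp[OF assms(4)] equivp_transp[OF assms(4)]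
  note r' = equivp_reflp[OF assms(5)] equivp_symp[OF assms(5)] equivp_transp[OF assms(5)]
  show ?case
  proof (cases "C = {}")
    case True
    then have "C' = {}" using psubset.prems
      by (metis image_mset_empty image_mset_is_empty_iff mset_set.empty mset_set_empty_iff)
    with True show ?thesis by (auto simp: bij_betw_def)
  next
    case False
    then obtain x where x: "x \<in> C" by blast
    obtain f where f: "bij_betw f C C'" "\<forall>x \<in> C. c' (f x) = c x"
      using bij_image_mset psubset by meson
    define k k' where "k = {y \<in> C. r x y}" and "k' = {y \<in> C'. r' (f x) y}"
    have fx: "f x \<in> C'" "c x = c' (f x)" using f x by (auto simp: bij_betw_def)
    have kk: "image_mset c (mset_set k) = image_mset c' (mset_set k')"
      unfolding k_def k'_def using psubset.prems(3) x fx by blast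
    have fin: "finite k" "finite k'" using psubset by (auto simp: k_def k'_def)
    obtain h where h: "bij_betw h k k'" "\<forall>x \<in> k. c' (h x) = c x"
      using bij_image_mset[OF fin kk] by blast
    have sub: "k \<subseteq> C" "k' \<subseteq> C'" by (auto simp: k_def k'_def)
    have "x \<in> k" using x r(1) by (simp add: k_def)
    have rest: "\<exists>g. bij_betw g (C - k) (C' - k') \<and> (\<forall>x \<in> C - k. c' (g x) = c x) \<and>
        (\<forall>x \<in> C - k. \<forall>y \<in> C - k. r x y \<longleftrightarrow> r' (g x) (g y))"
    proof (rule psubset.IH)
      show "C - k \<subset> C" using \<open>x \<in> k\<close> x by blast
      show "finite (C' - k')" using psubset by simp
      show "image_mset c (mset_set (C - k)) = image_mset c' (mset_set (C' - k'))"
        using psubset.prems(2) kk fin sub psubset.hyps psubset.prems(1)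
        by (simp add: mset_set_Diff image_mset_Diff subset_imp_msubset_mset_set)
    next
      fix y y' assume y: "y \<in> C - k" "y' \<in> C' - k'" "c y = c' y'"
      \<comment> \<open>Classes are disjoint, so removing \<open>k\<close> leaves every other class
        whole.\<close>
      then have "{z \<in> C - k. r y z} = {z \<in> C. r y z}" "{z \<in> C' - k'. r' y' z} = {z \<in> C'. r' y' z}"
        unfolding k_def k'_def using r r' by blast+
      then show "image_mset c (mset_set {z \<in> C - k. r y z}) = image_mset c' (mset_set {z \<in> C' - k'. r' y' z})"
        using psubset.prems(3)[of y y'] y by auto
    qed
    then obtain g where g: "bij_betw g (C - k) (C' - k')" "\<forall>x \<in> C - k. c' (g x) = c x"
        "\<forall>x \<in> C - k. \<forall>y \<in> C - k. r x y \<longleftrightarrow> r' (g x) (g y)" by blast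
    define G where "G = (\<lambda>x. if x \<in> k then h x else g x)"
    have "bij_betw G (k \<union> (C - k)) (k' \<union> (C' - k'))"
      unfolding G_def using bij_betw_disjoint_Un[OF h(1) g(1)] by blast
    moreover have "k \<union> (C - k) = C" "k' \<union> (C' - k') = C'" using sub by blast+
    ultimately have G: "bij_betw G C C'" by simp
    have Gk: "G u \<in> k'" if "u \<in> k" for u using that h(1) by (auto simp: G_def bij_betw_def)
    have Gn: "G u \<in> C' - k'" if "u \<in> C - k" for u using that g(1) by (auto simp: G_def bij_betw_def)
    have "r u w \<longleftrightarrow> r' (G u) (G w)" if uw: "u \<in> C" "w \<in> C" for u w
    proof (cases "u \<in> k"; cases "w \<in> k")
      assume "u \<in> k" "w \<in> k"
      moreover from this have "G u \<in> k'" "G w \<in> k'" using Gk by blast+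
      ultimately show ?thesis unfolding k_def k'_def using r r' by blast
    next
      assume "u \<in> k" "w \<notin> k"
      moreover from this uw have "G u \<in> k'" "G w \<in> C' - k'" using Gk Gn by blast+
      ultimately show ?thesis using uw unfolding k_def k'_def using r r' by blast
    next
      assume "u \<notin> k" "w \<in> k"
      moreover from this uw have "G w \<in> k'" "G u \<in> C' - k'" using Gk Gn by blast+
      ultimately show ?thesis using uw unfolding k_def k'_def using r r' by blast
    next
      assume "u \<notin> k" "w \<notin> k"
      then show ?thesis using g(3) uw by (simp add: G_def)
    qed
    moreover have "\<forall>x \<in> C. c' (G x) = c x" using h(2) g(2) by (simp add: G_def)
    ultimately show ?thesis using G by blast
  qed
qed

section \<open>Stable equivalences of tuples\<close>

text \<open>The facts about stable refinement that the combinatorial part uses. Tuples may be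
  shorter than \<open>K\<close>. \<open>R_ext\<close> is the counting property, in the form of a
  bijection; \<open>R_sub\<close> allows coordinates to be dropped, permuted and repeated.\<close>

locale wl_equivalence =
  fixes U :: "'a set" and E S :: "'a \<Rightarrow> 'a \<Rightarrow> bool" and K :: nat
    and R :: "'a list \<Rightarrow> 'a list \<Rightarrow> bool"
  assumes finite_U: "finite U"
    and E_sym: "E u w \<Longrightarrow> E w u"
    and S_equiv: "equivp S"
    and R_dom: "R x y \<Longrightarrow> set x \<subseteq> U \<and> set y \<subseteq> U \<and> length x = length y \<and> x \<noteq> []"
    and R_refl: "x \<noteq> [] \<Longrightarrow> set x \<subseteq> U \<Longrightarrow> length x \<le> K \<Longrightarrow> R x x"
    and R_sym: "R x y \<Longrightarrow> R y x"
    and R_trans: "R x y \<Longrightarrow> R y z \<Longrightarrow> R x z"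
    and R_atom: "R x y \<Longrightarrow> i < length x \<Longrightarrow> j < length x \<Longrightarrow>
      (x ! i = x ! j \<longleftrightarrow> y ! i = y ! j) \<and> (E (x ! i) (x ! j) \<longleftrightarrow> E (y ! i) (y ! j)) \<and>
      (S (x ! i) (x ! j) \<longleftrightarrow> S (y ! i) (y ! j))"
    and R_ext: "R x y \<Longrightarrow> length x < K \<Longrightarrow>
      \<exists>f. bij_betw f U U \<and> (\<forall>v \<in> U. R (x @ [v]) (y @ [f v]))"
    and R_sub: "R x y \<Longrightarrow> is \<noteq> [] \<Longrightarrow> set is \<subseteq> {..<length x} \<Longrightarrow> length is \<le> K \<Longrightarrow>
      R (map ((!) x) is) (map ((!) y) is)"
begin

lemmas S_rules = equivp_reflp[OF S_equiv] equivp_symp[OF S_equiv] equivp_transp[OF S_equiv]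

lemma E_comm: "E u w \<longleftrightarrow> E w u"
  using E_sym by blast

lemma R_drop:
  assumes "R (a @ b @ c) (a' @ b' @ c')" "length a = length a'" "length b = length b'"
    "a @ c \<noteq> []" "length (a @ c) \<le> K"
  shows "R (a @ c) (a' @ c')"
proof -
  define J where "J = [0..<length a] @ [length a + length b..<length a + length b + length c]"
  have len: "length c = length c'" using R_dom[OF assms(1)] assms(2,3) by simp
  have "R (map ((!) (a @ b @ c)) J) (map ((!) (a' @ b' @ c')) J)"
    using assms by (intro R_sub) (auto simp: J_def)
  moreover have "map ((!) (a @ b @ c)) J = a @ c"
    by (rule nth_equalityI) (auto simp: J_def nth_append)
  moreover have "map ((!) (a' @ b' @ c')) J = a' @ c'"
    using assms(2,3) len by (intro nth_equalityI) (auto simp: J_def nth_append)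
  ultimately show ?thesis by simp
qed

lemma R_drop_front:
  assumes "R (b @ c) (b' @ c')" "length b = length b'" "c \<noteq> []" "length c \<le> K"
  shows "R c c'"
  using R_drop[of "[]" b c "[]" b' c'] assms by simp

lemma R_swap:
  assumes "R (p @ [u, w]) (q @ [u', w'])" "length p + 2 \<le> K"
  shows "R (p @ [w, u]) (q @ [w', u'])"
proof -
  define J where "J = [0..<length p] @ [Suc (length p), length p]"
  have len: "length p = length q" using R_dom[OF assms(1)] by simp
  have "R (map ((!) (p @ [u, w])) J) (map ((!) (q @ [u', w'])) J)"
    using assms by (intro R_sub) (auto simp: J_def)
  moreover have "map ((!) (p @ [u, w])) J = p @ [w, u]"
    by (rule nth_equalityI) (auto simp: J_def nth_append less_Suc_eq)
  moreover have "map ((!) (q @ [u', w'])) J = q @ [w', u']"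
    using len by (intro nth_equalityI) (auto simp: J_def nth_append less_Suc_eq)
  ultimately show ?thesis by simp
qed

lemma R_extend:
  assumes "R x y" "length x + length z \<le> K" "set z \<subseteq> U"
  shows "\<exists>z'. R (x @ z) (y @ z') \<and> length z' = length z"
  using assms(2,3)
proof (induction z rule: rev_induct)
  case Nil
  then show ?case using assms(1) by auto
next
  case (snoc v z)
  then obtain z' where z': "R (x @ z) (y @ z')" "length z' = length z" by auto
  then obtain f where "\<forall>v \<in> U. R ((x @ z) @ [v]) ((y @ z') @ [f v])"
    using R_ext[of "x @ z"] snoc.prems by fastforce
  then show ?case using snoc.prems z' by (intro exI[of _ "z' @ [f v]"]) auto
qed

text \<open>A semantic substitute for definability with parameters: \<open>Q\<close> with parameters
  \<open>p\<close> and \<open>Q'\<close> with parameters \<open>q\<close> count as one relation if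
  pairs of equal type belong to both or to neither.\<close>

definition pres :: "'a list \<Rightarrow> 'a list \<Rightarrow> ('a \<Rightarrow> 'a \<Rightarrow> bool) \<Rightarrow> ('a \<Rightarrow> 'a \<Rightarrow> bool) \<Rightarrow> bool" where
  "pres p q Q Q' \<longleftrightarrow> length p = length q \<and>
     (\<forall>u w u' w'. R (p @ [u, w]) (q @ [u', w']) \<longrightarrow> (Q u w \<longleftrightarrow> Q' u' w'))"

lemma pres_sym: "pres p q Q Q' \<Longrightarrow> pres q p Q' Q"
  unfolding pres_def using R_sym by metis

lemma presD: "pres p q Q Q' \<Longrightarrow> R (p @ [u, w]) (q @ [u', w']) \<Longrightarrow> Q u w \<longleftrightarrow> Q' u' w'"
  unfolding pres_def by blast

lemma pres_conj: "pres p q Q Q' \<Longrightarrow> pres p q T T' \<Longrightarrow>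
   pres p q (\<lambda>x y. Q x y \<and> T x y) (\<lambda>x y. Q' x y \<and> T' x y)"
  unfolding pres_def by blast

lemma pres_disj: "pres p q Q Q' \<Longrightarrow> pres p q T T' \<Longrightarrow>
   pres p q (\<lambda>x y. Q x y \<or> T x y) (\<lambda>x y. Q' x y \<or> T' x y)"
  unfolding pres_def by blast

lemma pres_converse: "pres p q Q Q' \<Longrightarrow> length p + 2 \<le> K \<Longrightarrow> pres p q (\<lambda>x y. Q y x) (\<lambda>x y. Q' y x)"
  unfolding pres_def using R_swap by blast

lemma pres_weaken:
  assumes "pres p q Q Q'" "length a = length a'" "length c = length c'" "length p + 2 \<le> K"
  shows "pres (a @ p @ c) (a' @ q @ c') Q Q'"
  unfolding pres_def
proof (intro conjI allI impI)
  show len: "length (a @ p @ c) = length (a' @ q @ c')" using assms by (simp add: pres_def)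
  fix u w u' w' assume R: "R ((a @ p @ c) @ [u, w]) ((a' @ q @ c') @ [u', w'])"
  define J where "J = [length a..<length a + length p] @ [length (a @ p @ c), Suc (length (a @ p @ c))]"
  have "R (map ((!) ((a @ p @ c) @ [u, w])) J) (map ((!) ((a' @ q @ c') @ [u', w'])) J)"
    using assms(4) by (intro R_sub[OF R]) (auto simp: J_def)
  moreover have "map ((!) ((a @ p @ c) @ [u, w])) J = p @ [u, w]"
    by (rule nth_equalityI) (auto simp: J_def nth_append less_Suc_eq)
  moreover have "map ((!) ((a' @ q @ c') @ [u', w'])) J = q @ [u', w']"
    using len assms(2,3) by (intro nth_equalityI) (auto simp: J_def nth_append less_Suc_eq)
  ultimately show "Q u w \<longleftrightarrow> Q' u' w'" using presD[OF assms(1)] by simp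
qed

text \<open>A path is copied vertex by vertex. Only the current vertex, the end point and the next
  vertex are held at a time, so three coordinates suffice for paths of any length.\<close>

lemma pres_rtranclp_imp:
  assumes "pres p q Q Q'" "length p + 3 \<le> K" "\<And>u w. Q u w \<Longrightarrow> u \<in> U"
    and "Q\<^sup>*\<^sup>* u w" "R (p @ [u, w]) (q @ [u', w'])"
  shows "Q'\<^sup>*\<^sup>* u' w'"
  using assms(4,5)
proof (induction arbitrary: u' rule: converse_rtranclp_induct)
  case base
  have "length p = length q" using base R_dom by fastforce
  then have "u' = w'" using R_atom[OF base, of "length p" "Suc (length p)"] by (simp add: nth_append)
  then show ?case by simp
next
  case (step u z)
  have len: "length p = length q" using step.prems R_dom by fastforce
  have z: "z \<in> U" using step.hyps(2) assms(3) R_dom[OF step.prems]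
    by (cases rule: converse_rtranclpE) auto
  have "\<exists>z'. R ((p @ [u, w]) @ [z]) ((q @ [u', w']) @ z') \<and> length z' = length [z]"
    using step.prems assms(2) z by (intro R_extend) auto
  then obtain z' where z': "R (p @ [u, w, z]) (q @ [u', w', z'])" by (auto simp: length_Suc_conv)
  have "R (p @ [u, z]) (q @ [u', z'])"
    using R_drop[of "p @ [u]" "[w]" "[z]" "q @ [u']" "[w']" "[z']"] z' len assms(2) by simp
  moreover have "R (p @ [w, z]) (q @ [w', z'])"
    using R_drop[of p "[u]" "[w, z]" q "[u']" "[w', z']"] z' len assms(2) by simp
  then have "R (p @ [z, w]) (q @ [z', w'])" using R_swap assms(2) by simp
  ultimately show ?case using presD[OF assms(1)] step by (meson converse_rtranclp_into_rtranclp)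
qed

lemma pres_rtranclp:
  assumes "pres p q Q Q'" "length p + 3 \<le> K" "\<And>u w. Q u w \<Longrightarrow> u \<in> U" "\<And>u w. Q' u w \<Longrightarrow> u \<in> U"
  shows "pres p q Q\<^sup>*\<^sup>* Q'\<^sup>*\<^sup>*"
proof -
  have len: "length p = length q" using assms(1) by (simp add: pres_def)
  show ?thesis unfolding pres_def
  proof (intro conjI len allI impI iffI)
    fix u w u' w' assume R: "R (p @ [u, w]) (q @ [u', w'])"
    show "Q'\<^sup>*\<^sup>* u' w'" if "Q\<^sup>*\<^sup>* u w" using pres_rtranclp_imp[OF assms(1-3) that R] .
    show "Q\<^sup>*\<^sup>* u w" if "Q'\<^sup>*\<^sup>* u' w'"
      using pres_rtranclp_imp[OF pres_sym[OF assms(1)] _ assms(4) that R_sym[OF R]] len assms(2) by simp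
  qed
qed

text \<open>A type is the set of all equivalent tuples. Types over different parameter lists can
  thus be compared by equality and used as colours.\<close>

definition tp :: "'a list \<Rightarrow> 'a \<Rightarrow> 'a list set" where "tp p u = {z. R (p @ [u]) z}"

lemma tp_eq_iff:
  assumes "set p \<subseteq> U" "set q \<subseteq> U" "u \<in> U" "w \<in> U" "length p < K" "length q < K"
  shows "tp p u = tp q w \<longleftrightarrow> R (p @ [u]) (q @ [w])"
proof
  assume "tp p u = tp q w"
  moreover have "R (q @ [w]) (q @ [w])" using assms by (intro R_refl) auto
  ultimately show "R (p @ [u]) (q @ [w])" by (auto simp: tp_def)
next
  assume "R (p @ [u]) (q @ [w])"
  then show "tp p u = tp q w" unfolding tp_def using R_sym R_trans by blast
qed

text \<open>The bijection comes from \<open>R_ext\<close> before any relation is chosen, so a single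
  one serves all preserved relations. In particular, a type determines the number of vertices
  related to its vertex.\<close>

lemma pres_bij:
  assumes "R (p @ [u]) (q @ [u'])" "length p + 2 \<le> K"
  obtains f where "bij_betw f U U" "\<And>y. y \<in> U \<Longrightarrow> R (p @ [u, y]) (q @ [u', f y])"
    "\<And>Q Q'. pres p q Q Q' \<Longrightarrow> bij_betw f {y \<in> U. Q u y} {y \<in> U. Q' u' y}"
    "\<And>y. y \<in> U \<Longrightarrow> R (p @ [y]) (q @ [f y])"
proof -
  obtain f where f: "bij_betw f U U" "\<And>y. y \<in> U \<Longrightarrow> R ((p @ [u]) @ [y]) ((q @ [u']) @ [f y])"
    using R_ext[OF assms(1)] assms(2) by fastforce
  have len: "length p = length q" using R_dom[OF assms(1)] by simp
  have f2: "R (p @ [u, y]) (q @ [u', f y])" if "y \<in> U" for y using f(2)[OF that] by simp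
  have "bij_betw f {y \<in> U. Q u y} {y \<in> U. Q' u' y}" if Q: "pres p q Q Q'" for Q Q'
  proof -
    have *: "Q u y \<longleftrightarrow> Q' u' (f y)" if "y \<in> U" for y using presD[OF Q f2[OF that]] .
    have f': "inj_on f U" "f ` U = U" using f(1) by (auto simp: bij_betw_def)
    have "f ` {y \<in> U. Q u y} = {y \<in> U. Q' u' y}"
    proof (intro equalityI subsetI)
      show "z \<in> {y \<in> U. Q' u' y}" if "z \<in> f ` {y \<in> U. Q u y}" for z
        using that * bij_betwE[OF f(1)] by auto
      show "z \<in> f ` {y \<in> U. Q u y}" if "z \<in> {y \<in> U. Q' u' y}" for z
      proof -
        have "z \<in> f ` U" using that by (simp add: f'(2))
        then obtain y where "y \<in> U" "z = f y" by blast
        then show ?thesis using that * by blast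
      qed
    qed
    moreover have "inj_on f {y \<in> U. Q u y}" using f'(1) by (rule inj_on_subset) blast
    ultimately show ?thesis by (simp add: bij_betw_def)
  qed
  moreover have "R (p @ [y]) (q @ [f y])" if "y \<in> U" for y
    using R_drop[of p "[u]" "[y]" q "[u']" "[f y]"] f2[OF that] len assms(2) by simp
  ultimately show ?thesis using that f(1) f2 by blast
qed

text \<open>Provides the hypothesis of \<open>class_matching\<close> on single classes, with types
  as colours.\<close>

lemma pres_tp_mset:
  assumes "R (p @ [u]) (q @ [u'])" "length p + 2 \<le> K" "pres p q Q Q'"
  shows "image_mset (tp p) (mset_set {y \<in> U. Q u y}) = image_mset (tp q) (mset_set {y \<in> U. Q' u' y})"
proof -
  obtain f where f: "bij_betw f U U" "bij_betw f {y \<in> U. Q u y} {y \<in> U. Q' u' y}"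
    "\<And>y. y \<in> U \<Longrightarrow> R (p @ [y]) (q @ [f y])"
    by (rule pres_bij[OF assms(1,2)]) (use assms(3) in blast)
  show ?thesis
  proof (rule image_mset_bij[OF f(2)])
    fix y assume "y \<in> {y \<in> U. Q u y}"
    then have "R (p @ [y]) (q @ [f y])" using f(3) by blast
    then show "tp q (f y) = tp p y" unfolding tp_def using R_sym R_trans by blast
  qed
qed

section \<open>Disagreement arrows and their strong components\<close>

definition match :: "'a list \<Rightarrow> 'a \<Rightarrow> 'a \<Rightarrow> bool" where
  "match B u a \<longleftrightarrow> (\<forall>b \<in> set B. E u b \<longleftrightarrow> E a b)"

text \<open>If no entry of \<open>A\<close> matches \<open>u\<close>, the last condition is vacuous
  and \<open>u\<close> has arrows to its whole side. With empty lists this makes a side one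
  component, the starting point at the top level.\<close>

definition arr :: "'a list \<Rightarrow> 'a list \<Rightarrow> 'a \<Rightarrow> 'a \<Rightarrow> bool" where
  "arr A B u w \<longleftrightarrow> u \<in> U \<and> w \<in> U \<and> S u w \<and> (\<forall>a \<in> set A. match B u a \<longrightarrow> (E u w \<longleftrightarrow> \<not> E a w))"

abbreviation reach :: "'a list \<Rightarrow> 'a list \<Rightarrow> 'a \<Rightarrow> 'a \<Rightarrow> bool" where
  "reach A B \<equiv> (arr A B)\<^sup>*\<^sup>*"

definition scc :: "'a list \<Rightarrow> 'a list \<Rightarrow> 'a \<Rightarrow> 'a \<Rightarrow> bool" where
  "scc A B u w \<longleftrightarrow> reach A B u w \<and> reach A B w u"

text \<open>At most one entry of \<open>A\<close> can then match a given vertex, so agreement and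
  disagreement refer to one definite representative.\<close>

definition indep :: "'a list \<Rightarrow> 'a list \<Rightarrow> bool" where
  "indep A B \<longleftrightarrow> (\<forall>a \<in> set A. \<forall>a' \<in> set A. match B a a' \<longrightarrow> a = a')"

lemma scc_equiv: "equivp (scc A B)"
proof (rule equivpI)
  show "reflp (scc A B)" "symp (scc A B)" by (auto simp: reflp_def symp_def scc_def)
  show "transp (scc A B)"
  proof (rule transpI)
    fix x y z assume "scc A B x y" "scc A B y z"
    then show "scc A B x z"
      using rtranclp_trans[of "arr A B" x y z] rtranclp_trans[of "arr A B" z y x] by (simp add: scc_def)
  qed
qed

lemma scc_rules:
  shows "scc A B u u" "scc A B u w \<Longrightarrow> scc A B w u" "scc A B u w \<Longrightarrow> scc A B w z \<Longrightarrow> scc A B u z"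
  by (fact equivp_reflp[OF scc_equiv] equivp_symp[OF scc_equiv] equivp_transp[OF scc_equiv])+

lemma reach_S: "reach A B u w \<Longrightarrow> S u w"
proof (induction rule: rtranclp_induct)
  case base
  show ?case by (rule S_rules(1))
next
  case (step y z)
  then show ?case using S_rules(3)[of u y z] by (simp add: arr_def)
qed

lemma reach_U: "reach A B u w \<Longrightarrow> u \<in> U \<Longrightarrow> w \<in> U"
  by (induction rule: rtranclp_induct) (auto simp: arr_def)

lemma R_atom_at:
  assumes "R ((A @ B) @ c) ((A' @ B') @ c')" "length A = length A'" "length B = length B'"
  shows "i < length A \<Longrightarrow> k < length c \<Longrightarrow> E (A ! i) (c ! k) \<longleftrightarrow> E (A' ! i) (c' ! k)"
    "j < length B \<Longrightarrow> k < length c \<Longrightarrow> E (c ! k) (B ! j) \<longleftrightarrow> E (c' ! k) (B' ! j)"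
    "i < length A \<Longrightarrow> j < length B \<Longrightarrow> E (A ! i) (B ! j) \<longleftrightarrow> E (A' ! i) (B' ! j)"
    "k < length c \<Longrightarrow> l < length c \<Longrightarrow> (E (c ! k) (c ! l) \<longleftrightarrow> E (c' ! k) (c' ! l)) \<and> (S (c ! k) (c ! l) \<longleftrightarrow> S (c' ! k) (c' ! l))"
    "i < length A \<Longrightarrow> i' < length A \<Longrightarrow> A ! i = A ! i' \<longleftrightarrow> A' ! i = A' ! i'"
proof -
  note at = R_atom[OF assms(1)]
  show "i < length A \<Longrightarrow> k < length c \<Longrightarrow> E (A ! i) (c ! k) \<longleftrightarrow> E (A' ! i) (c' ! k)"
    using at[of i "length A + length B + k"] assms(2,3) by (simp add: nth_append)
  show "j < length B \<Longrightarrow> k < length c \<Longrightarrow> E (c ! k) (B ! j) \<longleftrightarrow> E (c' ! k) (B' ! j)"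
    using at[of "length A + length B + k" "length A + j"] assms(2,3) by (simp add: nth_append)
  show "i < length A \<Longrightarrow> j < length B \<Longrightarrow> E (A ! i) (B ! j) \<longleftrightarrow> E (A' ! i) (B' ! j)"
    using at[of i "length A + j"] assms(2,3) by (simp add: nth_append)
  show "k < length c \<Longrightarrow> l < length c \<Longrightarrow> (E (c ! k) (c ! l) \<longleftrightarrow> E (c' ! k) (c' ! l)) \<and> (S (c ! k) (c ! l) \<longleftrightarrow> S (c' ! k) (c' ! l))"
    using at[of "length A + length B + k" "length A + length B + l"] assms(2,3) by (simp add: nth_append)
  show "i < length A \<Longrightarrow> i' < length A \<Longrightarrow> A ! i = A ! i' \<longleftrightarrow> A' ! i = A' ! i'"
    using at[of i i'] assms(2,3) by (simp add: nth_append)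
qed

lemma match_nth: "match B u a \<longleftrightarrow> (\<forall>j < length B. E u (B ! j) \<longleftrightarrow> E a (B ! j))"
  by (auto simp: match_def all_set_conv_all_nth)

lemma R_match:
  assumes "R ((A @ B) @ c) ((A' @ B') @ c')" "length A = length A'" "length B = length B'"
    "i < length A" "k < length c"
  shows "match B (c ! k) (A ! i) \<longleftrightarrow> match B' (c' ! k) (A' ! i)"
  using R_atom_at(2,3)[OF assms(1-3)] assms(3-) by (simp add: match_nth)

lemma R_indep:
  assumes "R ((A @ B) @ c) ((A' @ B') @ c')" "length A = length A'" "length B = length B'" "indep A B"
  shows "indep A' B'"
proof -
  have "match B (A ! i) (A ! i') \<longleftrightarrow> match B' (A' ! i) (A' ! i')" if "i < length A" "i' < length A" for i i'
    using R_atom_at(3)[OF assms(1-3)] that assms(3) by (simp add: match_nth)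
  then show ?thesis using assms(2,4) R_atom_at(5)[OF assms(1-3)]
    by (simp add: indep_def all_set_conv_all_nth)
qed

lemma pres_arr:
  assumes "length A = length A'" "length B = length B'"
  shows "pres (A @ B) (A' @ B') (arr A B) (arr A' B')"
  unfolding pres_def
proof (intro conjI allI impI)
  show "length (A @ B) = length (A' @ B')" using assms by simp
  fix u w u' w' assume R: "R ((A @ B) @ [u, w]) ((A' @ B') @ [u', w'])"
  have "match B u (A ! i) \<longleftrightarrow> match B' u' (A' ! i)" if "i < length A" for i
    using R_match[OF R assms that, of 0] by simp
  moreover have "E (A ! i) w \<longleftrightarrow> E (A' ! i) w'" if "i < length A" for i
    using R_atom_at(1)[OF R assms that, of 1] by simp
  moreover have "E u w \<longleftrightarrow> E u' w'" "S u w \<longleftrightarrow> S u' w'"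
    using R_atom_at(4)[OF R assms, of 0 1] by simp_all
  ultimately show "arr A B u w \<longleftrightarrow> arr A' B' u' w'"
    using R_dom[OF R] assms by (simp add: arr_def all_set_conv_all_nth)
qed

lemma pres_reach:
  assumes "length A = length A'" "length B = length B'" "length A + length B + 3 \<le> K"
  shows "pres (A @ B) (A' @ B') (reach A B) (reach A' B')"
  using assms by (intro pres_rtranclp pres_arr) (auto simp: arr_def)

lemma pres_scc:
  assumes "length A = length A'" "length B = length B'" "length A + length B + 3 \<le> K"
  shows "pres (A @ B) (A' @ B') (scc A B) (scc A' B')"
  unfolding scc_def using assms by (intro pres_conj pres_reach pres_converse) auto

text \<open>The sets reachable from two vertices of the same type have the same size, so none of them
  is a proper subset of the other.\<close>

lemma reach_back:
  assumes "R ((A @ B) @ [d]) ((A @ B) @ [d2])" "length A + length B + 3 \<le> K"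
    and "reach A B d e" "reach A B e d2"
  shows "reach A B e d"
proof -
  have d: "d \<in> U" "d2 \<in> U" using R_dom[OF assms(1)] by auto
  have "length (A @ B) + 2 \<le> K" using assms(2) by simp
  then obtain f where "bij_betw f {y \<in> U. reach A B d y} {y \<in> U. reach A B d2 y}"
    by (rule pres_bij[OF assms(1)]) (use pres_reach[OF refl refl assms(2)] in blast)
  then have "card {y \<in> U. reach A B d y} = card {y \<in> U. reach A B d2 y}"
    by (rule bij_betw_same_card)
  moreover have "{y \<in> U. reach A B d2 y} \<subseteq> {y \<in> U. reach A B d y}"
    using rtranclp_trans[OF assms(3)] rtranclp_trans[OF assms(4)] by blast
  ultimately have "{y \<in> U. reach A B d2 y} = {y \<in> U. reach A B d y}"
    using finite_U by (intro card_subset_eq) auto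
  then have "reach A B d2 d" using d by auto
  then show ?thesis using rtranclp_trans[OF assms(4)] by blast
qed

text \<open>An arrow from \<open>x\<close> to \<open>y\<close> lets \<open>d\<close> reach
  \<open>e\<close>; one from \<open>y'\<close> to \<open>x'\<close> lets \<open>e'\<close> reach
  \<open>d'\<close>. Carrying \<open>d'\<close> over to the first side gives a vertex
  \<open>d2\<close> of the type of \<open>d\<close> that \<open>e\<close> reaches, and
  \<open>reach_back\<close> closes a cycle through \<open>d\<close> and \<open>e\<close>. Types are
  needed for the representatives \<open>d\<close> and \<open>e\<close> only.\<close>

lemma no_opposite_arrows:
  assumes R: "R ((A @ B) @ [d]) ((A' @ B') @ [d'])" "R ((A @ B) @ [e]) ((A' @ B') @ [e'])"
    and len: "length A = length A'" "length B = length B'" "length A + length B + 3 \<le> K"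
    and "scc A B x d" "scc A B y e" "scc A' B' x' d'" "scc A' B' y' e'" "\<not> scc A B x y"
    and "arr A B x y"
  shows "\<not> arr A' B' y' x'"
proof
  assume "arr A' B' y' x'"
  then have e': "reach A' B' e' d'"
    using assms(8,9) rtranclp_trans rtranclp.rtrancl_into_rtrancl[of _ e' y' x'] unfolding scc_def by metis
  have "R ((A' @ B') @ [e']) ((A @ B) @ [e])" using R_sym R(2) by blast
  moreover have "set [d'] \<subseteq> U" using R_dom[OF R(1)] by simp
  ultimately obtain d2 where d2: "R (((A' @ B') @ [e']) @ [d']) (((A @ B) @ [e]) @ [d2])"
    using R_extend[of "(A' @ B') @ [e']" "(A @ B) @ [e]" "[d']"] len by (auto simp: length_Suc_conv)
  then have "reach A B e d2"
    using presD[OF pres_reach[OF len], of e d2 e' d'] R_sym e' by simp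
  moreover have "R ((A' @ B') @ [d']) ((A @ B) @ [d2])"
    using R_drop[of "A' @ B'" "[e']" "[d']" "A @ B" "[e]" "[d2]"] d2 len by simp
  then have "R ((A @ B) @ [d]) ((A @ B) @ [d2])" using R_trans R(1) by blast
  moreover have "reach A B d e"
    using assms(6,7,11) rtranclp_trans rtranclp.rtrancl_into_rtrancl[of _ d x y] unfolding scc_def by metis
  ultimately have "reach A B e d" using reach_back len(3) by blast
  then have "scc A B d e" using \<open>reach A B d e\<close> by (simp add: scc_def)
  then show False using assms(6,7,10) scc_rules by metis
qed

text \<open>Some \<open>A ! i\<close> matches \<open>x\<close> and agrees with it at
  \<open>y\<close>. By the adjacencies to \<open>B\<close>, the entry \<open>A' ! i\<close> matches
  \<open>x'\<close>, and by independence it is the only one to do so. Both adjacencies are then read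
  off those of \<open>y\<close> and \<open>y'\<close> to the entry \<open>i\<close>. No types of
  \<open>x\<close> and \<open>y\<close> enter, only their adjacency to the parameters.\<close>

lemma edge_without_arrow:
  assumes R: "R ((A @ B) @ c) ((A' @ B') @ c')"
    and len: "length A = length A'" "length B = length B'"
    and ind: "indep A B"
    and x: "\<And>j. j < length B \<Longrightarrow> E x (B ! j) \<longleftrightarrow> E x' (B' ! j)"
    and y: "\<And>i. i < length A \<Longrightarrow> E y (A ! i) \<longleftrightarrow> E y' (A' ! i)"
    and S: "S x y" "S x' y'" and U: "x \<in> U" "y \<in> U" "x' \<in> U" "y' \<in> U"
    and na: "\<not> arr A B x y" "\<not> arr A' B' x' y'"
  shows "E x y \<longleftrightarrow> E x' y'"
proof -
  obtain i where i: "i < length A" "match B x (A ! i)" "E x y \<longleftrightarrow> E (A ! i) y"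
    using na(1) S(1) U by (auto simp: arr_def in_set_conv_nth)
  obtain i' where i': "i' < length A" "match B' x' (A' ! i')" "E x' y' \<longleftrightarrow> E (A' ! i') y'"
    using na(2) S(2) U len by (auto simp: arr_def in_set_conv_nth)
  have "match B' x' (A' ! i)"
    using i(1,2) x R_atom_at(3)[OF R len] len by (simp add: match_nth)
  with i' have "match B' (A' ! i) (A' ! i')" by (simp add: match_def)
  then have "A' ! i = A' ! i'" using R_indep[OF R len ind] i(1) i'(1) len by (simp add: indep_def)
  then show ?thesis using i(3) i'(3) y[OF i(1)] E_comm[of y] E_comm[of y'] by simp
qed

text \<open>Arrows between different components run in at most one direction on either side, and not
  in opposite directions on the two sides. So in one of the two orders of the pair both sides lack
  an arrow, and \<open>edge_without_arrow\<close> applies in that order.\<close>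

lemma cross_edge:
  assumes R: "R ((A @ B) @ [d]) ((A' @ B') @ [d'])" "R ((A @ B) @ [e]) ((A' @ B') @ [e'])"
    and len: "length A = length A'" "length B = length B'" "length A + length B + 3 \<le> K"
    and ind: "indep A B"
    and scc: "scc A B x d" "scc A B y e" "scc A' B' x' d'" "scc A' B' y' e'" "\<not> scc A B x y" "\<not> scc A' B' x' y'"
    and x: "\<And>i. i < length (A @ B) \<Longrightarrow> E x ((A @ B) ! i) \<longleftrightarrow> E x' ((A' @ B') ! i)"
    and y: "\<And>i. i < length (A @ B) \<Longrightarrow> E y ((A @ B) ! i) \<longleftrightarrow> E y' ((A' @ B') ! i)"
    and S: "S x y" "S x' y'" and U: "x \<in> U" "y \<in> U" "x' \<in> U" "y' \<in> U"
  shows "E x y \<longleftrightarrow> E x' y'"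
proof -
  have xy: "E x (B ! j) \<longleftrightarrow> E x' (B' ! j)" "E y (B ! j) \<longleftrightarrow> E y' (B' ! j)" if "j < length B" for j
    using x[of "length A + j"] y[of "length A + j"] that len by (simp_all add: nth_append)
  have xyA: "E x (A ! j) \<longleftrightarrow> E x' (A' ! j)" "E y (A ! j) \<longleftrightarrow> E y' (A' ! j)" if "j < length A" for j
    using x[of j] y[of j] that len by (simp_all add: nth_append)
  have fwd: ?thesis if "\<not> arr A B x y" "\<not> arr A' B' x' y'"
    using edge_without_arrow[OF R(1) len(1,2) ind xy(1) xyA(2) S U that] .
  have bwd: ?thesis if "\<not> arr A B y x" "\<not> arr A' B' y' x'"
    using edge_without_arrow[OF R(1) len(1,2) ind xy(2) xyA(1) S_rules(2)[OF S(1)] S_rules(2)[OF S(2)] U(2,1,4,3) that]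
      E_comm[of x y] E_comm[of x' y'] by simp
  have 1: "\<not> arr A' B' y' x'" if "arr A B x y"
    using no_opposite_arrows[OF R len scc(1-5) that] .
  have 2: "\<not> arr A' B' x' y'" if "arr A B y x"
    using no_opposite_arrows[OF R(2,1) len scc(2,1,4,3) _ that] scc(5) scc_rules(2)[of A B y x] by blast
  have 3: "\<not> (arr A B x y \<and> arr A B y x)" "\<not> (arr A' B' x' y' \<and> arr A' B' y' x')"
    using scc(5,6) by (auto simp: scc_def)
  show ?thesis using fwd bwd 1 2 3 by blast
qed

section \<open>Isomorphisms assembled from components\<close>

abbreviation scc_iso :: "'a list \<Rightarrow> 'a list \<Rightarrow> 'a \<Rightarrow> 'a list \<Rightarrow> 'a list \<Rightarrow> 'a \<Rightarrow> bool" where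
  "scc_iso A B v A' B' v' \<equiv> \<exists>\<theta>. bij_betw \<theta> {w. scc A B v w} {w. scc A' B' v' w} \<and>
        (\<forall>x. scc A B v x \<longrightarrow> (\<forall>y. scc A B v y \<longrightarrow> (E x y \<longleftrightarrow> E (\<theta> x) (\<theta> y)))) \<and>
        (\<forall>x. scc A B v x \<longrightarrow> (\<forall>i < length (A @ B). E x ((A @ B) ! i) \<longleftrightarrow> E (\<theta> x) ((A' @ B') ! i)))"

text \<open>Only the unprimed side is tied to \<open>X\<close>; of the primed side just the lengths
  and the equality of types are assumed. Quantifying over all parameters and base vertices lets the
  union step choose the parameters of the subparts. The isomorphism keeps adjacency to the
  parameters, which is what gluing needs and reproduces.\<close>

definition locally_isomorphic :: "'a set \<Rightarrow> bool" where
  "locally_isomorphic X \<longleftrightarrow> (\<forall>A B A' B' v v'.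
     set A \<subseteq> X \<longrightarrow> set B \<subseteq> U - X \<longrightarrow> length A \<le> 3 \<longrightarrow> length B \<le> 3 \<longrightarrow> length A = length A' \<longrightarrow>
     length B = length B' \<longrightarrow> indep A B \<longrightarrow> {w. scc A B v w} \<subseteq> X \<longrightarrow>
     R ((A @ B) @ [v]) ((A' @ B') @ [v']) \<longrightarrow>
     scc_iso A B v A' B' v')"

lemma scc_class_eq: "scc A B u w \<Longrightarrow> {z. scc A B u z} = {z. scc A B w z}"
  using scc_rules by blast

lemma locally_isomorphicD:
  assumes "locally_isomorphic X" "set A \<subseteq> X" "set B \<subseteq> U - X" "length A \<le> 3" "length B \<le> 3" "length A = length A'"
     "length B = length B'" "indep A B" "{w. scc A B v w} \<subseteq> X"
     "R ((A @ B) @ [v]) ((A' @ B') @ [v'])"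
  shows "scc_iso A B v A' B' v'"
  using assms(1)[unfolded locally_isomorphic_def, rule_format, OF assms(2-)] .

text \<open>The given \<open>g\<close> preserves types only; \<open>class_matching\<close> replaces
  it by an \<open>h\<close> that also carries components to components. The hypothesis on
  \<open>X\<close> supplies an isomorphism for every component, based at a representative and its
  image under \<open>h\<close>. Edges inside components are then correct, and
  \<open>cross_edge\<close> settles the others. \<open>P\<close> and \<open>Q\<close> may contain
  further parameters, which \<open>sub\<close> forgets.\<close>

lemma glue_sccs:
  assumes IH: "locally_isomorphic X"
    and A: "set A \<subseteq> X" "set B \<subseteq> U - X" "length A \<le> 3" "length B \<le> 3" "indep A B"
    and A': "length A = length A'" "length B = length B'"
    and P: "set P \<subseteq> U" "set Q \<subseteq> U" "length P = length Q" "length P + 2 \<le> K" "9 \<le> K"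
    and sub: "\<And>u u'. R (P @ [u]) (Q @ [u']) \<Longrightarrow> R ((A @ B) @ [u]) ((A' @ B') @ [u'])"
    and pres: "pres P Q (scc A B) (scc A' B')"
    and C: "C \<subseteq> X \<inter> U" "\<And>u w. u \<in> C \<Longrightarrow> scc A B u w \<Longrightarrow> w \<in> C"
    and D: "D \<subseteq> U" "\<And>u w. u \<in> D \<Longrightarrow> scc A' B' u w \<Longrightarrow> w \<in> D"
    and S: "\<And>x y. x \<in> C \<Longrightarrow> y \<in> C \<Longrightarrow> S x y" "\<And>x y. x \<in> D \<Longrightarrow> y \<in> D \<Longrightarrow> S x y"
    and g: "bij_betw g C D" "\<And>u. u \<in> C \<Longrightarrow> R (P @ [u]) (Q @ [g u])"
  shows "\<exists>\<theta>. bij_betw \<theta> C D \<and> (\<forall>x \<in> C. \<forall>y \<in> C. E x y \<longleftrightarrow> E (\<theta> x) (\<theta> y)) \<and>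
    (\<forall>x \<in> C. \<forall>i < length (A @ B). E x ((A @ B) ! i) \<longleftrightarrow> E (\<theta> x) ((A' @ B') ! i))"
proof -
  have fin: "finite C" "finite D" using C(1) D(1) finite_U finite_subset by blast+
  have tp_iff: "tp P u = tp Q w \<longleftrightarrow> R (P @ [u]) (Q @ [w])" if "u \<in> C" "w \<in> D" for u w
    using that C(1) D(1) P by (intro tp_eq_iff) auto
  have "image_mset (tp P) (mset_set C) = image_mset (tp Q) (mset_set D)"
  proof (rule image_mset_bij[OF g(1)])
    fix y assume "y \<in> C"
    then show "tp Q (g y) = tp P y" using g(2) bij_betwE[OF g(1)] tp_iff[of y "g y"] by simp
  qed
  moreover have "image_mset (tp P) (mset_set {y \<in> C. scc A B x y}) = image_mset (tp Q) (mset_set {y \<in> D. scc A' B' x' y})"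
    if x: "x \<in> C" "x' \<in> D" "tp P x = tp Q x'" for x x'
  proof -
    have "{y \<in> C. scc A B x y} = {y \<in> U. scc A B x y}" using C x(1) by blast
    moreover have "{y \<in> D. scc A' B' x' y} = {y \<in> U. scc A' B' x' y}" using D x(2) by blast
    moreover have "R (P @ [x]) (Q @ [x'])" using x tp_iff by blast
    ultimately show ?thesis using pres_tp_mset[OF _ P(4) pres] by simp
  qed
  ultimately have "\<exists>h. bij_betw h C D \<and> (\<forall>x \<in> C. tp Q (h x) = tp P x) \<and>
      (\<forall>x \<in> C. \<forall>y \<in> C. scc A B x y \<longleftrightarrow> scc A' B' (h x) (h y))"
    by (rule class_matching[OF fin _ scc_equiv scc_equiv])
  then obtain h where h: "bij_betw h C D" "\<forall>x \<in> C. tp Q (h x) = tp P x"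
    "\<forall>x \<in> C. \<forall>y \<in> C. scc A B x y \<longleftrightarrow> scc A' B' (h x) (h y)" by auto
  have hD: "h x \<in> D" if "x \<in> C" for x using that h(1) by (auto simp: bij_betw_def)
  have hR: "R ((A @ B) @ [x]) ((A' @ B') @ [h x])" if "x \<in> C" for x
    using bspec[OF h(2) that] tp_iff[OF that hD[OF that]] sub[of x "h x"] by simp
  define good where "good x t \<longleftrightarrow> bij_betw t {w. scc A B x w} {w. scc A' B' (h x) w} \<and>
        (\<forall>z. scc A B x z \<longrightarrow> (\<forall>y. scc A B x y \<longrightarrow> (E z y \<longleftrightarrow> E (t z) (t y)))) \<and>
        (\<forall>z. scc A B x z \<longrightarrow> (\<forall>i < length (A @ B). E z ((A @ B) ! i) \<longleftrightarrow> E (t z) ((A' @ B') ! i)))" for x t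
  have "\<exists>t. good x t" if "x \<in> C" for x
  proof -
    have "{w. scc A B x w} \<subseteq> X" using subsetD[OF C(1) C(2)[OF that]] by blast
    then show ?thesis unfolding good_def by (rule locally_isomorphicD[OF IH A(1-4) A' A(5) _ hR[OF that]])
  qed
  then have "\<forall>x \<in> C. \<exists>t. good x t" by simp
  then obtain t0 where t0: "\<forall>x \<in> C. good x (t0 x)" by (rule bchoice[THEN exE])
  have t: "bij_betw (t0 x) {w. scc A B x w} {w. scc A' B' (h x) w}"
    "scc A B x z \<Longrightarrow> scc A B x y \<Longrightarrow> E z y \<longleftrightarrow> E (t0 x z) (t0 x y)"
    "scc A B x z \<Longrightarrow> i < length (A @ B) \<Longrightarrow> E z ((A @ B) ! i) \<longleftrightarrow> E (t0 x z) ((A' @ B') ! i)"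
    if "x \<in> C" for x y z i
    using bspec[OF t0 that] unfolding good_def by simp_all
  \<comment> \<open>All vertices of a component must use the same local isomorphism. The choice
    depends only on the predicate \<open>scc A B u\<close>, so it is constant on components.\<close>
  define rep where "rep u = (SOME w. scc A B u w)" for u
  have rep: "scc A B u (rep u)" for u
    unfolding rep_def using scc_rules(1) by (rule someI)
  have repC: "rep u \<in> C" if "u \<in> C" for u using C(2)[OF that rep] .
  have rep_eq: "rep u = rep w" if "scc A B u w" for u w
  proof -
    have "scc A B u = scc A B w" using scc_class_eq[OF that] by (simp add: set_eq_iff fun_eq_iff)
    then show ?thesis by (simp add: rep_def)
  qed
  define \<theta> where "\<theta> u = t0 (rep u) u" for u
  have \<theta>_class: "scc A' B' (h (rep u)) (\<theta> u)" if "u \<in> C" for u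
    using bij_betwE[OF t(1)[OF repC[OF that]]] scc_rules(2)[OF rep] by (auto simp: \<theta>_def)
  have \<theta>D: "\<theta> u \<in> D" if "u \<in> C" for u using D(2)[OF hD[OF repC[OF that]] \<theta>_class[OF that]] .
  have \<theta>_scc: "scc A B u w" if "u \<in> C" "w \<in> C" "scc A' B' (\<theta> u) (\<theta> w)" for u w
  proof -
    have "scc A' B' (h (rep u)) (h (rep w))"       using scc_rules(3)[OF scc_rules(3)[OF \<theta>_class[OF that(1)] that(3)] scc_rules(2)[OF \<theta>_class[OF that(2)]]] .
    then have "scc A B (rep u) (rep w)" using h(3) repC that by blast
    then show ?thesis using scc_rules(3)[OF scc_rules(3)[OF rep[of u]] scc_rules(2)[OF rep[of w]]] by simp
  qed
  have "inj_on \<theta> C"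
  proof (rule inj_onI)
    fix u w assume uw: "u \<in> C" "w \<in> C" "\<theta> u = \<theta> w"
    have "scc A B u w" by (rule \<theta>_scc[OF uw(1,2)]) (simp add: uw(3) scc_rules(1))
    then have eq: "rep u = rep w" by (rule rep_eq)
    moreover have "scc A B (rep u) u" "scc A B (rep u) w"
      using scc_rules(2)[OF rep[of u]] scc_rules(2)[OF rep[of w]] eq by simp_all
    ultimately show "u = w" using t(1)[OF repC[OF uw(1)]] uw(3) unfolding \<theta>_def bij_betw_def inj_on_def by simp
  qed
  moreover have "D \<subseteq> \<theta> ` C"
  proof
    fix y assume "y \<in> D"
    then obtain u where u: "u \<in> C" "y = h u" using h(1) by (auto simp: bij_betw_def)
    have "scc A' B' (h (rep u)) y"
      using bspec[OF bspec[OF h(3) repC[OF u(1)]] u(1)] u(2) scc_rules(2)[OF rep[of u]] by simp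
    then obtain w where w: "scc A B (rep u) w" "y = t0 (rep u) w"
      using bij_betw_imp_surj_on[OF t(1)[OF repC[OF u(1)]]] by auto
    have "w \<in> C" using C(2)[OF repC[OF u(1)] w(1)] .
    moreover have "rep w = rep u" using rep_eq[OF w(1)] rep_eq[OF rep[of u]] by simp
    ultimately show "y \<in> \<theta> ` C" using w(2) by (intro image_eqI[of _ _ w]) (simp_all add: \<theta>_def)
  qed
  ultimately have "bij_betw \<theta> C D" using \<theta>D by (auto simp: bij_betw_def)
  moreover have \<theta>_adj: "E x ((A @ B) ! i) \<longleftrightarrow> E (\<theta> x) ((A' @ B') ! i)" if "x \<in> C" "i < length (A @ B)" for x i
    using t(3)[OF repC[OF that(1)] scc_rules(2)[OF rep] that(2)] by (simp add: \<theta>_def)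
  moreover have "E x y \<longleftrightarrow> E (\<theta> x) (\<theta> y)" if xy: "x \<in> C" "y \<in> C" for x y
  proof (cases "scc A B x y")
    case True
    have "scc A B (rep x) x" "scc A B (rep x) y"
      using scc_rules(2)[OF rep[of x]] scc_rules(2)[OF rep[of y]] rep_eq[OF True] by simp_all
    then show ?thesis using t(2)[OF repC[OF xy(1)], of x y] rep_eq[OF True] by (simp add: \<theta>_def)
  next
    case False
    have "\<not> scc A' B' (\<theta> x) (\<theta> y)" using \<theta>_scc[OF xy] False by blast
    moreover have "length A + length B + 3 \<le> K" using A(3,4) P(5) by simp
    moreover have "\<theta> x \<in> D" "\<theta> y \<in> D" using \<theta>D xy by simp_all
    ultimately show ?thesis
      using cross_edge[OF hR[OF repC[OF xy(1)]] hR[OF repC[OF xy(2)]] A' _ A(5) rep rep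
        scc_rules(2)[OF \<theta>_class[OF xy(1)]] scc_rules(2)[OF \<theta>_class[OF xy(2)]] False _ \<theta>_adj[OF xy(1)] \<theta>_adj[OF xy(2)]]
        S(1)[OF xy] S(2)[of "\<theta> x" "\<theta> y"] xy subsetD[OF C(1)] subsetD[OF D(1)] by simp
  qed
  ultimately show ?thesis by blast
qed

section \<open>Parameters for parts with few outside neighbourhoods\<close>

definition few_classes :: "'a set \<Rightarrow> bool" where
  "few_classes X \<longleftrightarrow> card ((\<lambda>u. {w \<in> U - X. E u w}) ` X) \<le> 3"

lemma list_of_few:
  assumes "finite M" "card M \<le> 3"
  obtains ms where "set ms = M" "length ms \<le> 3" "distinct ms"
proof -
  obtain ms where ms: "set ms = M" "distinct ms" using finite_distinct_list[OF assms(1)] by blast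
  show ?thesis by (rule that[OF ms(1) _ ms(2)]) (use distinct_card[OF ms(2)] ms(1) assms(2) in simp)
qed

text \<open>One vertex is taken for each of the three pairs among at most three neighbourhoods,
  namely one in which the two differ.\<close>

lemma separating_list:
  assumes "few_classes X" "X \<subseteq> U"
  obtains B where "set B \<subseteq> U - X" "length B \<le> 3"
    "\<And>u w z. u \<in> X \<Longrightarrow> w \<in> X \<Longrightarrow> match B u w \<Longrightarrow> z \<in> U - X \<Longrightarrow> E u z \<longleftrightarrow> E w z"
proof -
  define M where "M = (\<lambda>u. {w \<in> U - X. E u w}) ` X"
  have fin: "finite M" using assms(2) finite_U by (auto simp: M_def intro: finite_subset)
  have M: "N \<subseteq> U - X" if "N \<in> M" for N using that by (auto simp: M_def)
  have sep: "\<exists>l. length l \<le> 1 \<and> set l \<subseteq> U - X \<and> (N \<noteq> N' \<longrightarrow> (\<exists>z \<in> set l. (z \<in> N) \<noteq> (z \<in> N')))"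
    if "N \<subseteq> U - X" "N' \<subseteq> U - X" for N N'
  proof (cases "N = N'")
    case True
    then show ?thesis by (intro exI[of _ "[]"]) auto
  next
    case False
    then obtain z where "(z \<in> N) \<noteq> (z \<in> N')" by blast
    then show ?thesis using that by (intro exI[of _ "[z]"]) auto
  qed
  have "\<exists>N1 N2 N3. M \<subseteq> {N1, N2, N3} \<and> N1 \<subseteq> U - X \<and> N2 \<subseteq> U - X \<and> N3 \<subseteq> U - X"
  proof -
    have "card M \<le> 3" using assms(1) by (simp add: few_classes_def M_def)
    then obtain ms where ms: "set ms = M" "length ms \<le> 3" by (rule list_of_few[OF fin])
    \<comment> \<open>Missing neighbourhoods are filled up by the empty set, so that always three
      sets are compared.\<close>
    define f where "f i = (if i < length ms then ms ! i else {})" for i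
    have "M \<subseteq> {f 0, f 1, f 2}"
    proof
      fix N assume "N \<in> M"
      then obtain i where i: "i < length ms" "N = ms ! i" using ms(1) by (auto simp: in_set_conv_nth)
      then have "i = 0 \<or> i = 1 \<or> i = 2" using ms(2) by linarith
      moreover have "N = f i" using i by (simp add: f_def)
      ultimately show "N \<in> {f 0, f 1, f 2}" by blast
    qed
    moreover have "f i \<subseteq> U - X" for i
    proof (cases "i < length ms")
      case True
      then have "ms ! i \<in> M" using ms(1) by (metis nth_mem)
      then show ?thesis using True M by (simp add: f_def)
    qed (simp add: f_def)
    ultimately show ?thesis by (intro exI[of _ "f 0"] exI[of _ "f 1"] exI[of _ "f 2"] conjI)
  qed
  then obtain N1 N2 N3 where N: "M \<subseteq> {N1, N2, N3}" "N1 \<subseteq> U - X" "N2 \<subseteq> U - X" "N3 \<subseteq> U - X" by (elim exE conjE)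
  obtain l1 l2 l3 where l: "length l1 \<le> 1" "length l2 \<le> 1" "length l3 \<le> 1"
    "set l1 \<subseteq> U - X" "set l2 \<subseteq> U - X" "set l3 \<subseteq> U - X"
    "N1 \<noteq> N2 \<Longrightarrow> \<exists>z \<in> set l1. (z \<in> N1) \<noteq> (z \<in> N2)"
    "N1 \<noteq> N3 \<Longrightarrow> \<exists>z \<in> set l2. (z \<in> N1) \<noteq> (z \<in> N3)"
    "N2 \<noteq> N3 \<Longrightarrow> \<exists>z \<in> set l3. (z \<in> N2) \<noteq> (z \<in> N3)"
    using sep[OF N(2,3)] sep[OF N(2,4)] sep[OF N(3,4)] by (elim exE conjE) blast
  define B where "B = l1 @ l2 @ l3"
  have sepB: "N = N'" if "N \<in> M" "N' \<in> M" "\<And>z. z \<in> set B \<Longrightarrow> z \<in> N \<longleftrightarrow> z \<in> N'" for N N'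
  proof (rule ccontr)
    assume "N \<noteq> N'"
    then have "\<exists>z \<in> set B. (z \<in> N) \<noteq> (z \<in> N')"
      using l(7-9) subsetD[OF N(1) that(1)] subsetD[OF N(1) that(2)] unfolding B_def by fastforce
    then show False using that(3) by blast
  qed
  have "set B \<subseteq> U - X" "length B \<le> 3" using l(1-6) by (auto simp: B_def)
  moreover have "E u z \<longleftrightarrow> E w z" if uw: "u \<in> X" "w \<in> X" "match B u w" "z \<in> U - X" for u w z
  proof -
    have "{w \<in> U - X. E u w} = {z \<in> U - X. E w z}"
    proof (rule sepB)
      fix z assume z: "z \<in> set B"
      then have "E u z \<longleftrightarrow> E w z" using uw(3) by (simp add: match_def)
      then show "z \<in> {w \<in> U - X. E u w} \<longleftrightarrow> z \<in> {z \<in> U - X. E w z}" by blast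
    qed (use uw in \<open>simp_all add: M_def\<close>)
    then show ?thesis using uw(4) by blast
  qed
  ultimately show ?thesis by (rule that)
qed

text \<open>An entry of \<open>A\<close> matches itself and does not disagree with itself, so no
  arrow leaves it.\<close>

lemma reach_sink:
  assumes "reach A B a w" "a \<in> set A"
  shows "w = a"
  using assms(1)
proof (cases rule: converse_rtranclpE)
  case (step z)
  then show ?thesis using assms(2) by (auto simp: arr_def match_def)
qed simp

text \<open>Components for \<open>A1\<close> and \<open>B1\<close> must not straddle the boundary of
  the component of \<open>v\<close>. An arrow for the new parameters from \<open>u\<close> is an
  arrow for the old ones from \<open>u\<close> or from its representative \<open>rp u\<close>
  (\<open>star\<close>). So the danger lies in a representative that reaches \<open>v\<close>
  although \<open>u\<close> does not, or that reaches \<open>v\<close> from outside its component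
  although \<open>u\<close> lies inside. The order of preference in \<open>ok\<close> excludes
  both.\<close>

lemma nested_parameters:
  assumes X: "X1 \<subseteq> X" "X \<subseteq> U" "few_classes X1" "\<forall>x \<in> X. \<forall>y \<in> X. S x y"
    and A: "set A \<subseteq> X" "set B \<subseteq> U - X" "indep A B"
    and v: "scc A B v c" "c \<noteq> v"
  shows "\<exists>A1 B1. set A1 \<subseteq> X1 \<and> set B1 \<subseteq> U - X1 \<and> length A1 \<le> 3 \<and> length B1 \<le> 3 \<and> indep A1 B1 \<and>
    (\<forall>u \<in> X1. \<forall>w \<in> X1. match B1 u w \<longrightarrow> (\<forall>z \<in> U - X1. E u z \<longleftrightarrow> E w z)) \<and> set A \<inter> X1 \<subseteq> set A1 \<and>
    (\<forall>u \<in> X1. \<forall>w. scc A1 B1 u w \<longrightarrow> w \<in> X1) \<and>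
    (\<forall>u \<in> X1. \<forall>w. scc A B v u \<longrightarrow> scc A1 B1 u w \<longrightarrow> scc A B v w)"
proof -
  have X1U: "X1 \<subseteq> U" using X by blast
  obtain B1 where B1: "set B1 \<subseteq> U - X1" "length B1 \<le> 3"
    and sep: "\<And>u w z. u \<in> X1 \<Longrightarrow> w \<in> X1 \<Longrightarrow> match B1 u w \<Longrightarrow> z \<in> U - X1 \<Longrightarrow> E u z \<longleftrightarrow> E w z"
    using separating_list[OF X(3) X1U] by metis
  define cls where "cls u = {w \<in> U - X1. E u w}" for u
  define M where "M = cls ` X1"
  have "finite M" "card M \<le> 3"
    using X(3) X1U finite_U finite_subset by (auto simp: M_def cls_def few_classes_def)
  then obtain ms where ms: "set ms = M" "length ms \<le> 3" by (rule list_of_few)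
  define to where "to z = reach A B z v" for z
  \<comment> \<open>Entries of \<open>A\<close> are sinks: one that reaches \<open>v\<close> would
    be \<open>v\<close> itself and could not reach \<open>c\<close>.\<close>
  have notoA: "\<not> to a" if "a \<in> set A" for a
  proof
    assume "to a"
    then have "v = a" using reach_sink that by (simp add: to_def)
    moreover have "c = v" using reach_sink[of A B v c] v(1) that \<open>v = a\<close> by (simp add: scc_def)
    ultimately show False using v(2) by simp
  qed
  (* A representative of a class is taken from A if possible, else it does not reach v, else it lies in the component of v. *)
  define ok where "ok N a \<longleftrightarrow> a \<in> X1 \<and> cls a = N \<and> (a \<in> set A \<or> (\<forall>b \<in> set A \<inter> X1. cls b \<noteq> N)) \<and>
    (\<not> to a \<or> ((\<forall>x \<in> X1. cls x = N \<longrightarrow> to x) \<and> (scc A B v a \<or> (\<forall>x \<in> X1. cls x = N \<longrightarrow> \<not> scc A B v x))))" for N a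
  have "\<exists>a. ok N a" if N: "N \<in> M" for N
  proof (cases "\<exists>b \<in> set A \<inter> X1. cls b = N")
    case True
    then show ?thesis using notoA by (auto simp: ok_def)
  next
    case False
    note noA = this
    show ?thesis
    proof (cases "\<exists>x \<in> X1. cls x = N \<and> \<not> to x")
      case True
      then show ?thesis using noA by (auto simp: ok_def)
    next
      case False
      note all_to = this
      show ?thesis
      proof (cases "\<exists>x \<in> X1. cls x = N \<and> scc A B v x")
        case True
        then obtain x where "x \<in> X1" "cls x = N" "scc A B v x" by blast
        then have "ok N x" unfolding ok_def using noA all_to by blast
        then show ?thesis ..
      next
        case False
        obtain x where "x \<in> X1" "cls x = N" using N by (auto simp: M_def)
        then have "ok N x" unfolding ok_def using noA all_to False by blast
        then show ?thesis ..
      qed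
    qed
  qed
  then have "\<forall>N \<in> M. \<exists>a. ok N a" by simp
  then obtain ch where ch: "\<forall>N \<in> M. ok N (ch N)" by (rule bchoice[THEN exE])
  define A1 where "A1 = map ch ms"
  define rp where "rp u = ch (cls u)" for u
  have rp: "rp u \<in> set A1" "rp u \<in> X1" "cls (rp u) = cls u" "ok (cls u) (rp u)" if "u \<in> X1" for u
  proof -
    have "cls u \<in> M" using that by (simp add: M_def)
    then have "ok (cls u) (rp u)" using ch by (simp add: rp_def)
    then show "ok (cls u) (rp u)" "rp u \<in> X1" "cls (rp u) = cls u" by (simp_all add: ok_def)
    show "rp u \<in> set A1" using \<open>cls u \<in> M\<close> ms(1) by (simp add: A1_def rp_def)
  qed
  have A1_rp: "a = rp a" "a \<in> X1" if a: "a \<in> set A1" for a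
  proof -
    obtain N where N: "N \<in> M" "a = ch N" using a ms(1) by (auto simp: A1_def)
    then have "ok N a" using ch by simp
    then show "a \<in> X1" "a = rp a" using N by (simp_all add: ok_def rp_def)
  qed
  have match1: "match B1 u w \<longleftrightarrow> cls u = cls w" if "u \<in> X1" "w \<in> X1" for u w
  proof
    assume "match B1 u w"
    then show "cls u = cls w" using sep[OF that] by (auto simp: cls_def)
  next
    assume eq: "cls u = cls w"
    show "match B1 u w"
      unfolding match_def
    proof
      fix b assume "b \<in> set B1"
      then have "b \<in> U - X1" using B1(1) by blast
      then show "E u b \<longleftrightarrow> E w b" using eq by (auto simp: cls_def)
    qed
  qed
  have "indep A1 B1"
    unfolding indep_def
  proof (intro ballI impI)
    fix a a' assume a: "a \<in> set A1" "a' \<in> set A1" "match B1 a a'"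
    then have "cls a = cls a'" using match1 A1_rp(2) by simp
    then show "a = a'" using A1_rp(1)[OF a(1)] A1_rp(1)[OF a(2)] by (simp add: rp_def)
  qed
  have sameB: "match B u (rp u)" if "u \<in> X1" for u
    unfolding match_def
  proof
    fix b assume "b \<in> set B"
    then have "b \<in> U - X1" using A(2) X(1) by blast
    moreover have "cls (rp u) = cls u" using rp that by blast
    ultimately show "E u b \<longleftrightarrow> E (rp u) b" by (auto simp: cls_def)
  qed
  \<comment> \<open>A vertex and its representative have the same neighbours outside
    \<open>X1\<close>, so no arrow leaves \<open>X1\<close>.\<close>
  have closed1: "w \<in> X1" if "arr A1 B1 u w" "u \<in> X1" for u w
  proof (rule ccontr)
    assume "w \<notin> X1"
    then have w: "w \<in> U - X1" using that(1) by (simp add: arr_def)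
    have "match B1 u (rp u)" using match1[OF that(2)] rp[OF that(2)] by simp
    then show False using that(1) sep[OF that(2) _ _ w] rp[OF that(2)] by (auto simp: arr_def)
  qed
  have closed: "w \<in> X1" if "reach A1 B1 u w" "u \<in> X1" for u w
    using that by (induction rule: rtranclp_induct) (auto intro: closed1)
  \<comment> \<open>Both \<open>u\<close> and \<open>rp u\<close> have the same neighbours in
    \<open>B\<close>, hence match the same single entry \<open>a\<close> of \<open>A\<close>. Since
    \<open>a\<close> agrees with \<open>u\<close> at \<open>w\<close> and \<open>rp u\<close> does
    not, the arrow starts at \<open>rp u\<close>.\<close>
  have star': "arr A B (rp u) w" if uw: "arr A1 B1 u w" "u \<in> X1" and na: "\<not> arr A B u w" for u w
  proof -
    have w: "w \<in> X1" using closed1 uw by blast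
    have U: "u \<in> U" "w \<in> U" "S u w" using uw(1) by (auto simp: arr_def)
    have "match B1 u (rp u)" using match1[OF uw(2)] rp[OF uw(2)] by simp
    then have diff: "E u w \<longleftrightarrow> \<not> E (rp u) w" using uw(1) rp[OF uw(2)] by (simp add: arr_def)
    obtain a where a: "a \<in> set A" "match B u a" "E u w \<longleftrightarrow> E a w" using na U by (auto simp: arr_def)
    have "a = a'" if "a' \<in> set A" "match B (rp u) a'" for a'
    proof -
      have "match B a a'" using sameB[OF uw(2)] a(2) that(2) by (simp add: match_def)
      then show ?thesis using A(3) a(1) that(1) by (simp add: indep_def)
    qed
    moreover have "S (rp u) w" using X(1,4) rp(2)[OF uw(2)] w by blast
    ultimately show ?thesis using U rp(2)[OF uw(2)] X1U a diff by (auto simp: arr_def)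
  qed
  then have star: "arr A B u w \<or> arr A B (rp u) w" if "arr A1 B1 u w" "u \<in> X1" for u w
    using that by blast
  have to_step: "to u" if "arr A B u w" "to w" for u w
    using that unfolding to_def by (rule converse_rtranclp_into_rtranclp)
  \<comment> \<open>If the old arrow into \<open>z\<close> starts at \<open>rp y\<close>, this
    representative reaches \<open>v\<close>. By \<open>ok\<close>, such a representative is taken
    only if its whole class reaches \<open>v\<close>, and \<open>y\<close> is in the class.\<close>
  have to_back: "to w" if "reach A1 B1 w u" "w \<in> X1" "to u" for u w
    using that(1,2,3)
  proof (induction rule: converse_rtranclp_induct)
    case base
    then show ?case by simp
  next
    case (step y z)
    then have z: "to z" using closed1 by blast
    from star[OF step.hyps(1) step.prems(1)] show ?case
    proof
      assume "arr A B y z"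
      then show ?thesis using z by (rule to_step)
    next
      assume "arr A B (rp y) z"
      then have "to (rp y)" using z by (rule to_step)
      then have "\<forall>x \<in> X1. cls x = cls y \<longrightarrow> to x" using rp(4)[OF step.prems(1)] by (simp add: ok_def)
      then show ?thesis using step.prems(1) by blast
    qed
  qed
  \<comment> \<open>Every vertex on the path reaches \<open>v\<close>, because the path returns to
    \<open>u\<close>. If the old arrow starts at \<open>rp y\<close>, then \<open>y\<close> shows
    that its class meets the component of \<open>v\<close>, and \<open>ok\<close> puts
    \<open>rp y\<close> into that component.\<close>
  have nested: "scc A B v w" if uw: "u \<in> X1" "scc A B v u" "scc A1 B1 u w" for u w
  proof -
    have fwd: "reach A1 B1 u w" "reach A1 B1 w u" using uw(3) by (simp_all add: scc_def)
    have tou: "to u" using uw(2) by (simp add: scc_def to_def)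
    from fwd show ?thesis
    proof (induction rule: rtranclp_induct)
      case base
      show ?case by (rule uw(2))
    next
      case (step y z)
      have "reach A1 B1 y u" using step.hyps(2) step.prems by (rule converse_rtranclp_into_rtranclp)
      then have y: "scc A B v y" by (rule step.IH)
      have yX: "y \<in> X1" using closed[OF step.hyps(1) uw(1)] .
      have zX: "z \<in> X1" using closed1[OF step.hyps(2) yX] .
      have toz: "to z" using to_back[OF step.prems zX tou] .
      have "reach A B v z"
        using star[OF step.hyps(2) yX]
      proof
        assume "arr A B y z"
        then show ?thesis using y by (auto simp: scc_def intro: rtranclp.rtrancl_into_rtrancl)
      next
        assume r: "arr A B (rp y) z"
        then have "to (rp y)" using toz by (rule to_step)
        then have "scc A B v (rp y)" using rp(4)[OF yX] y yX by (auto simp: ok_def)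
        then show ?thesis using r by (auto simp: scc_def intro: rtranclp.rtrancl_into_rtrancl)
      qed
      then show ?case using toz by (simp add: scc_def to_def)
    qed
  qed
  have "set A \<inter> X1 \<subseteq> set A1"
  proof
    fix a assume a: "a \<in> set A \<inter> X1"
    then have "rp a \<in> set A" using rp(4)[of a] by (auto simp: ok_def)
    moreover have "match B a (rp a)" using sameB a by blast
    ultimately have "a = rp a" using A(3) a by (auto simp: indep_def)
    then show "a \<in> set A1" using rp(1)[of a] a by simp
  qed
  moreover have "set A1 \<subseteq> X1" "length A1 \<le> 3" using A1_rp(2) ms(2) by (auto simp: A1_def)
  moreover have "\<forall>u \<in> X1. \<forall>w. scc A1 B1 u w \<longrightarrow> w \<in> X1"
    unfolding scc_def using closed by blast
  moreover have "\<forall>u \<in> X1. \<forall>w \<in> X1. match B1 u w \<longrightarrow> (\<forall>z \<in> U - X1. E u z \<longleftrightarrow> E w z)"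
    using sep by simp
  moreover have "\<forall>u \<in> X1. \<forall>w. scc A B v u \<longrightarrow> scc A1 B1 u w \<longrightarrow> scc A B v w" using nested by simp
  ultimately show ?thesis
    using B1 \<open>indep A1 B1\<close> by (intro exI[of _ A1] exI[of _ B1] conjI)
qed

lemma R_adj:
  assumes "R (p @ [x]) (q @ [x'])" "i < length p"
  shows "E x (p ! i) \<longleftrightarrow> E x' (q ! i)"
proof -
  have "length p = length q" using R_dom[OF assms(1)] by simp
  then show ?thesis using R_atom[OF assms(1), of "length p" i] assms(2) by (simp add: nth_append)
qed

text \<open>The type of \<open>v'\<close> gives its component the same size, one. This covers the
  case without a second vertex \<open>c\<close>, which \<open>nested_parameters\<close>
  requires.\<close>

lemma trivial_class:
  assumes R: "R ((A @ B) @ [v]) ((A' @ B') @ [v'])" and len: "length A = length A'" "length B = length B'"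
    "length A + length B + 3 \<le> K" and C: "{w. scc A B v w} = {v}"
  shows "scc_iso A B v A' B' v'"
proof -
  have U: "v \<in> U" "v' \<in> U" using R_dom[OF R] by auto
  have "length (A @ B) + 2 \<le> K" using len by simp
  then obtain f where "bij_betw f {y \<in> U. scc A B v y} {y \<in> U. scc A' B' v' y}"
    by (rule pres_bij[OF R]) (use pres_scc[OF len] in blast)
  moreover have "{y \<in> U. scc A B v y} = {w. scc A B v w}" "{y \<in> U. scc A' B' v' y} = {w. scc A' B' v' w}"
    using reach_U U by (auto simp: scc_def)
  ultimately have f: "bij_betw f {v} {w. scc A' B' v' w}" using C by simp
  then have "{w. scc A' B' v' w} = {f v}" by (auto simp: bij_betw_def)
  moreover have "v' \<in> {w. scc A' B' v' w}" using scc_rules(1) by simp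
  ultimately have "f v = v'" by simp
  have x: "x = v" if "scc A B v x" for x using C that by blast
  have "E v v \<longleftrightarrow> E v' v'"
    using R_atom[OF R, of "length (A @ B)" "length (A @ B)"] len by (simp add: nth_append)
  then show ?thesis using f x \<open>f v = v'\<close> C R_adj[OF R] by (intro exI[of _ f]) auto
qed

lemma equivp_rtranclp:
  assumes "\<And>u w. J u w \<Longrightarrow> J w u"
  shows "equivp J\<^sup>*\<^sup>*"
proof (rule equivpI)
  show "symp J\<^sup>*\<^sup>*" using assms by (intro symp_rtranclp sympI)
  show "transp J\<^sup>*\<^sup>*" by (intro transpI) (rule rtranclp_trans)
qed (simp add: reflp_def)

lemma R_back_extend:
  assumes "R (P @ [u]) (Q @ [u'])" "w' \<in> U" "length P + 2 \<le> K"
  obtains w where "w \<in> U" "R (P @ [u, w]) (Q @ [u', w'])"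
proof -
  have "length (Q @ [u']) + length [w'] \<le> K" using assms R_dom[OF assms(1)] by simp
  then obtain w where w: "R ((Q @ [u']) @ [w']) ((P @ [u]) @ w)" "length w = length [w']"
    using R_extend[OF R_sym[OF assms(1)], of "[w']"] assms(2) by auto
  then obtain w0 where "w = [w0]" by (auto simp: length_Suc_conv)
  then have "R (P @ [u, w0]) (Q @ [u', w'])" using R_sym[OF w(1)] by simp
  moreover from this have "w0 \<in> U" using R_dom by fastforce
  ultimately show ?thesis using that by blast
qed

text \<open>\<open>C1\<close> is a half of a component, and \<open>r\<close> joins vertices that
  have to stay in the same half. The image of \<open>C1\<close> under \<open>g\<close> plays the
  part of the corresponding half on the second side, where no subpart is given. It is closed under
  components: a vertex \<open>w'\<close> in the component of \<open>u'\<close> pulls back by types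
  into \<open>C1\<close>, hence satisfies \<open>inC'\<close> and is \<open>r'\<close>-related to
  \<open>u'\<close>, and \<open>g\<close> carries \<open>r\<close> to \<open>r'\<close>. The vertex
  \<open>x2\<close> shows that \<theta> x has the type of some vertex of \<open>C1\<close> that
  agrees with \<open>x\<close> on the parameters.\<close>

lemma glue_half:
  assumes IH: "locally_isomorphic X"
    and A: "set A \<subseteq> X" "set B \<subseteq> U - X" "length A \<le> 3" "length B \<le> 3" "indep A B"
    and A': "length A = length A'" "length B = length B'"
    and P: "set P \<subseteq> U" "set Q \<subseteq> U" "length P = length Q" "length P + 2 \<le> K" "9 \<le> K"
    and sub: "\<And>u u'. R (P @ [u]) (Q @ [u']) \<Longrightarrow> R ((A @ B) @ [u]) ((A' @ B') @ [u'])"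
    and pres: "pres P Q (scc A B) (scc A' B')"
    and presC: "pres P Q (\<lambda>_ w. inC w) (\<lambda>_ w. inC' w)"
    and C: "{w. inC w} \<subseteq> U" "{w. inC' w} \<subseteq> U"
    and S: "\<And>x y. inC x \<Longrightarrow> inC y \<Longrightarrow> S x y" "\<And>x y. inC' x \<Longrightarrow> inC' y \<Longrightarrow> S x y"
    and C1: "C1 \<subseteq> X" "\<And>x. x \<in> C1 \<Longrightarrow> inC x" "\<And>u w. u \<in> C1 \<Longrightarrow> scc A B u w \<Longrightarrow> w \<in> C1"
    and r: "\<And>u w. u \<in> C1 \<Longrightarrow> r u w \<Longrightarrow> w \<in> C1"
      "\<And>u w. inC' u \<Longrightarrow> inC' w \<Longrightarrow> scc A' B' u w \<Longrightarrow> r' u w"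
    and g: "bij_betw g {w. inC w} {w. inC' w}" "\<And>u. inC u \<Longrightarrow> R (P @ [u]) (Q @ [g u])"
      "\<And>x y. inC x \<Longrightarrow> inC y \<Longrightarrow> r x y \<longleftrightarrow> r' (g x) (g y)"
  shows "\<exists>\<theta>. bij_betw \<theta> C1 (g ` C1) \<and> (\<forall>x \<in> C1. \<forall>y \<in> C1. E x y \<longleftrightarrow> E (\<theta> x) (\<theta> y)) \<and>
    (\<forall>x \<in> C1. \<exists>x2 \<in> C1. R (P @ [x2]) (Q @ [\<theta> x]) \<and> (\<forall>z \<in> set (A @ B). E x z \<longleftrightarrow> E x2 z)) \<and>
    (\<forall>u \<in> g ` C1. \<forall>w. scc A' B' u w \<longrightarrow> w \<in> g ` C1)"
proof -
  have g_mem: "inC' (g u)" if "inC u" for u using bij_betwE[OF g(1)] that by simp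
  have closed': "w' \<in> g ` C1" if u': "u' \<in> g ` C1" and s: "scc A' B' u' w'" for u' w'
  proof -
    obtain u where u: "u \<in> C1" "u' = g u" using u' by auto
    have inCu: "inC u" using C1(2) u by blast
    have inCu': "inC' u'" using g_mem[OF inCu] u by simp
    have "u' \<in> U" using inCu' C(2) by blast
    then have w'U: "w' \<in> U" using s reach_U by (auto simp: scc_def)
    have Ru: "R (P @ [u]) (Q @ [u'])" using g(2)[OF inCu] u by simp
    obtain w where w: "w \<in> U" "R (P @ [u, w]) (Q @ [u', w'])"
      by (rule R_back_extend[OF Ru w'U P(4)])
    have "scc A B u w" using presD[OF pres w(2)] s by simp
    then have "inC w" using C1(2)[OF C1(3)[OF u(1)]] by simp
    then have "inC' w'" using presD[OF presC w(2)] by simp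
    then have r': "r' u' w'" using r(2) inCu' s by blast
    have "w' \<in> g ` {w. inC w}" using g(1) \<open>inC' w'\<close> by (simp add: bij_betw_def)
    then obtain w2 where w2: "inC w2" "w' = g w2" by auto
    then have "r u w2" using g(3)[OF inCu w2(1)] r' u(2) by simp
    then show ?thesis using r(1)[OF u(1)] w2(2) by blast
  qed
  have C1U: "C1 \<subseteq> X \<inter> U" using C1(1,2) C(1) by blast
  have D: "inC' y" if "y \<in> g ` C1" for y using g_mem C1(2) that by blast
  then have DU: "g ` C1 \<subseteq> U" using C(2) by blast
  have "C1 \<subseteq> {w. inC w}" using C1(2) by blast
  then have gb: "bij_betw g C1 (g ` C1)" by (rule bij_betw_subset[OF g(1)]) simp
  have S1: "S x y" if "x \<in> C1" "y \<in> C1" for x y by (rule S(1)[OF C1(2)[OF that(1)] C1(2)[OF that(2)]])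
  have S2: "S x y" if "x \<in> g ` C1" "y \<in> g ` C1" for x y by (rule S(2)[OF D[OF that(1)] D[OF that(2)]])
  have gR: "R (P @ [x]) (Q @ [g x])" if "x \<in> C1" for x by (rule g(2)[OF C1(2)[OF that]])
  have "\<exists>\<theta>. bij_betw \<theta> C1 (g ` C1) \<and> (\<forall>x \<in> C1. \<forall>y \<in> C1. E x y \<longleftrightarrow> E (\<theta> x) (\<theta> y)) \<and>
    (\<forall>x \<in> C1. \<forall>i < length (A @ B). E x ((A @ B) ! i) \<longleftrightarrow> E (\<theta> x) ((A' @ B') ! i))"
    by (rule glue_sccs[OF IH A A' P sub pres C1U C1(3) DU closed' S1 S2 gb gR])
  then obtain \<theta> where \<theta>: "bij_betw \<theta> C1 (g ` C1)" "\<forall>x \<in> C1. \<forall>y \<in> C1. E x y \<longleftrightarrow> E (\<theta> x) (\<theta> y)"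
    "\<forall>x \<in> C1. \<forall>i < length (A @ B). E x ((A @ B) ! i) \<longleftrightarrow> E (\<theta> x) ((A' @ B') ! i)" by (elim exE conjE)
  have "\<exists>x2 \<in> C1. R (P @ [x2]) (Q @ [\<theta> x]) \<and> (\<forall>z \<in> set (A @ B). E x z \<longleftrightarrow> E x2 z)" if x: "x \<in> C1" for x
  proof -
    have "\<theta> x \<in> g ` C1" using bij_betwE[OF \<theta>(1)] x by blast
    then obtain x2 where x2: "x2 \<in> C1" "\<theta> x = g x2" by blast
    have Rx: "R (P @ [x2]) (Q @ [\<theta> x])" using g(2)[OF C1(2)[OF x2(1)]] x2(2) by simp
    have "E x z \<longleftrightarrow> E x2 z" if z: "z \<in> set (A @ B)" for z
    proof -
      obtain i where i: "i < length (A @ B)" "z = (A @ B) ! i" using z by (metis in_set_conv_nth)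
      then show ?thesis using \<theta>(3) x R_adj[OF sub[OF Rx] i(1)] by simp
    qed
    then show ?thesis using x2(1) Rx by blast
  qed
  then have "\<forall>x \<in> C1. \<exists>x2 \<in> C1. R (P @ [x2]) (Q @ [\<theta> x]) \<and> (\<forall>z \<in> set (A @ B). E x z \<longleftrightarrow> E x2 z)"
    by simp
  moreover have "\<forall>u \<in> g ` C1. \<forall>w. scc A' B' u w \<longrightarrow> w \<in> g ` C1" using closed' by simp
  ultimately show ?thesis using \<theta>(1,2) by (intro exI[of _ \<theta>] conjI)
qed

section \<open>Induction along the decomposition\<close>

inductive decomposable :: "'a set \<Rightarrow> bool" where
  leaf: "decomposable {x}"
| node: "decomposable X1 \<Longrightarrow> decomposable X2 \<Longrightarrow> X1 \<inter> X2 = {} \<Longrightarrow> few_classes X1 \<Longrightarrow> few_classes X2 \<Longrightarrow>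
    decomposable (X1 \<union> X2)"

text \<open>The component \<open>C\<close> of \<open>v\<close> is cut into its intersections with
  \<open>X1\<close> and \<open>X2\<close>. With nested parameters each half is a union of components
  of its subpart and is treated by \<open>glue_half\<close>. What remains are edges between the
  halves and adjacency to \<open>A @ B\<close>.\<close>

lemma locally_isomorphic_union:
  assumes IH: "locally_isomorphic X1" "locally_isomorphic X2"
    and disj: "X1 \<inter> X2 = {}" and few: "few_classes X1" "few_classes X2"
    and XU: "X1 \<union> X2 \<subseteq> U" and SX: "\<forall>x \<in> X1 \<union> X2. \<forall>y \<in> X1 \<union> X2. S x y" and K: "22 \<le> K"
  shows "locally_isomorphic (X1 \<union> X2)"
  unfolding locally_isomorphic_def
proof (intro allI impI)
  fix A B A' B' v v'
  assume A: "set A \<subseteq> X1 \<union> X2" "set B \<subseteq> U - (X1 \<union> X2)" "length A \<le> 3" "length B \<le> 3"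
    and len: "length A = length A'" "length B = length B'" and ind: "indep A B"
    and C_X: "{w. scc A B v w} \<subseteq> X1 \<union> X2" and R0: "R ((A @ B) @ [v]) ((A' @ B') @ [v'])"
  let ?goal = "scc_iso A B v A' B' v'"
  show ?goal
  proof (cases "\<exists>c. scc A B v c \<and> c \<noteq> v")
    case False
    then have "{w. scc A B v w} = {v}" using scc_rules(1) by blast
    moreover have "length A + length B + 3 \<le> K" using A(3,4) K by simp
    ultimately show ?thesis using trivial_class[OF R0 len] by blast
  next
    case True
    then obtain c where c: "scc A B v c" "c \<noteq> v" by blast
    have sub12: "X1 \<subseteq> X1 \<union> X2" "X2 \<subseteq> X1 \<union> X2" by simp_all
    obtain A1 B1 where p1: "set A1 \<subseteq> X1" "set B1 \<subseteq> U - X1" "length A1 \<le> 3" "length B1 \<le> 3" "indep A1 B1"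
      and sep1: "\<forall>u \<in> X1. \<forall>w \<in> X1. match B1 u w \<longrightarrow> (\<forall>z \<in> U - X1. E u z \<longleftrightarrow> E w z)"
      and AA1: "set A \<inter> X1 \<subseteq> set A1" and cl1: "\<forall>u \<in> X1. \<forall>w. scc A1 B1 u w \<longrightarrow> w \<in> X1"
      and ne1: "\<forall>u \<in> X1. \<forall>w. scc A B v u \<longrightarrow> scc A1 B1 u w \<longrightarrow> scc A B v w"
      using nested_parameters[OF sub12(1) XU few(1) SX A(1,2) ind c] by (elim exE conjE)
    obtain A2 B2 where p2: "set A2 \<subseteq> X2" "set B2 \<subseteq> U - X2" "length A2 \<le> 3" "length B2 \<le> 3" "indep A2 B2"
      and sep2: "\<forall>u \<in> X2. \<forall>w \<in> X2. match B2 u w \<longrightarrow> (\<forall>z \<in> U - X2. E u z \<longleftrightarrow> E w z)"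
      and AA2: "set A \<inter> X2 \<subseteq> set A2" and cl2: "\<forall>u \<in> X2. \<forall>w. scc A2 B2 u w \<longrightarrow> w \<in> X2"
      and ne2: "\<forall>u \<in> X2. \<forall>w. scc A B v u \<longrightarrow> scc A2 B2 u w \<longrightarrow> scc A B v w"
      using nested_parameters[OF sub12(2) XU few(2) SX A(1,2) ind c] by (elim exE conjE)
    define z where "z = (A1 @ B1) @ A2 @ B2"
    have "set z \<subseteq> U" using p1(1,2) p2(1,2) XU by (auto simp: z_def)
    moreover have "length ((A @ B) @ [v]) + length z \<le> K" using A(3,4) p1(3,4) p2(3,4) K by (simp add: z_def)
    ultimately obtain z' where z': "R (((A @ B) @ [v]) @ z) (((A' @ B') @ [v']) @ z')" "length z' = length z"
      using R_extend[OF R0] by blast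
    define A1' B1' A2' B2' where "A1' = take (length A1) z'" and "B1' = take (length B1) (drop (length A1) z')"
      and "A2' = take (length A2) (drop (length A1 + length B1) z')" and "B2' = drop (length A1 + length B1 + length A2) z'"
    have z'_eq: "z' = (A1' @ B1') @ A2' @ B2'"
      unfolding A1'_def B1'_def A2'_def B2'_def
      by (simp add: drop_drop[symmetric] add.commute[of "length A1"] add.assoc del: drop_drop)
        (metis append_take_drop_id drop_drop add.commute add.left_commute)
    have len1: "length A1 = length A1'" "length B1 = length B1'" and len2: "length A2 = length A2'" "length B2 = length B2'"
      using z'(2) unfolding A1'_def B1'_def A2'_def B2'_def z_def by simp_all
    define P Q where "P = ((A @ B) @ [v]) @ (A1 @ B1) @ A2 @ B2" and "Q = ((A' @ B') @ [v']) @ (A1' @ B1') @ A2' @ B2'"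
    have RPQ: "R P Q" using z'(1) by (simp add: P_def Q_def z_def z'_eq)
    have P: "set P \<subseteq> U" "set Q \<subseteq> U" "length P = length Q" using R_dom[OF RPQ] by auto
    have lenP: "length P + 3 \<le> K" using A(3,4) p1(3,4) p2(3,4) K by (simp add: P_def)
    then have P2: "length P + 2 \<le> K" "9 \<le> K" using K by simp_all
    have v: "v \<in> U" "v' \<in> U" using R_dom[OF R0] by auto
    have l: "length A + length B + 3 \<le> K" "length A1 + length B1 + 3 \<le> K" "length A2 + length B2 + 3 \<le> K"
      using A(3,4) p1(3,4) p2(3,4) K by simp_all
    have pres1: "pres P Q (scc A1 B1) (scc A1' B1')"
      unfolding P_def Q_def using len len1 len2 l by (intro pres_weaken pres_scc) auto
    have "pres ((((A @ B) @ [v]) @ (A1 @ B1)) @ (A2 @ B2) @ []) ((((A' @ B') @ [v']) @ (A1' @ B1')) @ (A2' @ B2') @ [])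
       (scc A2 B2) (scc A2' B2')"
      using len len1 len2 l by (intro pres_weaken pres_scc) auto
    then have pres2: "pres P Q (scc A2 B2) (scc A2' B2')" by (simp add: P_def Q_def)
    have presC: "pres P Q (\<lambda>_ w. scc A B v w) (\<lambda>_ w. scc A' B' v' w)"
      unfolding pres_def
    proof (intro conjI P(3) allI impI)
      fix u w u' w' assume "R (P @ [u, w]) (Q @ [u', w'])"
      then have "R (((A @ B) @ [v]) @ ((A1 @ B1) @ (A2 @ B2) @ [u]) @ [w]) (((A' @ B') @ [v']) @ ((A1' @ B1') @ (A2' @ B2') @ [u']) @ [w'])"
        by (simp add: P_def Q_def)
      from R_drop[OF this] have "R (((A @ B) @ [v]) @ [w]) (((A' @ B') @ [v']) @ [w'])"
        using len len1 len2 l by simp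
      then show "scc A B v w \<longleftrightarrow> scc A' B' v' w'" using presD[OF pres_scc[OF len l(1)]] by simp
    qed
    have sub1: "R ((A1 @ B1) @ [u]) ((A1' @ B1') @ [u'])" if "R (P @ [u]) (Q @ [u'])" for u u'
    proof -
      have "R (((A @ B) @ [v]) @ ((A1 @ B1) @ (A2 @ B2) @ [u])) (((A' @ B') @ [v']) @ ((A1' @ B1') @ (A2' @ B2') @ [u']))"
        using that by (simp add: P_def Q_def)
      from R_drop_front[OF this] have "R ((A1 @ B1) @ (A2 @ B2) @ [u]) ((A1' @ B1') @ (A2' @ B2') @ [u'])"
        using len p1(3,4) p2(3,4) K by simp
      from R_drop[OF this] show ?thesis using len1 len2 l by simp
    qed
    have sub2: "R ((A2 @ B2) @ [u]) ((A2' @ B2') @ [u'])" if "R (P @ [u]) (Q @ [u'])" for u u'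
    proof -
      have "R ((((A @ B) @ [v]) @ (A1 @ B1)) @ ((A2 @ B2) @ [u])) ((((A' @ B') @ [v']) @ (A1' @ B1')) @ ((A2' @ B2') @ [u']))"
        using that by (simp add: P_def Q_def)
      from R_drop_front[OF this] show ?thesis using len len1 l by simp
    qed
    have sub0: "R ((A @ B) @ [u]) ((A' @ B') @ [u'])" if "R (P @ [u]) (Q @ [u'])" for u u'
    proof -
      have "R ((A @ B) @ ([v] @ (A1 @ B1) @ (A2 @ B2)) @ [u]) ((A' @ B') @ ([v'] @ (A1' @ B1') @ (A2' @ B2')) @ [u'])"
        using that by (simp add: P_def Q_def)
      from R_drop[OF this] show ?thesis using len len1 len2 l by simp
    qed
    define C C' where "C = {w. scc A B v w}" and "C' = {w. scc A' B' v' w}"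
    have CU: "C \<subseteq> U" "C' \<subseteq> U" using v reach_U by (auto simp: C_def C'_def scc_def)
    have SC: "S x y" if "x \<in> C" "y \<in> C" for x y
    proof -
      have "scc A B x y" using scc_rules(3)[OF scc_rules(2), of A B v x y] that by (simp add: C_def)
      then show ?thesis using reach_S unfolding scc_def by blast
    qed
    have SC': "S x y" if "x \<in> C'" "y \<in> C'" for x y
    proof -
      have "scc A' B' x y" using scc_rules(3)[OF scc_rules(2), of A' B' v' x y] that by (simp add: C'_def)
      then show ?thesis using reach_S unfolding scc_def by blast
    qed
    \<comment> \<open>Membership in \<open>X1\<close> has no counterpart on the second side, whereas
      \<open>J\<close> is decided by types. Its classes stay inside one half on the first side, so
      matching them with the classes of \<open>J'\<close> defines halves on the second side.\<close>
    define J where "J u w \<longleftrightarrow> (scc A B v u \<and> scc A B v w) \<and> (scc A1 B1 u w \<or> scc A2 B2 u w)" for u w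
    define J' where "J' u w \<longleftrightarrow> (scc A' B' v' u \<and> scc A' B' v' w) \<and> (scc A1' B1' u w \<or> scc A2' B2' u w)" for u w
    have "pres P Q J J'"
      unfolding J_def J'_def using pres_converse[OF presC P2(1)] presC pres1 pres2
      by (intro pres_conj pres_disj)
    then have presJ: "pres P Q J\<^sup>*\<^sup>* J'\<^sup>*\<^sup>*"
      using CU by (intro pres_rtranclp[OF _ lenP]) (auto simp: J_def J'_def C_def C'_def)
    have "J w u" if "J u w" for u w using that scc_rules(2) unfolding J_def by blast
    then have eqJ: "equivp J\<^sup>*\<^sup>*" by (rule equivp_rtranclp)
    have "J' w u" if "J' u w" for u w using that scc_rules(2) unfolding J'_def by blast
    then have eqJ': "equivp J'\<^sup>*\<^sup>*" by (rule equivp_rtranclp)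
    have JC: "y \<in> C" if "J\<^sup>*\<^sup>* x y" "x \<in> C" for x y
      using that by (induction rule: rtranclp_induct) (auto simp: J_def C_def)
    have JC': "y \<in> C'" if "J'\<^sup>*\<^sup>* x y" "x \<in> C'" for x y
      using that by (induction rule: rtranclp_induct) (auto simp: J'_def C'_def)
    have fin: "finite C" "finite C'" using CU finite_U finite_subset by blast+
    have tp_iff: "tp P u = tp Q w \<longleftrightarrow> R (P @ [u]) (Q @ [w])" if "u \<in> U" "w \<in> U" for u w
      using that P lenP by (intro tp_eq_iff) auto
    obtain f where "\<forall>y \<in> U. R (P @ [y]) (Q @ [f y])" using R_ext[OF RPQ] lenP by auto
    then have "R (P @ [v]) (Q @ [f v])" using v(1) by blast
    from pres_tp_mset[OF this P2(1) presC]
    have "image_mset (tp P) (mset_set C) = image_mset (tp Q) (mset_set C')"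
      using CU by (simp add: C_def C'_def Collect_conj_eq Int_absorb1)
    moreover have "image_mset (tp P) (mset_set {y \<in> C. J\<^sup>*\<^sup>* x y}) = image_mset (tp Q) (mset_set {y \<in> C'. J'\<^sup>*\<^sup>* x' y})"
      if x: "x \<in> C" "x' \<in> C'" "tp P x = tp Q x'" for x x'
    proof -
      have "{y \<in> C. J\<^sup>*\<^sup>* x y} = {y \<in> U. J\<^sup>*\<^sup>* x y}" "{y \<in> C'. J'\<^sup>*\<^sup>* x' y} = {y \<in> U. J'\<^sup>*\<^sup>* x' y}"
        using JC x(1) JC' x(2) CU by auto
      moreover have "R (P @ [x]) (Q @ [x'])" using x CU tp_iff by blast
      ultimately show ?thesis using pres_tp_mset[OF _ P2(1) presJ] by simp
    qed
    ultimately have "\<exists>g. bij_betw g C C' \<and> (\<forall>x \<in> C. tp Q (g x) = tp P x) \<and> (\<forall>x \<in> C. \<forall>y \<in> C. J\<^sup>*\<^sup>* x y \<longleftrightarrow> J'\<^sup>*\<^sup>* (g x) (g y))"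
      by (rule class_matching[OF fin _ eqJ eqJ'])
    then obtain g where g: "bij_betw g C C'" "\<And>x. x \<in> C \<Longrightarrow> tp Q (g x) = tp P x"
      "\<And>x y. x \<in> C \<Longrightarrow> y \<in> C \<Longrightarrow> J\<^sup>*\<^sup>* x y \<longleftrightarrow> J'\<^sup>*\<^sup>* (g x) (g y)" by auto
    have gC: "g x \<in> C'" if "x \<in> C" for x using bij_betwE[OF g(1)] that by blast
    have gR: "R (P @ [x]) (Q @ [g x])" if "x \<in> C" for x
      using g(2)[OF that] tp_iff[of x "g x"] that gC CU by auto
    define C1 C2 where "C1 = C \<inter> X1" and "C2 = C \<inter> X2"
    have C12: "C1 \<union> C2 = C" "C1 \<inter> C2 = {}" using C_X disj by (auto simp: C1_def C2_def C_def)
    have scl1: "w \<in> C1" if "u \<in> C1" "scc A1 B1 u w" for u w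
      using that cl1 ne1 unfolding C1_def C_def by blast
    have scl2: "w \<in> C2" if "u \<in> C2" "scc A2 B2 u w" for u w
      using that cl2 ne2 unfolding C2_def C_def by blast
    \<comment> \<open>A step from \<open>C1\<close> to \<open>C2\<close> would use a component for
      \<open>A2\<close> and \<open>B2\<close>. Read backwards, it starts in \<open>C2\<close>, which
      is closed under these components.\<close>
    have J1: "w \<in> C1" if "J u w" "u \<in> C1" for u w
    proof (rule ccontr)
      assume "w \<notin> C1"
      then have "w \<in> C2" "scc A2 B2 u w" using that scl1 C12(1) by (auto simp: J_def C_def)
      then have "u \<in> C2" using scl2 scc_rules(2) by blast
      then show False using that(2) C12 by blast
    qed
    have J2: "w \<in> C2" if "J u w" "u \<in> C2" for u w
    proof (rule ccontr)
      assume "w \<notin> C2"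
      then have "w \<in> C1" "scc A1 B1 u w" using that scl2 C12(1) by (auto simp: J_def C_def)
      then have "u \<in> C1" using scl1 scc_rules(2) by blast
      then show False using that(2) C12 by blast
    qed
    have Jr1: "w \<in> C1" if "u \<in> C1" "J\<^sup>*\<^sup>* u w" for u w
      using that(2,1) by (induction rule: rtranclp_induct) (auto intro: J1)
    have Jr2: "w \<in> C2" if "u \<in> C2" "J\<^sup>*\<^sup>* u w" for u w
      using that(2,1) by (induction rule: rtranclp_induct) (auto intro: J2)
    have gC_bij: "bij_betw g {w. scc A B v w} {w. scc A' B' v' w}" using g(1) by (simp add: C_def C'_def)
    have CU': "{w. scc A B v w} \<subseteq> U" "{w. scc A' B' v' w} \<subseteq> U" using CU by (simp_all add: C_def C'_def)
    have C1X: "C1 \<subseteq> X1" and C2X: "C2 \<subseteq> X2" by (simp_all add: C1_def C2_def)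
    have C1v: "scc A B v x" if "x \<in> C1" for x using that by (simp add: C1_def C_def)
    have C2v: "scc A B v x" if "x \<in> C2" for x using that by (simp add: C2_def C_def)
    have SCv: "S x y" if "scc A B v x" "scc A B v y" for x y using SC[of x y] that by (simp add: C_def)
    have SCv': "S x y" if "scc A' B' v' x" "scc A' B' v' y" for x y using SC'[of x y] that by (simp add: C'_def)
    have Jstep1: "J'\<^sup>*\<^sup>* u w" if "scc A' B' v' u" "scc A' B' v' w" "scc A1' B1' u w" for u w
      using that by (intro r_into_rtranclp) (simp add: J'_def)
    have Jstep2: "J'\<^sup>*\<^sup>* u w" if "scc A' B' v' u" "scc A' B' v' w" "scc A2' B2' u w" for u w
      using that by (intro r_into_rtranclp) (simp add: J'_def)
    have gRv: "R (P @ [x]) (Q @ [g x])" if "scc A B v x" for x using gR[of x] that by (simp add: C_def)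
    have g3v: "J\<^sup>*\<^sup>* x y \<longleftrightarrow> J'\<^sup>*\<^sup>* (g x) (g y)" if "scc A B v x" "scc A B v y" for x y
      using g(3)[of x y] that by (simp add: C_def)
    have "\<exists>\<theta>. bij_betw \<theta> C1 (g ` C1) \<and> (\<forall>x \<in> C1. \<forall>y \<in> C1. E x y \<longleftrightarrow> E (\<theta> x) (\<theta> y)) \<and>
      (\<forall>x \<in> C1. \<exists>x2 \<in> C1. R (P @ [x2]) (Q @ [\<theta> x]) \<and> (\<forall>z \<in> set (A1 @ B1). E x z \<longleftrightarrow> E x2 z)) \<and>
      (\<forall>u \<in> g ` C1. \<forall>w. scc A1' B1' u w \<longrightarrow> w \<in> g ` C1)"
      by (rule glue_half[where inC = "scc A B v" and inC' = "scc A' B' v'" and r = "J\<^sup>*\<^sup>*" and r' = "J'\<^sup>*\<^sup>*" and g = g, OF IH(1) p1 len1 P P2 sub1 pres1 presC CU' SCv SCv' C1X C1v scl1 Jr1 Jstep1 gC_bij gRv g3v])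
    then obtain t1 where t1: "bij_betw t1 C1 (g ` C1)" "\<forall>x \<in> C1. \<forall>y \<in> C1. E x y \<longleftrightarrow> E (t1 x) (t1 y)"
      "\<forall>x \<in> C1. \<exists>x2 \<in> C1. R (P @ [x2]) (Q @ [t1 x]) \<and> (\<forall>z \<in> set (A1 @ B1). E x z \<longleftrightarrow> E x2 z)"
      "\<forall>u \<in> g ` C1. \<forall>w. scc A1' B1' u w \<longrightarrow> w \<in> g ` C1" by (elim exE conjE)
    have "\<exists>\<theta>. bij_betw \<theta> C2 (g ` C2) \<and> (\<forall>x \<in> C2. \<forall>y \<in> C2. E x y \<longleftrightarrow> E (\<theta> x) (\<theta> y)) \<and>
      (\<forall>x \<in> C2. \<exists>x2 \<in> C2. R (P @ [x2]) (Q @ [\<theta> x]) \<and> (\<forall>z \<in> set (A2 @ B2). E x z \<longleftrightarrow> E x2 z)) \<and>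
      (\<forall>u \<in> g ` C2. \<forall>w. scc A2' B2' u w \<longrightarrow> w \<in> g ` C2)"
      by (rule glue_half[where inC = "scc A B v" and inC' = "scc A' B' v'" and r = "J\<^sup>*\<^sup>*" and r' = "J'\<^sup>*\<^sup>*" and g = g, OF IH(2) p2 len2 P P2 sub2 pres2 presC CU' SCv SCv' C2X C2v scl2 Jr2 Jstep2 gC_bij gRv g3v])
    then obtain t2 where t2: "bij_betw t2 C2 (g ` C2)" "\<forall>x \<in> C2. \<forall>y \<in> C2. E x y \<longleftrightarrow> E (t2 x) (t2 y)"
      "\<forall>x \<in> C2. \<exists>x2 \<in> C2. R (P @ [x2]) (Q @ [t2 x]) \<and> (\<forall>z \<in> set (A2 @ B2). E x z \<longleftrightarrow> E x2 z)"
      "\<forall>u \<in> g ` C2. \<forall>w. scc A2' B2' u w \<longrightarrow> w \<in> g ` C2" by (elim exE conjE)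
    define \<theta> where "\<theta> x = (if x \<in> C1 then t1 x else t2 x)" for x
    have gdisj: "g ` C1 \<inter> g ` C2 = {}"
      using C12 g(1) by (metis bij_betw_def image_empty inj_on_image_Int sup_ge1 sup_ge2)
    have "bij_betw \<theta> (C1 \<union> C2) (g ` C1 \<union> g ` C2)"
      unfolding \<theta>_def by (rule bij_betw_disjoint_Un[OF t1(1) t2(1) C12(2) gdisj])
    moreover have "g ` C1 \<union> g ` C2 = C'" using C12(1) g(1) by (metis bij_betw_def image_Un)
    ultimately have bij: "bij_betw \<theta> C C'" using C12(1) by simp
    have th1: "\<theta> x = t1 x" if "x \<in> C1" for x using that by (simp add: \<theta>_def)
    have th2: "\<theta> x = t2 x" if "x \<in> C2" for x using that C12(2) by (auto simp: \<theta>_def)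
    have Csub: "C1 \<subseteq> C" "C2 \<subseteq> C" by (simp_all add: C1_def C2_def)
    then have gsub: "g ` C1 \<subseteq> C'" "g ` C2 \<subseteq> C'" using gC by auto
    have sep1': "E x y \<longleftrightarrow> E x2 y" if "x \<in> C1" "x2 \<in> C1" "\<forall>z \<in> set (A1 @ B1). E x z \<longleftrightarrow> E x2 z" "y \<in> U - X1" for x x2 y

    proof -
      have "x \<in> X1" "x2 \<in> X1" "match B1 x x2" using that by (auto simp: C1_def match_def)
      then show ?thesis using sep1 that(4) by blast
    qed
    have sep2': "E x y \<longleftrightarrow> E x2 y" if "x \<in> C2" "x2 \<in> C2" "\<forall>z \<in> set (A2 @ B2). E x z \<longleftrightarrow> E x2 z" "y \<in> U - X2" for x x2 y

    proof -
      have "x \<in> X2" "x2 \<in> X2" "match B2 x x2" using that by (auto simp: C2_def match_def)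
      then show ?thesis using sep2 that(4) by blast
    qed
    have AB: "set (A @ B) \<subseteq> U" using A(1,2) XU by auto
    \<comment> \<open>Entries of \<open>A\<close> in \<open>X1\<close> are also entries of
      \<open>A1\<close>, so \<open>x\<close> and \<open>x2\<close> agree on them. The remaining
      parameters lie outside \<open>X1\<close>, where agreement on \<open>B1\<close> is enough. The
      type of \<open>x2\<close> then carries the adjacency over to the image.\<close>
    have adj: "E x ((A @ B) ! i) \<longleftrightarrow> E (\<theta> x) ((A' @ B') ! i)" if x: "x \<in> C" and i: "i < length (A @ B)" for x i
    proof -
      define z where "z = (A @ B) ! i"
      have z: "z \<in> set (A @ B)" using i unfolding z_def by (rule nth_mem)
      consider "x \<in> C1" | "x \<in> C2" using x C12(1) by blast
      then show ?thesis
      proof cases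
        case 1
        then obtain x2 where x2: "x2 \<in> C1" "R (P @ [x2]) (Q @ [t1 x])" "\<forall>z \<in> set (A1 @ B1). E x z \<longleftrightarrow> E x2 z" using t1(3) by blast
        have "E x z \<longleftrightarrow> E x2 z"
        proof (cases "z \<in> X1")
          case True
          then have "z \<in> set (A1 @ B1)" using z AA1 A(2) by auto
          then show ?thesis using x2(3) by blast
        next
          case False
          then show ?thesis using sep1'[OF 1 x2(1,3)] z AB by blast
        qed
        then show ?thesis using R_adj[OF sub0[OF x2(2)] i] th1[OF 1] by (simp add: z_def)
      next
        case 2
        then obtain x2 where x2: "x2 \<in> C2" "R (P @ [x2]) (Q @ [t2 x])" "\<forall>z \<in> set (A2 @ B2). E x z \<longleftrightarrow> E x2 z" using t2(3) by blast
        have "E x z \<longleftrightarrow> E x2 z"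
        proof (cases "z \<in> X2")
          case True
          then have "z \<in> set (A2 @ B2)" using z AA2 A(2) by auto
          then show ?thesis using x2(3) by blast
        next
          case False
          then show ?thesis using sep2'[OF 2 x2(1,3)] z AB by blast
        qed
        then show ?thesis using R_adj[OF sub0[OF x2(2)] i] th2[OF 2] by (simp add: z_def)
      qed
    qed
    \<comment> \<open>First \<open>x\<close> and \<open>y\<close> are exchanged for
      \<open>x2\<close> and \<open>y2\<close>, which have the types of the images. Neither exchange
      alters the adjacency, as the other vertex is outside the part and agreement on
      \<open>B1\<close> or \<open>B2\<close> suffices. Then \<open>cross_edge\<close> applies with
      empty paths to the representatives.\<close>
    have cross: "E x y \<longleftrightarrow> E (\<theta> x) (\<theta> y)" if x: "x \<in> C1" and y: "y \<in> C2" for x y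
    proof -
      obtain x2 where x2: "x2 \<in> C1" "R (P @ [x2]) (Q @ [t1 x])" "\<forall>z \<in> set (A1 @ B1). E x z \<longleftrightarrow> E x2 z" using t1(3) x by blast
      obtain y2 where y2: "y2 \<in> C2" "R (P @ [y2]) (Q @ [t2 y])" "\<forall>z \<in> set (A2 @ B2). E y z \<longleftrightarrow> E y2 z" using t2(3) y by blast
      have tx: "t1 x \<in> g ` C1" using bij_betwE[OF t1(1)] x by blast
      have ty: "t2 y \<in> g ` C2" using bij_betwE[OF t2(1)] y by blast
      have mem: "x2 \<in> C" "y2 \<in> C" "t1 x \<in> C'" "t2 y \<in> C'"
        using subsetD[OF Csub(1) x2(1)] subsetD[OF Csub(2) y2(1)] subsetD[OF gsub(1) tx] subsetD[OF gsub(2) ty] by simp_all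
      have memU: "x2 \<in> U" "y2 \<in> U" "t1 x \<in> U" "t2 y \<in> U"
        using subsetD[OF CU(1) mem(1)] subsetD[OF CU(1) mem(2)] subsetD[OF CU(2) mem(3)] subsetD[OF CU(2) mem(4)] by simp_all
      have out: "y \<in> U - X1" "x2 \<in> U - X2" using y x2(1) CU disj by (auto simp: C1_def C2_def)
      have n1: "\<not> scc A1 B1 x2 y2" using scl1[OF x2(1)] y2(1) C12(2) by blast
      have n2: "\<not> scc A1' B1' (t1 x) (t2 y)" using t1(4) tx ty gdisj by blast
      have "E x2 y2 \<longleftrightarrow> E (t1 x) (t2 y)"
        using cross_edge[OF sub1[OF x2(2)] sub1[OF y2(2)] len1 l(2) p1(5) scc_rules(1) scc_rules(1) scc_rules(1) scc_rules(1) n1 n2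
          R_adj[OF sub1[OF x2(2)]] R_adj[OF sub1[OF y2(2)]] SC[OF mem(1,2)] SC'[OF mem(3,4)] memU] by simp
      moreover have "E x y \<longleftrightarrow> E x2 y" using sep1'[OF x x2(1,3) out(1)] .
      moreover have "E y x2 \<longleftrightarrow> E y2 x2" using sep2'[OF y y2(1,3) out(2)] .
      ultimately show ?thesis using th1[OF x] th2[OF y] E_comm[of y] E_comm[of y2] by simp
    qed
    have edges: "E x y \<longleftrightarrow> E (\<theta> x) (\<theta> y)" if xy: "x \<in> C" "y \<in> C" for x y
    proof -
      consider "x \<in> C1" "y \<in> C1" | "x \<in> C1" "y \<in> C2" | "x \<in> C2" "y \<in> C1" | "x \<in> C2" "y \<in> C2"
        using xy C12(1) by blast
      then show ?thesis
      proof cases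
        case 1 then show ?thesis using t1(2) th1 by simp
      next
        case 2 then show ?thesis by (rule cross)
      next
        case 3 then show ?thesis using cross[of y x] E_comm[of x] E_comm[of "\<theta> x"] by simp
      next
        case 4 then show ?thesis using t2(2) th2 by simp
      qed
    qed
    show ?goal using bij edges adj by (intro exI[of _ \<theta>]) (simp add: C_def C'_def)
  qed
qed

lemma decomposable_locally_isomorphic:
  assumes "decomposable X" "X \<subseteq> U" "\<forall>x \<in> X. \<forall>y \<in> X. S x y" "22 \<le> K"
  shows "locally_isomorphic X"
  using assms(1,2,3)
proof induction
  case (leaf x)
  show ?case
    unfolding locally_isomorphic_def
  proof (intro allI impI)
    fix A B A' B' v v'
    assume A: "length A \<le> 3" "length B \<le> 3" "length A = length A'" "length B = length B'"
      "{w. scc A B v w} \<subseteq> {x}" "R ((A @ B) @ [v]) ((A' @ B') @ [v'])"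
    have "{w. scc A B v w} = {v}" using A(5) scc_rules(1)[of A B v] by blast
    then show "scc_iso A B v A' B' v'"
      using A(1,2) assms(4) by (intro trivial_class[OF A(6,3,4)]) auto
  qed
next
  case (node X1 X2)
  then show ?case using assms(4) by (intro locally_isomorphic_union) auto
qed

text \<open>For empty parameters the component of a vertex is its whole side.\<close>

lemma wl_isomorphic:
  assumes "decomposable X" "X = {w \<in> U. S v w}" "R [v] [v']" "22 \<le> K"
  shows "\<exists>\<theta>. bij_betw \<theta> {w \<in> U. S v w} {w \<in> U. S v' w} \<and>
    (\<forall>x \<in> {w \<in> U. S v w}. \<forall>y \<in> {w \<in> U. S v w}. E x y \<longleftrightarrow> E (\<theta> x) (\<theta> y))"
proof -
  have v: "v \<in> U" "v' \<in> U" using R_dom[OF assms(3)] by auto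
  have *: "scc [] [] u w \<longleftrightarrow> w \<in> U \<and> S u w" if "u \<in> U" for u w
  proof
    show "w \<in> U \<and> S u w" if "scc [] [] u w"
      using that \<open>u \<in> U\<close> reach_U reach_S by (auto simp: scc_def)
    show "scc [] [] u w" if "w \<in> U \<and> S u w"
      using that \<open>u \<in> U\<close> S_rules(2)[of u w] by (auto simp: scc_def arr_def)
  qed
  have "locally_isomorphic X"
    using assms S_rules by (intro decomposable_locally_isomorphic) blast+
  from locally_isomorphicD[OF this, of "[]" "[]" "[]" "[]" v v'] show ?thesis
    using *[OF v(1)] *[OF v(2)] assms(2,3) by (auto simp: indep_def Ball_def)
qed

end

section \<open>Refinement\<close>

lemma count_image_mset_set:
  assumes "finite A"
  shows "count (image_mset f (mset_set A)) Z = card {v \<in> A. f v = Z}"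
  using assms
proof (induction A rule: finite_induct)
  case (insert x A)
  have "{v \<in> insert x A. f v = Z} = (if f x = Z then insert x {v \<in> A. f v = Z} else {v \<in> A. f v = Z})" by auto
  then show ?case using insert by simp
qed simp

locale refinement =
  fixes U :: "'a set" and E S :: "'a \<Rightarrow> 'a \<Rightarrow> bool" and K :: nat
  assumes finite_U: "finite U" and E_sym: "E u w \<Longrightarrow> E w u" and S_equiv: "equivp S"
begin

definition tuples :: "'a list set" where "tuples = {x. set x \<subseteq> U \<and> length x = K}"

definition atomic :: "'a list \<Rightarrow> 'a list \<Rightarrow> bool" where
  "atomic x y \<longleftrightarrow> (\<forall>i < K. \<forall>j < K. (x ! i = x ! j \<longleftrightarrow> y ! i = y ! j) \<and>
     (E (x ! i) (x ! j) \<longleftrightarrow> E (y ! i) (y ! j)) \<and> (S (x ! i) (x ! j) \<longleftrightarrow> S (y ! i) (y ! j)))"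

text \<open>Colours are never named: equivalent tuples have, for every coordinate and every
  \<open>z\<close>, equally many one-coordinate variants equivalent to \<open>z\<close>. In this
  form the values of \<open>W\<close> are bits that a table can hold.\<close>

primrec W :: "nat \<Rightarrow> 'a list \<Rightarrow> 'a list \<Rightarrow> bool" where
  "W 0 x y \<longleftrightarrow> atomic x y"
| "W (Suc t) x y \<longleftrightarrow> W t x y \<and> (\<forall>i < K. \<forall>z \<in> tuples.
     card {v \<in> U. W t (x[i := v]) z} = card {v \<in> U. W t (y[i := v]) z})"

lemma finite_tuples: "finite tuples"
  unfolding tuples_def using finite_lists_length_eq[OF finite_U] .

lemma card_tuples: "card tuples = card U ^ K"
  unfolding tuples_def using card_lists_length_eq[OF finite_U] .

lemma update_tuples: "x \<in> tuples \<Longrightarrow> v \<in> U \<Longrightarrow> x[i := v] \<in> tuples"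
  unfolding tuples_def using set_update_subset_insert[of x i v] by fastforce

lemma W_refl: "W t x x" by (induction t) (auto simp: atomic_def)

lemma W_sym: "W t x y \<Longrightarrow> W t y x" by (induction t) (auto simp: atomic_def)

lemma W_trans: "W t x y \<Longrightarrow> W t y z \<Longrightarrow> W t x z" by (induction t) (auto simp: atomic_def)

lemma W_mono: "s \<le> t \<Longrightarrow> W t x y \<Longrightarrow> W s x y"
  by (induction rule: inc_induct) auto

text \<open>Equal counts for all \<open>z\<close> mean equal multisets of equivalence classes of the
  variants, and these yield a bijection.\<close>

lemma W_ext:
  assumes "W (Suc t) x y" "x \<in> tuples" "y \<in> tuples" "i < K"
  shows "\<exists>f. bij_betw f U U \<and> (\<forall>v \<in> U. W t (x[i := v]) (y[i := f v]))"
proof -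
  define c where "c x v = {z \<in> tuples. W t (x[i := v]) z}" for x v
  have c: "c x v = {z \<in> tuples. W t z0 z} \<longleftrightarrow> W t (x[i := v]) z0"
    if "x \<in> tuples" "v \<in> U" "z0 \<in> tuples" for x v z0
  proof
    assume "c x v = {z \<in> tuples. W t z0 z}"
    then have "z0 \<in> c x v" using W_refl that(3) by simp
    then show "W t (x[i := v]) z0" by (simp add: c_def)
  next
    assume *: "W t (x[i := v]) z0"
    then have "W t (x[i := v]) z \<longleftrightarrow> W t z0 z" for z using W_sym W_trans by blast
    then show "c x v = {z \<in> tuples. W t z0 z}" by (simp add: c_def)
  qed
  have count_c: "count (image_mset (c x) (mset_set U)) Z = card {v \<in> U. c x v = Z}" for x Z
    using count_image_mset_set[OF finite_U] .
  have "image_mset (c x) (mset_set U) = image_mset (c y) (mset_set U)"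
  proof (rule multiset_eqI, unfold count_c)
    fix Z
    show "card {v \<in> U. c x v = Z} = card {v \<in> U. c y v = Z}"
    proof (cases "\<exists>z0 \<in> tuples. Z = {z \<in> tuples. W t z0 z}")
      case True
      then obtain z0 where z0: "z0 \<in> tuples" "Z = {z \<in> tuples. W t z0 z}" by blast
      have "{v \<in> U. c x v = Z} = {v \<in> U. W t (x[i := v]) z0}" "{v \<in> U. c y v = Z} = {v \<in> U. W t (y[i := v]) z0}"
        unfolding z0(2) using c[OF assms(2) _ z0(1)] c[OF assms(3) _ z0(1)] by (intro Collect_cong conj_cong refl; simp)+
      then show ?thesis using assms(1,4) z0(1) by simp
    next
      case False
      then have "{v \<in> U. c x v = Z} = {}" "{v \<in> U. c y v = Z} = {}"
        using update_tuples assms(2,3) unfolding c_def by blast+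
      then show ?thesis by (simp only: card.empty)
    qed
  qed
  from bij_image_mset[OF finite_U finite_U this]
  obtain f where f: "bij_betw f U U" "\<forall>v \<in> U. c y (f v) = c x v" by auto
  have "W t (x[i := v]) (y[i := f v])" if v: "v \<in> U" for v
  proof -
    have fv: "f v \<in> U" using bij_betwE[OF f(1)] v by blast
    have "c x v = {z \<in> tuples. W t (y[i := f v]) z}" using f(2) v by (simp add: c_def)
    then show ?thesis using c[OF assms(2) v update_tuples[OF assms(3) fv]] by simp
  qed
  then show ?thesis using f(1) by blast
qed

lemma W_card_bij:
  assumes "bij_betw f U U" "\<And>v. v \<in> U \<Longrightarrow> W t (X v) (Y (f v))"
  shows "card {v \<in> U. W t (X v) z} = card {v \<in> U. W t (Y v) z}"
proof -
  have *: "W t (X v) z \<longleftrightarrow> W t (Y (f v)) z" if "v \<in> U" for v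
    using assms(2)[OF that] W_sym W_trans by blast
  have "f ` {v \<in> U. W t (X v) z} = {v \<in> U. W t (Y v) z}"
  proof (intro equalityI subsetI)
    show "w \<in> {v \<in> U. W t (Y v) z}" if "w \<in> f ` {v \<in> U. W t (X v) z}" for w
      using that * bij_betwE[OF assms(1)] by auto
    show "w \<in> f ` {v \<in> U. W t (X v) z}" if w: "w \<in> {v \<in> U. W t (Y v) z}" for w
    proof -
      have "w \<in> f ` U" using w assms(1) by (simp add: bij_betw_def)
      then obtain v where "v \<in> U" "w = f v" by blast
      then show ?thesis using w * by blast
    qed
  qed
  moreover have "inj_on f {v \<in> U. W t (X v) z}"
    by (rule inj_on_subset[of f U]) (use assms(1) in \<open>auto simp: bij_betw_def\<close>)
  ultimately show ?thesis using card_image by fastforce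
qed

lemma W_reindex:
  assumes "W t x y" "x \<in> tuples" "y \<in> tuples" "length \<sigma> = K" "set \<sigma> \<subseteq> {..<K}"
  shows "W t (map ((!) x) \<sigma>) (map ((!) y) \<sigma>)"
  using assms
proof (induction t arbitrary: x y \<sigma>)
  case 0
  have "\<sigma> ! i < K" if "i < K" for i using 0(4,5) that by (metis lessThan_iff nth_mem subsetD)
  then show ?case using 0(1,4) by (simp add: atomic_def)
next
  case (Suc t)
  have len: "length x = K" "length y = K" using Suc.prems by (simp_all add: tuples_def)
  have "W t (map ((!) x) \<sigma>) (map ((!) y) \<sigma>)" using Suc by simp
  moreover have "card {v \<in> U. W t ((map ((!) x) \<sigma>)[i := v]) z} = card {v \<in> U. W t ((map ((!) y) \<sigma>)[i := v]) z}"
    if i: "i < K" for i z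
  proof -
    \<comment> \<open>Pigeonhole: the positions other than \<open>i\<close> use at most
      \<open>K - 1\<close> coordinates of \<open>x\<close>. So some coordinate \<open>j\<close> is
      free to receive the new vertex, and an update after reindexing becomes an update before
      it.\<close>
    have "card ((!) \<sigma> ` ({..<K} - {i})) \<le> card ({..<K} - {i})" by (rule card_image_le) simp
    also have "\<dots> < card {..<K}" using i by simp
    finally have "\<not> {..<K} \<subseteq> (!) \<sigma> ` ({..<K} - {i})"
      using card_mono[of "(!) \<sigma> ` ({..<K} - {i})" "{..<K}"] by auto
    then obtain j where "j < K" "j \<notin> (!) \<sigma> ` ({..<K} - {i})" by blast
    then have j: "j < K" "\<And>l. l < K \<Longrightarrow> l \<noteq> i \<Longrightarrow> \<sigma> ! l \<noteq> j" by auto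
    define \<tau> where "\<tau> = \<sigma>[i := j]"
    have \<tau>: "length \<tau> = K" "set \<tau> \<subseteq> {..<K}"
      using Suc.prems(4,5) j(1) set_update_subset_insert[of \<sigma> i j] by (auto simp: \<tau>_def)
    have upd: "(map ((!) x) \<sigma>)[i := v] = map ((!) (x[j := v])) \<tau>" if "length x = K" for x v
    proof (rule nth_equalityI)
      fix l assume "l < length ((map ((!) x) \<sigma>)[i := v])"
      then have "l < K" using Suc.prems(4) by simp
      then show "(map ((!) x) \<sigma>)[i := v] ! l = map ((!) (x[j := v])) \<tau> ! l"
        using j i that Suc.prems(4) by (cases "l = i") (auto simp: \<tau>_def nth_list_update)
    qed (use \<tau> Suc.prems(4) in simp)
    obtain f where f: "bij_betw f U U" "\<forall>v \<in> U. W t (x[j := v]) (y[j := f v])"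
      using W_ext[OF Suc.prems(1-3) j(1)] by (elim exE conjE)
    show ?thesis
    proof (rule W_card_bij[OF f(1)])
      fix v assume v: "v \<in> U"
      have fv: "f v \<in> U" using bij_betwE[OF f(1)] v by blast
      show "W t ((map ((!) x) \<sigma>)[i := v]) ((map ((!) y) \<sigma>)[i := f v])"
        unfolding upd[OF len(1)] upd[OF len(2)]
        by (rule Suc.IH[OF bspec[OF f(2) v] update_tuples[OF Suc.prems(2) v] update_tuples[OF Suc.prems(3) fv] \<tau>])
    qed
  qed
  ultimately show ?case by simp
qed

lemma W_automorphism:
  assumes "bij_betw \<pi> U U" "\<And>u w. u \<in> U \<Longrightarrow> w \<in> U \<Longrightarrow> (E (\<pi> u) (\<pi> w) \<longleftrightarrow> E u w) \<and> (S (\<pi> u) (\<pi> w) \<longleftrightarrow> S u w)"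
    and "x \<in> tuples"
  shows "W t x (map \<pi> x)"
  using assms(3)
proof (induction t arbitrary: x)
  case 0
  have mem: "x ! i \<in> U" if "i < K" for i using 0 that by (auto simp: tuples_def)
  have len: "length x = K" using 0 by (simp add: tuples_def)
  have inj: "\<pi> u = \<pi> w \<longleftrightarrow> u = w" if "u \<in> U" "w \<in> U" for u w
    using assms(1) that by (auto simp: bij_betw_def inj_on_def)
  show ?case using mem len inj assms(2) by (simp add: atomic_def)
next
  case (Suc t)
  have "card {v \<in> U. W t (x[i := v]) z} = card {v \<in> U. W t ((map \<pi> x)[i := v]) z}" for i z
  proof (rule W_card_bij[OF assms(1)])
    fix v assume "v \<in> U"
    then have "W t (x[i := v]) (map \<pi> (x[i := v]))" using Suc update_tuples by blast
    then show "W t (x[i := v]) ((map \<pi> x)[i := \<pi> v])" by (simp add: map_update)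
  qed
  then show ?case using Suc by simp
qed

text \<open>The number of pairs of tuples. Every round before stability separates at least one
  further pair.\<close>

definition stab :: nat where "stab = card U ^ (2 * K)"

lemma W_stable:
  assumes "x \<in> tuples" "y \<in> tuples"
  shows "W (Suc stab) x y \<longleftrightarrow> W stab x y"
proof -
  define V where "V t = {(x, y) \<in> tuples \<times> tuples. W t x y}" for t
  have dec: "V (Suc t) \<subseteq> V t" for t by (auto simp: V_def)
  have fin: "finite (V t)" for t
    by (rule finite_subset[of _ "tuples \<times> tuples"]) (auto simp: V_def finite_tuples)
  have stays: "V (Suc (Suc t)) = V (Suc t)" if "V (Suc t) = V t" for t
  proof -
    have *: "W (Suc t) x y \<longleftrightarrow> W t x y" if "x \<in> tuples" "y \<in> tuples" for x y
      using \<open>V (Suc t) = V t\<close> that by (auto simp: V_def set_eq_iff simp del: W.simps)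
    have "W (Suc (Suc t)) x y \<longleftrightarrow> W (Suc t) x y" if xy: "x \<in> tuples" "y \<in> tuples" for x y
    proof -
      have "{v \<in> U. W (Suc t) (x[i := v]) z} = {v \<in> U. W t (x[i := v]) z}"
           "{v \<in> U. W (Suc t) (y[i := v]) z} = {v \<in> U. W t (y[i := v]) z}" if "z \<in> tuples" for i z
        using *[OF update_tuples[OF xy(1)] that] *[OF update_tuples[OF xy(2)] that] by (simp_all cong: conj_cong del: W.simps)
      then show ?thesis using *[OF xy] W.simps(2)[of "Suc t" x y] W.simps(2)[of t x y] by simp
    qed
    then show ?thesis by (auto simp: V_def simp del: W.simps)
  qed
  have later: "V (Suc t) = V t" if "V (Suc s) = V s" "s \<le> t" for s t
    using that(2,1)
  proof (induction rule: dec_induct)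
    case base
    then show ?case .
  next
    case (step n)
    then show ?case using stays[of n] by blast
  qed
  have less: "V (Suc t) = V t \<or> card (V (Suc t)) < card (V t)" for t
    using psubset_card_mono[OF fin[of t], of "V (Suc t)"] dec[of t] unfolding psubset_eq by blast
  have bound: "V (Suc t) = V t \<or> card (V (Suc t)) + Suc t \<le> card (V 0)" for t
  proof (induction t)
    case 0
    then show ?case using less[of 0] by auto
  next
    case (Suc t)
    then show ?case
    proof
      assume "V (Suc t) = V t"
      then show ?thesis using stays[of t] by blast
    next
      assume "card (V (Suc t)) + Suc t \<le> card (V 0)"
      then show ?thesis using less[of "Suc t"] by auto
    qed
  qed
  have "card (V 0) \<le> card (tuples \<times> tuples)"
    by (rule card_mono) (auto simp: V_def finite_tuples)
  also have "\<dots> = stab" by (simp add: card_cartesian_product card_tuples stab_def power_mult power2_eq_square mult.commute power_mult_distrib)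
  finally have "V (Suc stab) = V stab" using bound[of stab] by linarith
  then show ?thesis using assms by (auto simp: V_def set_eq_iff simp del: W.simps)
qed

text \<open>Repeating the first entry adds no information, so short tuples inherit the equivalence
  of full ones. Appending a vertex overwrites the first repetition, see
  \<open>pad_snoc\<close>.\<close>

definition pad :: "'a list \<Rightarrow> 'a list" where "pad x = x @ replicate (K - length x) (hd x)"

definition R :: "'a list \<Rightarrow> 'a list \<Rightarrow> bool" where
  "R x y \<longleftrightarrow> x \<noteq> [] \<and> length x = length y \<and> length x \<le> K \<and> set x \<subseteq> U \<and> set y \<subseteq> U \<and> W stab (pad x) (pad y)"

lemma pad_tuples: "x \<noteq> [] \<Longrightarrow> length x \<le> K \<Longrightarrow> set x \<subseteq> U \<Longrightarrow> pad x \<in> tuples"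
  by (auto simp: pad_def tuples_def)

lemma pad_nth: "i < length x \<Longrightarrow> pad x ! i = x ! i"
  by (simp add: pad_def nth_append)

lemma pad_snoc:
  assumes "x \<noteq> []" "length x < K"
  shows "(pad x)[length x := v] = pad (x @ [v])"
proof -
  obtain m where m: "K - length x = Suc m" using assms(2) by (metis Suc_diff_Suc)
  then have "K - length (x @ [v]) = m" by simp
  then show ?thesis using m assms(1) by (simp add: pad_def list_update_append)
qed

lemma pad_map:
  assumes "x \<noteq> []" "js \<noteq> []" "set js \<subseteq> {..<length x}" "length js \<le> K"
  shows "pad (map ((!) x) js) = map ((!) (pad x)) (js @ replicate (K - length js) (hd js))"
proof -
  have "hd js < length x" using assms(2,3) hd_in_set by fastforce
  moreover have "map ((!) (pad x)) js = map ((!) x) js" using assms(3) pad_nth by auto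
  ultimately show ?thesis using assms(2) by (simp add: pad_def[of "map _ _"] hd_map pad_nth)
qed

sublocale wl_equivalence U E S K R
proof (unfold_locales)
  show "finite U" by (rule finite_U)
  show "E w u" if "E u w" for u w using that by (rule E_sym)
  show "equivp S" by (rule S_equiv)
  show "set x \<subseteq> U \<and> set y \<subseteq> U \<and> length x = length y \<and> x \<noteq> []" if "R x y" for x y
    using that by (simp add: R_def)
  show "R x x" if "x \<noteq> []" "set x \<subseteq> U" "length x \<le> K" for x using that W_refl by (simp add: R_def)
  show "R y x" if "R x y" for x y using that W_sym[of stab "pad x" "pad y"] by (auto simp: R_def)
  show "R x z" if "R x y" "R y z" for x y z using that W_trans[of stab "pad x" "pad y" "pad z"] by (auto simp: R_def)
next
  fix x y i j assume *: "R x y" "i < length x" "j < length x"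
  then have at: "atomic (pad x) (pad y)" and len: "length x = length y" "length x \<le> K"
    using W_mono[of 0 stab] by (auto simp: R_def)
  have "i < K" "j < K" using * len by simp_all
  then show "(x ! i = x ! j \<longleftrightarrow> y ! i = y ! j) \<and> (E (x ! i) (x ! j) \<longleftrightarrow> E (y ! i) (y ! j)) \<and> (S (x ! i) (x ! j) \<longleftrightarrow> S (y ! i) (y ! j))"
    using at[unfolded atomic_def, rule_format, of i j] * len by (simp add: pad_nth)
next
  fix x y assume *: "R x y" "length x < K"
  then have xy: "x \<noteq> []" "y \<noteq> []" "length y = length x" "set x \<subseteq> U" "set y \<subseteq> U" by (auto simp: R_def)
  have T: "pad x \<in> tuples" "pad y \<in> tuples" using pad_tuples xy *(2) by simp_all
  \<comment> \<open>Each extension consumes one round; at the stable stage a further round is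
    available at no cost.\<close>
  have WS: "W (Suc stab) (pad x) (pad y)" using W_stable[OF T] * by (simp add: R_def del: W.simps)
  obtain f where f: "bij_betw f U U" "\<forall>v \<in> U. W stab ((pad x)[length x := v]) ((pad y)[length x := f v])"
    using W_ext[OF WS T *(2)] by (elim exE conjE)
  have "R (x @ [v]) (y @ [f v])" if "v \<in> U" for v
  proof -
    have "f v \<in> U" using bij_betwE[OF f(1)] that by blast
    moreover have "W stab (pad (x @ [v])) (pad (y @ [f v]))"
      using f(2) that pad_snoc[of x] pad_snoc[of y] xy *(2) by simp
    ultimately show ?thesis using that xy *(2) by (simp add: R_def)
  qed
  then show "\<exists>f. bij_betw f U U \<and> (\<forall>v \<in> U. R (x @ [v]) (y @ [f v]))" using f(1) by blast
next
  fix x y js assume *: "R x y" "js \<noteq> []" "set js \<subseteq> {..<length x}" "length js \<le> K"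
  then have xy: "x \<noteq> []" "y \<noteq> []" "length y = length x" "set x \<subseteq> U" "set y \<subseteq> U" "length x \<le> K" "W stab (pad x) (pad y)"
    by (auto simp: R_def)
  have T: "pad x \<in> tuples" "pad y \<in> tuples" using pad_tuples xy by simp_all
  have "hd js < length x" using *(2,3) hd_in_set by fastforce
  then have "set (js @ replicate (K - length js) (hd js)) \<subseteq> {..<K}"
    using *(3) xy(6) by (auto simp: subset_eq)
  then have "W stab (pad (map ((!) x) js)) (pad (map ((!) y) js))"
    using W_reindex[OF xy(7) T, of "js @ replicate (K - length js) (hd js)"] * xy by (simp add: pad_map)
  moreover have "set (map ((!) x) js) \<subseteq> U" "set (map ((!) y) js) \<subseteq> U"
    using *(3) xy(3,4,5) by (auto simp: subset_eq)
  ultimately show "R (map ((!) x) js) (map ((!) y) js)" using *(2,4) by (simp add: R_def)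
qed

end

section \<open>Expressions with three labels\<close>

lemma expr_arcs_verts: "expr_arcs e \<subseteq> (fst ` labeled_verts e) \<times> (fst ` labeled_verts e)"
proof (induction e)
  case (DUnion es)
  then show ?case by fastforce
next
  case (Join i j e)
  have "expr_arcs (Join i j e) \<subseteq> expr_arcs e \<union> (fst ` labeled_verts e) \<times> (fst ` labeled_verts e)" by force
  then show ?case using Join by auto
next
  case (Relabel i j e)
  have "fst ` labeled_verts (Relabel i j e) = fst ` labeled_verts e" by force
  then show ?case using Relabel by simp
qed simp

lemma labeled_verts_labels: "snd ` labeled_verts e \<subseteq> expr_labels e"
  by (induction e) fastforce+

context wl_equivalence begin

text \<open>Vertices with the same label have the same outside neighbourhood, so there are at most
  as many neighbourhoods as labels.\<close>

lemma few_classes_if_labeled: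
  assumes "X = fst ` M" "snd ` M \<subseteq> L" "finite L" "card L \<le> 3"
    and "\<And>u u' i z. (u, i) \<in> M \<Longrightarrow> (u', i) \<in> M \<Longrightarrow> z \<in> U - X \<Longrightarrow> E u z \<longleftrightarrow> E u' z"
  shows "few_classes X"
proof -
  define N where "N u = {w \<in> U - X. E u w}" for u
  define c where "c i = N (SOME u. (u, i) \<in> M)" for i
  have "N ` X \<subseteq> c ` L"
  proof
    fix A assume "A \<in> N ` X"
    then obtain u i where u: "(u, i) \<in> M" "A = N u" using assms(1) by auto
    have "(SOME u. (u, i) \<in> M, i) \<in> M" using u(1) by (rule someI)
    then have "N u = c i" unfolding c_def N_def using assms(5)[OF u(1)] by blast
    moreover have "i \<in> L" using u(1) assms(2) by force
    ultimately show "A \<in> c ` L" using u(2) by blast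
  qed
  then have "card (N ` X) \<le> card L"
    using assms(3) surj_card_le by blast
  then show ?thesis using assms(4) by (simp add: few_classes_def N_def)
qed

text \<open>Here \<open>J\<close> collects the pairs of labels that are joined above \<open>e\<close>.\<close>

lemma decomposable_expr:
  assumes "wf_expr e" "expr_labels e \<subseteq> L" "finite L" "card L \<le> 3"
    and "fst ` labeled_verts e \<noteq> {}"
    and "\<And>u u' i z. (u, i) \<in> labeled_verts e \<Longrightarrow> (u', i) \<in> labeled_verts e \<Longrightarrow>
      z \<in> U - fst ` labeled_verts e \<Longrightarrow> E u z \<longleftrightarrow> E u' z"
    and "\<And>u w i j. (u, i) \<in> labeled_verts e \<Longrightarrow> (w, j) \<in> labeled_verts e \<Longrightarrow>
      E u w \<longleftrightarrow> (u, w) \<in> expr_arcs e \<or> (i, j) \<in> J"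
  shows "decomposable (fst ` labeled_verts e)"
  using assms(1,2,5-)
proof (induction e arbitrary: J)
  case (Create v i)
  then show ?case by (simp add: leaf)
next
  case (Relabel i j e)
  define r where "r l = (if l = i then j else l)" for l
  have V: "fst ` labeled_verts (Relabel i j e) = fst ` labeled_verts e" by force
  have M: "(u, r l) \<in> labeled_verts (Relabel i j e)" if "(u, l) \<in> labeled_verts e" for u l
    using that by (force simp: r_def)
  have "decomposable (fst ` labeled_verts e)"
  \<comment> \<open>Joins above refer to the new labels; for \<open>e\<close> they are pulled back
    along the renaming.\<close>
  proof (rule Relabel.IH[where J = "{(a, b). (r a, r b) \<in> J}"])
    show "wf_expr e" "expr_labels e \<subseteq> L" using Relabel.prems(1,2) by simp_all
    show "fst ` labeled_verts e \<noteq> {}" using Relabel.prems(3) V by simp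
    show "E u z \<longleftrightarrow> E u' z" if "(u, l) \<in> labeled_verts e" "(u', l) \<in> labeled_verts e" "z \<in> U - fst ` labeled_verts e" for u u' l z
      using Relabel.prems(4)[OF M[OF that(1)] M[OF that(2)]] that(3) unfolding V by blast
    show "E u w \<longleftrightarrow> (u, w) \<in> expr_arcs e \<or> (a, b) \<in> {(a, b). (r a, r b) \<in> J}"
      if "(u, a) \<in> labeled_verts e" "(w, b) \<in> labeled_verts e" for u w a b
      using Relabel.prems(5)[OF M[OF that(1)] M[OF that(2)]] by simp
  qed
  then show ?case unfolding V .
next
  case (Join i j e)
  have fn: "a = b" if "(u, a) \<in> labeled_verts e" "(u, b) \<in> labeled_verts e" for u a b
    using labeled_verts_functional Join.prems(1) that by fastforce
  have "decomposable (fst ` labeled_verts e)"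
  proof (rule Join.IH[where J = "insert (i, j) (insert (j, i) J)"])
    show "wf_expr e" "expr_labels e \<subseteq> L" using Join.prems(1,2) by simp_all
    show "fst ` labeled_verts e \<noteq> {}" using Join.prems(3) by simp
    show "E u z \<longleftrightarrow> E u' z" if "(u, l) \<in> labeled_verts e" "(u', l) \<in> labeled_verts e" "z \<in> U - fst ` labeled_verts e" for u u' l z
      using Join.prems(4)[of u l u' z] that by simp
    show "E u w \<longleftrightarrow> (u, w) \<in> expr_arcs e \<or> (a, b) \<in> insert (i, j) (insert (j, i) J)"
      if ab: "(u, a) \<in> labeled_verts e" "(w, b) \<in> labeled_verts e" for u w a b
    proof -
      have "(u, i) \<in> labeled_verts e \<longleftrightarrow> a = i" "(u, j) \<in> labeled_verts e \<longleftrightarrow> a = j"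
        "(w, i) \<in> labeled_verts e \<longleftrightarrow> b = i" "(w, j) \<in> labeled_verts e \<longleftrightarrow> b = j"
        using fn ab by blast+
      then show ?thesis using Join.prems(5)[of u a w b] ab by auto
    qed
  qed
  then show ?case by simp
next
  case (DUnion es)
  let ?n = "length es"
  define V where "V k = fst ` labeled_verts (es ! k)" for k
  have lab: "labeled_verts (DUnion es) = (\<Union>k < ?n. labeled_verts (es ! k))"
    by (force simp: in_set_conv_nth)
  have arcs: "expr_arcs (DUnion es) = (\<Union>k < ?n. expr_arcs (es ! k))"
    by (force simp: in_set_conv_nth)
  have VV: "fst ` labeled_verts (DUnion es) = (\<Union>k < ?n. V k)"
    unfolding lab V_def by blast
  have disj: "V k \<inter> V l = {}" if "k < ?n" "l < ?n" "k \<noteq> l" for k l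
    using DUnion.prems(1) that by (simp add: V_def)
  have inV: "u \<in> V k" if "(u, i) \<in> labeled_verts (es ! k)" for u i k
    using that by (force simp: V_def)
  have arc_same: "(u, w) \<in> expr_arcs (DUnion es) \<longleftrightarrow> k = l \<and> (u, w) \<in> expr_arcs (es ! k)"
    if kl: "k < ?n" "l < ?n" "u \<in> V k" "w \<in> V l" for u w k l
  proof
    assume "(u, w) \<in> expr_arcs (DUnion es)"
    then obtain m where m: "m < ?n" "(u, w) \<in> expr_arcs (es ! m)" unfolding arcs by blast
    then have "u \<in> V m" "w \<in> V m" using expr_arcs_verts[of "es ! m"] by (auto simp: V_def)
    then have "k = m" "l = m" using disj[OF kl(1) m(1)] disj[OF kl(2) m(1)] kl(3,4) by blast+
    then show "k = l \<and> (u, w) \<in> expr_arcs (es ! k)" using m(2) by simp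
  next
    assume "k = l \<and> (u, w) \<in> expr_arcs (es ! k)"
    then show "(u, w) \<in> expr_arcs (DUnion es)" using kl(1) unfolding arcs by blast
  qed
  have edge: "E u w \<longleftrightarrow> (k = l \<and> (u, w) \<in> expr_arcs (es ! k)) \<or> (i, j) \<in> J"
    if "k < ?n" "l < ?n" "(u, i) \<in> labeled_verts (es ! k)" "(w, j) \<in> labeled_verts (es ! l)" for u w i j k l
  proof -
    have "(u, i) \<in> labeled_verts (DUnion es)" "(w, j) \<in> labeled_verts (DUnion es)" using that unfolding lab by blast+
    then show ?thesis
      using DUnion.prems(5) arc_same[OF that(1,2) inV[OF that(3)] inV[OF that(4)]] by simp
  qed
  have same: "E u z \<longleftrightarrow> E u' z"
    if M: "M \<subseteq> {..<?n}" and kl: "k \<in> M" "l \<in> M" and u: "(u, i) \<in> labeled_verts (es ! k)" "(u', i) \<in> labeled_verts (es ! l)"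
      and z: "z \<in> U - (\<Union>k \<in> M. V k)" for M k l u u' i z
  proof (cases "z \<in> (\<Union>k < ?n. V k)")
    case True
    then obtain m where m: "m < ?n" "z \<in> V m" by blast
    then obtain j where j: "(z, j) \<in> labeled_verts (es ! m)" by (auto simp: V_def)
    have kl': "k < ?n" "l < ?n" using M kl by blast+
    have "k \<noteq> m" "l \<noteq> m" using z kl m by blast+
    then show ?thesis using edge[OF kl'(1) m(1) u(1) j] edge[OF kl'(2) m(1) u(2) j] by simp
  next
    case False
    have "(u, i) \<in> labeled_verts (DUnion es)" "(u', i) \<in> labeled_verts (DUnion es)"
      using u kl M unfolding lab by blast+
    then show ?thesis using DUnion.prems(4) False z unfolding VV by blast
  qed
  \<comment> \<open>Stated for unions of arbitrary operands: the binary decomposition splits off one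
    operand at a time, so the union of all preceding ones is a part as well.\<close>
  have few: "few_classes (\<Union>k \<in> M. V k)" if M: "M \<subseteq> {..<?n}" for M
  proof (rule few_classes_if_labeled[where M = "\<Union>k \<in> M. labeled_verts (es ! k)", OF _ _ assms(3,4)])
    show "(\<Union>k \<in> M. V k) = fst ` (\<Union>k \<in> M. labeled_verts (es ! k))" unfolding V_def by blast
    show "snd ` (\<Union>k \<in> M. labeled_verts (es ! k)) \<subseteq> L"
    proof -
      have "snd ` labeled_verts (es ! k) \<subseteq> L" if "k \<in> M" for k
      proof -
        have "es ! k \<in> set es" using that M by auto
        then have "expr_labels (es ! k) \<subseteq> L" using DUnion.prems(2) by auto
        then show ?thesis using labeled_verts_labels[of "es ! k"] by blast
      qed
      then show ?thesis by blast
    qed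
    fix u u' i z
    assume "(u, i) \<in> (\<Union>k \<in> M. labeled_verts (es ! k))" "(u', i) \<in> (\<Union>k \<in> M. labeled_verts (es ! k))"
      and z: "z \<in> U - (\<Union>k \<in> M. V k)"
    then obtain k l where kl: "k \<in> M" "l \<in> M" "(u, i) \<in> labeled_verts (es ! k)" "(u', i) \<in> labeled_verts (es ! l)" by blast
    show "E u z \<longleftrightarrow> E u' z" by (rule same[OF M kl z])
  qed
  have part: "decomposable (V k)" if k: "k < ?n" "V k \<noteq> {}" for k
    unfolding V_def
  proof (rule DUnion.IH[where J = J])
    show "es ! k \<in> set es" using k(1) by simp
    show "wf_expr (es ! k)" using DUnion.prems(1) k(1) by simp
    have "es ! k \<in> set es" using k(1) by simp
    then show "expr_labels (es ! k) \<subseteq> L" using DUnion.prems(2) by auto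
    show "fst ` labeled_verts (es ! k) \<noteq> {}" using k(2) by (simp add: V_def)
    show "E u z \<longleftrightarrow> E u' z" if "(u, i) \<in> labeled_verts (es ! k)" "(u', i) \<in> labeled_verts (es ! k)"
      "z \<in> U - fst ` labeled_verts (es ! k)" for u u' i z
      using same[of "{k}" k k u i u' z] that k(1) by (simp add: V_def)
    show "E u w \<longleftrightarrow> (u, w) \<in> expr_arcs (es ! k) \<or> (i, j) \<in> J"
      if "(u, i) \<in> labeled_verts (es ! k)" "(w, j) \<in> labeled_verts (es ! k)" for u w i j
      using edge[OF k(1) k(1) that] by simp
  qed
  \<comment> \<open>Decomposable sets are nonempty, so empty operands have to be skipped.\<close>
  have "(\<Union>k < m. V k) = {} \<or> decomposable (\<Union>k < m. V k)" if "m \<le> ?n" for m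
    using that
  proof (induction m)
    case (Suc m)
    have split: "(\<Union>k < Suc m. V k) = (\<Union>k < m. V k) \<union> V m" by (auto simp: less_Suc_eq)
    show ?case
    proof (cases "V m = {} \<or> (\<Union>k < m. V k) = {}")
      case True
      have "m < ?n" "m \<le> ?n" using Suc.prems by simp_all
      then show ?thesis using True Suc.IH part[of m] unfolding split by (metis Un_empty_left Un_empty_right)
    next
      case False
      have "decomposable ((\<Union>k < m. V k) \<union> V m)"
      proof (rule node)
        show "decomposable (\<Union>k < m. V k)" using False Suc by auto
        show "decomposable (V m)" using False Suc.prems by (intro part) auto
        have "V k \<inter> V m = {}" if "k < m" for k using disj[of k m] that Suc.prems by simp
        then show "(\<Union>k < m. V k) \<inter> V m = {}" by blast
        show "few_classes (\<Union>k < m. V k)" using Suc.prems by (intro few) auto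
        show "few_classes (V m)" using few[of "{m}"] Suc.prems by simp
      qed
      then show ?thesis unfolding split by simp
    qed
  qed simp
  then show ?case using DUnion.prems(3) unfolding VV by blast
qed

end

section \<open>Isomorphism of graphs as equivalence of tuples\<close>

definition side :: "nat \<Rightarrow> nat \<Rightarrow> nat \<Rightarrow> bool" where
  "side n u w \<longleftrightarrow> (u < n \<longleftrightarrow> w < n)"

definition union_edge :: "nat \<Rightarrow> nat rel \<Rightarrow> nat rel \<Rightarrow> nat \<Rightarrow> nat \<Rightarrow> bool" where
  "union_edge n A B u w \<longleftrightarrow> (u < n \<and> w < n \<and> (u, w) \<in> A) \<or> (n \<le> u \<and> n \<le> w \<and> (u - n, w - n) \<in> B)"

lemma input_graphD:
  assumes "input_graph G"
  shows "pair_graph G" "pverts G = {..<card (pverts G)}" "(u, w) \<in> parcs G \<Longrightarrow> (w, u) \<in> parcs G"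
    "(u, w) \<in> parcs G \<Longrightarrow> u < card (pverts G) \<and> w < card (pverts G)"
proof -
  show G: "pair_graph G" using assms by (simp add: input_graph_def)
  obtain n where n: "pverts G = {..<n}" using assms by (auto simp: input_graph_def)
  then show "pverts G = {..<card (pverts G)}" by (metis card_lessThan)
  interpret pair_graph G by fact
  show "(w, u) \<in> parcs G" if "(u, w) \<in> parcs G"
    using pair_sym_arcs that by (auto simp: symmetric_def dest: symD)
  show "u < card (pverts G) \<and> w < card (pverts G)" if "(u, w) \<in> parcs G"
    using in_arcsD1[OF that] in_arcsD2[OF that] n by simp
qed

lemma refinement_union_edge:
  assumes "input_graph G" "input_graph H"
  shows "refinement {..<N :: nat} (union_edge n (parcs G) (parcs H)) (side n)"
proof
  show "finite {..<N}" by simp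
  show "union_edge n (parcs G) (parcs H) w u" if "union_edge n (parcs G) (parcs H) u w" for u w
    using that input_graphD(3)[OF assms(1)] input_graphD(3)[OF assms(2)] by (auto simp: union_edge_def)
  show "equivp (side n)" by (auto simp: side_def intro!: equivpI reflpI sympI transpI)
qed

text \<open>An isomorphism yields an automorphism of the union that swaps the graphs, hence
  equivalent tuples on different sides. Conversely a single equivalent pair is enough: its first
  entries are base vertices, and a side is one component at the top level. Two null graphs have no
  tuples at all, which explains the separate disjunct.\<close>

lemma digraph_iso_iff_W:
  assumes G: "input_graph G" "clique_width G \<le> 3" and H: "input_graph H" and K: "22 \<le> K"
    and n: "n1 = card (pverts G)" "n2 = card (pverts H)"
  defines "T \<equiv> refinement.tuples {..<n1 + n2} K"
    and "W \<equiv> refinement.W {..<n1 + n2} (union_edge n1 (parcs G) (parcs H)) (side n1) K ((n1 + n2) ^ (2 * K))"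
  shows "digraph_iso (with_proj G) (with_proj H) \<longleftrightarrow>
    n1 + n2 = 0 \<or> (\<exists>x \<in> T. \<exists>y \<in> T. x ! 0 < n1 \<and> n1 \<le> y ! 0 \<and> W x y)"
proof -
  let ?U = "{..<n1 + n2}" and ?E = "union_edge n1 (parcs G) (parcs H)" and ?S = "side n1"
  interpret r: refinement ?U ?E ?S K by (rule refinement_union_edge[OF G(1) H])
  have stab: "r.stab = (n1 + n2) ^ (2 * K)" by (simp add: r.stab_def)
  have T: "T = r.tuples" by (simp add: T_def)
  have W: "W = r.W r.stab" by (simp add: W_def stab)
  have V: "pverts G = {..<n1}" "pverts H = {..<n2}" unfolding n by (rule input_graphD(2)[OF G(1)] input_graphD(2)[OF H])+
  have iso: "digraph_iso (with_proj G) (with_proj H) \<longleftrightarrow> (\<exists>f. bij_betw f {..<n1} {..<n2} \<and>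
      (\<forall>u < n1. \<forall>v < n1. (u, v) \<in> parcs G \<longleftrightarrow> (f u, f v) \<in> parcs H))"
    using digraph_iso_pair_graph[OF input_graphD(1)[OF G(1)] input_graphD(1)[OF H]] V by (simp add: Ball_def)
  show ?thesis
  proof
    assume "digraph_iso (with_proj G) (with_proj H)"
    then obtain f where f: "bij_betw f {..<n1} {..<n2}"
      "\<And>u v. u < n1 \<Longrightarrow> v < n1 \<Longrightarrow> (u, v) \<in> parcs G \<longleftrightarrow> (f u, f v) \<in> parcs H" using iso by auto
    have eq: "n1 = n2" using bij_betw_same_card[OF f(1)] by simp
    define g where "g = the_inv_into {..<n1} f"
    have g: "bij_betw g {..<n1} {..<n1}" unfolding g_def using bij_betw_the_inv_into[OF f(1)] eq by simp
    have fg: "f (g u) = u" if "u < n1" for u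
      unfolding g_def using f_the_inv_into_f_bij_betw[OF f(1)] that eq by simp
    have f_lt: "f u < n1" if "u < n1" for u using bij_betwE[OF f(1)] that eq by simp
    have g_lt: "g u < n1" if "u < n1" for u using bij_betwE[OF g] that by simp
    \<comment> \<open>The automorphism that swaps the two graphs: \<open>f\<close> in one direction
      and its inverse in the other.\<close>
    define \<pi> where "\<pi> u = (if u < n1 then n1 + f u else g (u - n1))" for u
    have "inj_on \<pi> ?U"
    proof (rule inj_onI)
      fix u w assume uw: "u \<in> ?U" "w \<in> ?U" "\<pi> u = \<pi> w"
      have fi: "inj_on f {..<n1}" and gi: "inj_on g {..<n1}" using f(1) g by (auto simp: bij_betw_def)
      consider "u < n1" "w < n1" | "u < n1" "\<not> w < n1" | "\<not> u < n1" "w < n1" | "\<not> u < n1" "\<not> w < n1" by blast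
      then show "u = w"
      proof cases
        case 1
        then show ?thesis using uw(3) fi by (simp add: \<pi>_def inj_on_def)
      next
        case 2
        then have "w - n1 < n1" using uw(2) eq by auto
        then show ?thesis using 2 uw(3) g_lt[of "w - n1"] by (simp add: \<pi>_def)
      next
        case 3
        then have "u - n1 < n1" using uw(1) eq by auto
        then show ?thesis using 3 uw(3) g_lt[of "u - n1"] by (simp add: \<pi>_def)
      next
        case 4
        then have "u - n1 < n1" "w - n1 < n1" using uw(1,2) eq by auto
        then have "u - n1 = w - n1" using 4 uw(3) gi by (simp add: \<pi>_def inj_on_def)
        then show ?thesis using 4 by simp
      qed
    qed
    moreover have "\<pi> ` ?U \<subseteq> ?U"
    proof
      fix z assume "z \<in> \<pi> ` ?U"
      then obtain u where u: "u < n1 + n2" "z = \<pi> u" by auto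
      have "u - n1 < n1" if "\<not> u < n1" using u(1) that eq by simp
      then show "z \<in> ?U" using u f_lt[of u] g_lt[of "u - n1"] eq by (auto simp: \<pi>_def)
    qed
    ultimately have \<pi>: "bij_betw \<pi> ?U ?U" unfolding bij_betw_def using endo_inj_surj by blast
    have auto: "(?E (\<pi> u) (\<pi> w) \<longleftrightarrow> ?E u w) \<and> (?S (\<pi> u) (\<pi> w) \<longleftrightarrow> ?S u w)" if uw: "u \<in> ?U" "w \<in> ?U" for u w
    proof -
      have lt: "\<pi> u < n1 \<longleftrightarrow> \<not> u < n1" if "u \<in> ?U" for u
      proof (cases "u < n1")
        case False
        then have "u - n1 < n1" using that eq by auto
        then show ?thesis using False g_lt[of "u - n1"] by (simp add: \<pi>_def)
      qed (simp add: \<pi>_def)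
      have "?E (\<pi> u) (\<pi> w) \<longleftrightarrow> ?E u w"
      proof -
        consider "u < n1" "w < n1" | "u < n1" "\<not> w < n1" | "\<not> u < n1" "w < n1" | "\<not> u < n1" "\<not> w < n1" by blast
        then show ?thesis
        proof cases
          case 1
          then show ?thesis using f(2) by (simp add: union_edge_def \<pi>_def)
        next
          case 4
          then have "u - n1 < n1" "w - n1 < n1" using uw eq by auto
          moreover from this have "g (u - n1) < n1" "g (w - n1) < n1" using g_lt by simp_all
          ultimately show ?thesis using 4 f(2)[of "g (u - n1)" "g (w - n1)"] fg by (simp add: union_edge_def \<pi>_def not_less)
        qed (use lt[OF uw(1)] lt[OF uw(2)] in \<open>auto simp: union_edge_def\<close>)
      qed
      then show ?thesis using lt uw by (simp add: side_def)
    qed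
    show "n1 + n2 = 0 \<or> (\<exists>x \<in> T. \<exists>y \<in> T. x ! 0 < n1 \<and> n1 \<le> y ! 0 \<and> W x y)"
    proof (cases "n1 = 0")
      case False
      define x where "x = replicate K (0 :: nat)"
      have x: "x \<in> r.tuples" using False by (auto simp: x_def r.tuples_def)
      have y: "map \<pi> x \<in> r.tuples" using x bij_betwE[OF \<pi>] by (auto simp: r.tuples_def)
      have "r.W r.stab x (map \<pi> x)" by (rule r.W_automorphism[OF \<pi> auto x])
      moreover have "x ! 0 < n1" "n1 \<le> map \<pi> x ! 0" using K False by (simp_all add: x_def \<pi>_def)
      ultimately show ?thesis using x y unfolding T W by blast
    qed (use eq in simp)
  next
    assume rhs: "n1 + n2 = 0 \<or> (\<exists>x \<in> T. \<exists>y \<in> T. x ! 0 < n1 \<and> n1 \<le> y ! 0 \<and> W x y)"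
    show "digraph_iso (with_proj G) (with_proj H)"
    proof (cases "n1 + n2 = 0")
      case True
      then show ?thesis unfolding iso by (simp add: bij_betw_def)
    next
      case False
      then obtain x y where xy: "x \<in> r.tuples" "y \<in> r.tuples" "x ! 0 < n1" "n1 \<le> y ! 0" "r.W r.stab x y"
        using rhs unfolding T W by blast
      define v v' where "v = x ! 0" and "v' = y ! 0"
      have len: "length x = K" "length y = K" using xy by (simp_all add: r.tuples_def)
      have vU: "v \<in> ?U" "v' \<in> ?U"
      proof -
        have "v \<in> set x" "v' \<in> set y" using K len by (simp_all add: v_def v'_def)
        then show "v \<in> ?U" "v' \<in> ?U" using xy(1,2) by (auto simp: r.tuples_def)
      qed
      \<comment> \<open>Only the first entries matter. Repeating them turns the given tuples into
        padded one-element tuples.\<close>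
      have "r.W r.stab (map ((!) x) (replicate K 0)) (map ((!) y) (replicate K 0))"
        using K by (intro r.W_reindex[OF xy(5,1,2)]) auto
      moreover have "map ((!) x) (replicate K 0) = r.pad [v]" "map ((!) y) (replicate K 0) = r.pad [v']"
        using K by (simp_all add: r.pad_def v_def v'_def map_replicate_const replicate_Suc[symmetric] del: replicate_Suc)
      ultimately have R: "r.R [v] [v']" using vU K by (simp add: r.R_def)
      have sv: "{w \<in> ?U. ?S v w} = {..<n1}" "{w \<in> ?U. ?S v' w} = {n1..<n1 + n2}"
        using xy(3,4) by (auto simp: side_def v_def v'_def)
      obtain e where e: "k_expr 3 e" "forget_labels e = G"
        using clique_width_le_iff[OF input_graphD(1)[OF G(1)]] G(2) by blast
      have eV: "fst ` labeled_verts e = {..<n1}" and eA: "expr_arcs e = parcs G"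
        using arg_cong[OF e(2), of pverts] arg_cong[OF e(2), of parcs] V(1) by (simp_all only: forget_labels_def pair_pre_digraph.simps)
      have lt: "u < n1" if "(u, i) \<in> labeled_verts e" for u i
        using that eV by force
      have "r.decomposable (fst ` labeled_verts e)"
      proof (rule r.decomposable_expr[where L = "expr_labels e" and J = "{}"])
        show "wf_expr e" "card (expr_labels e) \<le> 3" using e(1) by (simp_all add: k_expr_def)
        show "finite (expr_labels e)" by (rule finite_expr_labels)
        show "fst ` labeled_verts e \<noteq> {}" using eV xy(3) by auto
        show "?E u z \<longleftrightarrow> ?E u' z" if "(u, i) \<in> labeled_verts e" "(u', i) \<in> labeled_verts e"
          "z \<in> ?U - fst ` labeled_verts e" for u u' i z
          using that(3) lt[OF that(1)] lt[OF that(2)] unfolding eV by (auto simp: union_edge_def)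
        show "?E u w \<longleftrightarrow> (u, w) \<in> expr_arcs e \<or> (i, j) \<in> {}"
          if "(u, i) \<in> labeled_verts e" "(w, j) \<in> labeled_verts e" for u w i j
          using lt[OF that(1)] lt[OF that(2)] eA by (auto simp: union_edge_def)
      qed simp
      then have "\<exists>\<theta>. bij_betw \<theta> {w \<in> ?U. ?S v w} {w \<in> ?U. ?S v' w} \<and>
        (\<forall>x \<in> {w \<in> ?U. ?S v w}. \<forall>y \<in> {w \<in> ?U. ?S v w}. ?E x y \<longleftrightarrow> ?E (\<theta> x) (\<theta> y))"
        unfolding eV by (rule r.wl_isomorphic[OF _ sv(1)[symmetric] R K])
      then obtain \<theta> where \<theta>: "bij_betw \<theta> {..<n1} {n1..<n1 + n2}"
        "\<forall>x \<in> {..<n1}. \<forall>y \<in> {..<n1}. ?E x y \<longleftrightarrow> ?E (\<theta> x) (\<theta> y)" unfolding sv by (elim exE conjE)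
      define f where "f u = \<theta> u - n1" for u
      have "bij_betw (\<lambda>u. u - n1) {n1..<n1 + n2} {..<n2}"
        by (rule bij_betwI[where g = "\<lambda>u. u + n1"]) auto
      from bij_betw_trans[OF \<theta>(1) this] have f: "bij_betw f {..<n1} {..<n2}"
        by (simp add: f_def[abs_def] comp_def)
      have "(u, w) \<in> parcs G \<longleftrightarrow> (f u, f w) \<in> parcs H" if uw: "u < n1" "w < n1" for u w
      proof -
        have "n1 \<le> \<theta> u" "n1 \<le> \<theta> w" using bij_betwE[OF \<theta>(1)] uw by auto
        then show ?thesis using \<theta>(2)[rule_format, of u w] uw by (simp add: union_edge_def f_def)
      qed
      then show ?thesis unfolding iso using f by blast
    qed
  qed
qed

section \<open>Compiling bounded sums\<close>

text \<open>\<open>Sm i b a\<close> sums \<open>a\<close> over all values of register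
  \<open>i\<close> below the content of register \<open>b\<close>. Sums serve three purposes:
  multiplication (constant summands), counting (summands 0 and 1) and quantification (test for
  0).\<close>

datatype tm = Var nat | Cst nat | Pls tm tm | Mns tm tm | Mem tm | Sm nat nat tm

primrec ev :: "tm \<Rightarrow> (nat \<Rightarrow> nat) \<Rightarrow> (nat \<Rightarrow> nat) \<Rightarrow> nat" where
  "ev (Var x) r m = r x"
| "ev (Cst n) r m = n"
| "ev (Pls a b) r m = ev a r m + ev b r m"
| "ev (Mns a b) r m = ev a r m - ev b r m"
| "ev (Mem a) r m = m (ev a r m)"
| "ev (Sm i b a) r m = (\<Sum>v < r b. ev a (r(i := v)) m)"

primrec fv :: "tm \<Rightarrow> nat set" where
  "fv (Var x) = {x}"
| "fv (Cst n) = {}"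
| "fv (Pls a b) = fv a \<union> fv b"
| "fv (Mns a b) = fv a \<union> fv b"
| "fv (Mem a) = fv a"
| "fv (Sm i b a) = insert b (fv a - {i})"

text \<open>\<open>B\<close> contains the registers that bound sums. None of them is a summation
  variable, so one bound on their initial values bounds all sums throughout and makes the running
  time polynomial.\<close>

primrec wf_tm :: "nat \<Rightarrow> nat set \<Rightarrow> tm \<Rightarrow> bool" where
  "wf_tm D B (Var x) \<longleftrightarrow> x < D"
| "wf_tm D B (Cst n) \<longleftrightarrow> True"
| "wf_tm D B (Pls a b) \<longleftrightarrow> wf_tm D B a \<and> wf_tm D B b"
| "wf_tm D B (Mns a b) \<longleftrightarrow> wf_tm D B a \<and> wf_tm D B b"
| "wf_tm D B (Mem a) \<longleftrightarrow> wf_tm D B a"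
| "wf_tm D B (Sm i b a) \<longleftrightarrow> i < D \<and> b \<in> B \<and> i \<notin> B \<and> wf_tm D B a"

lemma ev_cong: "(\<And>x. x \<in> fv a \<Longrightarrow> r x = r' x) \<Longrightarrow> ev a r m = ev a r' m"
proof (induction a arbitrary: r r')
  case (Sm i b a)
  have "ev a (r(i := v)) m = ev a (r'(i := v)) m" for v
    using Sm.prems by (intro Sm.IH) auto
  moreover have "r b = r' b" using Sm.prems by simp
  ultimately show ?case by simp
next
  case (Pls a b)
  have "ev a r m = ev a r' m" "ev b r m = ev b r' m" using Pls.prems by (auto intro: Pls.IH)
  then show ?case by simp
next
  case (Mns a b)
  have "ev a r m = ev a r' m" "ev b r m = ev b r' m" using Mns.prems by (auto intro: Mns.IH)
  then show ?case by simp
next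
  case (Mem a)
  have "ev a r m = ev a r' m" using Mem.prems by (auto intro: Mem.IH)
  then show ?case by simp
qed simp_all

lemma fv_wf: "wf_tm D B a \<Longrightarrow> B \<subseteq> {..<D} \<Longrightarrow> fv a \<subseteq> {..<D}"
  by (induction a) auto

fun seq :: "prog list \<Rightarrow> prog" where
  "seq [] = Skip"
| "seq [c] = c"
| "seq (c # d # cs) = Seq c (seq (d # cs))"

text \<open>The value is left in register \<open>d\<close>; the registers above \<open>d\<close> are scratch.\<close>

primrec compile :: "tm \<Rightarrow> nat \<Rightarrow> prog" where
  "compile (Var x) d = seq [Const (d + 1) 0, Add d x (d + 1)]"
| "compile (Cst n) d = Const d n"
| "compile (Pls a b) d = seq [compile a d, compile b (d + 1), Add d d (d + 1)]"
| "compile (Mns a b) d = seq [compile a d, compile b (d + 1), Sub d d (d + 1)]"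
| "compile (Mem a) d = seq [compile a d, Load d d]"
| "compile (Sm i b a) d = seq [Const d 0, Const (d + 1) 0, Add (d + 1) i (d + 1), Const i 0, Sub (d + 2) b i,
     While (d + 2) (seq [compile a (d + 3), Add d d (d + 3), Const (d + 3) 1, Add i i (d + 3), Sub (d + 2) b i]),
     Add i (d + 1) (d + 2)]"

primrec tm_time :: "tm \<Rightarrow> nat poly" where
  "tm_time (Var x) = [:2:]"
| "tm_time (Cst n) = [:1:]"
| "tm_time (Pls a b) = tm_time a + tm_time b + [:1:]"
| "tm_time (Mns a b) = tm_time a + tm_time b + [:1:]"
| "tm_time (Mem a) = tm_time a + [:1:]"
| "tm_time (Sm i b a) = [:7:] + [:0, 1:] * (tm_time a + [:5:])"

section \<open>Hoare triples with time bounds\<close>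

type_synonym assertion = "(nat \<Rightarrow> nat) \<Rightarrow> (nat \<Rightarrow> nat) \<Rightarrow> bool"

definition hoare :: "assertion \<Rightarrow> prog \<Rightarrow> assertion \<Rightarrow> nat \<Rightarrow> bool" where
  "hoare P c Q T \<longleftrightarrow> (\<forall>r m. P r m \<longrightarrow> (\<exists>t r' m'. exec c (r, m) t (r', m') \<and> t \<le> T \<and> Q r' m'))"

lemma hoareI: "(\<And>r m. P r m \<Longrightarrow> \<exists>t r' m'. exec c (r, m) t (r', m') \<and> t \<le> T \<and> Q r' m') \<Longrightarrow> hoare P c Q T"
  by (simp add: hoare_def)

lemma exec_witness:
  "exec c s t (r', m') \<Longrightarrow> t \<le> T \<Longrightarrow> Q r' m' \<Longrightarrow> \<exists>t r' m'. exec c s t (r', m') \<and> t \<le> T \<and> Q r' m'"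
  by (rule exI[of _ t], rule exI[of _ r'], rule exI[of _ m']) simp

lemma hoareD:
  assumes "hoare P c Q T" "P r m"
  shows "\<exists>t r' m'. exec c (r, m) t (r', m') \<and> t \<le> T \<and> Q r' m'"
  using assms unfolding hoare_def by simp

lemma hoare_conseq:
  assumes "hoare P c Q T" "\<And>r m. P' r m \<Longrightarrow> P r m" "\<And>r m. Q r m \<Longrightarrow> Q' r m" "T \<le> T'"
  shows "hoare P' c Q' T'"
  using assms unfolding hoare_def by (meson order_trans)

lemma hoare_Seq:
  assumes "hoare P c Q T" "hoare Q d X T'"
  shows "hoare P (Seq c d) X (T + T')"
proof (rule hoareI)
  fix r m assume "P r m"
  from hoareD[OF assms(1), OF this]
  obtain t r1 m1 where 1: "exec c (r, m) t (r1, m1)" "t \<le> T" "Q r1 m1" by (elim exE conjE)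
  from hoareD[OF assms(2), OF 1(3)]
  obtain t' r2 m2 where 2: "exec d (r1, m1) t' (r2, m2)" "t' \<le> T'" "X r2 m2" by (elim exE conjE)
  show "\<exists>t r' m'. exec (Seq c d) (r, m) t (r', m') \<and> t \<le> T + T' \<and> X r' m'"
    by (rule exec_witness[where Q = X, OF exec.Seq[OF 1(1) 2(1)], OF add_mono[OF 1(2) 2(2)], OF 2(3)])
qed

lemma hoare_Const: "hoare (\<lambda>r m. Q (r(x := n)) m) (Const x n) Q 1"
  by (rule hoareI, rule exec_witness[where Q = Q, OF exec.Const]) simp_all

lemma hoare_Add: "hoare (\<lambda>r m. Q (r(x := r y + r z)) m) (Add x y z) Q 1"
  by (rule hoareI, rule exec_witness[where Q = Q, OF exec.Add]) simp_all

lemma hoare_Sub: "hoare (\<lambda>r m. Q (r(x := r y - r z)) m) (Sub x y z) Q 1"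
  by (rule hoareI, rule exec_witness[where Q = Q, OF exec.Sub]) simp_all

lemma hoare_Load: "hoare (\<lambda>r m. Q (r(x := m (r y))) m) (Load x y) Q 1"
  by (rule hoareI, rule exec_witness[where Q = Q, OF exec.Load]) simp_all

lemma hoare_Store: "hoare (\<lambda>r m. Q r (m(r x := r y))) (Store x y) Q 1"
  by (rule hoareI, rule exec_witness[where Q = Q, OF exec.Store]) simp_all

lemma hoare_time: "hoare P c Q T \<Longrightarrow> T \<le> T' \<Longrightarrow> hoare P c Q T'"
  by (rule hoare_conseq)

lemma hoare_pre: "hoare P c Q T \<Longrightarrow> (\<And>r m. P' r m \<Longrightarrow> P r m) \<Longrightarrow> T \<le> T' \<Longrightarrow> hoare P' c Q T'"
  by (rule hoare_conseq)

lemmas hoare_AddI = hoare_pre[OF hoare_Add _ order.refl]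
  and hoare_SubI = hoare_pre[OF hoare_Sub _ order.refl]
  and hoare_LoadI = hoare_pre[OF hoare_Load _ order.refl]
  and hoare_StoreI = hoare_pre[OF hoare_Store _ order.refl]

text \<open>Counting \<open>i\<close> up to \<open>n\<close>, with the difference kept in the test register \<open>x\<close>.\<close>

lemma hoare_While:
  assumes "\<And>v. v < n \<Longrightarrow> hoare (I v) c (I (Suc v)) T"
    and "\<And>v r m. I v r m \<Longrightarrow> r x = n - v"
  shows "hoare (I 0) (While x c) (I n) (1 + n * (T + 1))"
proof -
  have "hoare (I (n - k)) (While x c) (I n) (1 + k * (T + 1))" if "k \<le> n" for k
    using that
  proof (induction k)
    case 0
    show ?case
    proof (rule hoareI)
      fix r m assume "I (n - 0) r m"
      then show "\<exists>t r' m'. exec (While x c) (r, m) t (r', m') \<and> t \<le> 1 + 0 * (T + 1) \<and> I n r' m'"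
        using assms(2)[of n r m] by (intro exec_witness[where Q = "I n", OF exec.WhileFalse]) simp_all
    qed
  next
    case (Suc k)
    show ?case
    proof (rule hoareI)
      fix r m assume I: "I (n - Suc k) r m"
      have "n - Suc k < n" "Suc (n - Suc k) = n - k" using Suc.prems by simp_all
      then have "hoare (I (n - Suc k)) c (I (n - k)) T" using assms(1)[of "n - Suc k"] by simp
      from hoareD[OF this, OF I]
      obtain t r1 m1 where 1: "exec c (r, m) t (r1, m1)" "t \<le> T" "I (n - k) r1 m1" by (elim exE conjE)
      have "hoare (I (n - k)) (While x c) (I n) (1 + k * (T + 1))" using Suc by simp
      from hoareD[OF this, OF 1(3)]
      obtain t' r2 m2 where 2: "exec (While x c) (r1, m1) t' (r2, m2)" "t' \<le> 1 + k * (T + 1)" "I n r2 m2"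
        by (elim exE conjE)
      have "fst (r, m) x \<noteq> 0" using assms(2)[OF I] Suc.prems by simp
      from exec.WhileTrue[OF this 1(1) 2(1)]
      have "exec (While x c) (r, m) (1 + t + t') (r2, m2)" .
      moreover have "1 + t + t' \<le> 1 + Suc k * (T + 1)" using 1(2) 2(2) by simp
      ultimately show "\<exists>t r' m'. exec (While x c) (r, m) t (r', m') \<and> t \<le> 1 + Suc k * (T + 1) \<and> I n r' m'"
        by (rule exec_witness[where Q = "I n", OF _ _ 2(3)])
    qed
  qed
  from this[of n] show ?thesis by simp
qed

abbreviation agrees :: "nat \<Rightarrow> (nat \<Rightarrow> nat) \<Rightarrow> (nat \<Rightarrow> nat) \<Rightarrow> assertion" where
  "agrees d r0 m0 \<equiv> \<lambda>r m. m = m0 \<and> (\<forall>x < d. r x = r0 x)"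

abbreviation holds :: "nat \<Rightarrow> nat \<Rightarrow> nat \<Rightarrow> (nat \<Rightarrow> nat) \<Rightarrow> (nat \<Rightarrow> nat) \<Rightarrow> assertion" where
  "holds x v d r0 m0 \<equiv> \<lambda>r m. m = m0 \<and> r x = v \<and> (\<forall>x < d. r x = r0 x)"

text \<open>All registers of a term lie below \<open>D\<close>, hence below the scratch registers
  from \<open>d\<close> on. So intermediate results do not disturb the evaluation of later
  subterms.\<close>

lemma hoare_compile:
  assumes "wf_tm D B a" "B \<subseteq> {..<D}" "D \<le> d" "\<And>b. b \<in> B \<Longrightarrow> r0 b \<le> N"
  shows "hoare (agrees d r0 m0) (compile a d)
    (holds d (ev a r0 m0) d r0 m0) (poly (tm_time a) N)"
  using assms(1,3,4)
proof (induction a arbitrary: d r0)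
  case (Var x)
  show ?case
    unfolding compile.simps seq.simps
    by (rule hoare_pre[OF hoare_Seq[OF hoare_Const hoare_Add]]) (use Var in auto)
next
  case (Cst n)
  show ?case unfolding compile.simps by (rule hoare_pre[OF hoare_Const]) auto
next
  case (Pls a b)
  have 1: "hoare (agrees d r0 m0) (compile a d)
    (holds d (ev a r0 m0) d r0 m0) (poly (tm_time a) N)"
    using Pls by simp
  define r1 where "r1 = r0(d := ev a r0 m0)"
  have "d \<notin> fv b" "d \<notin> B" using fv_wf[of D B b] Pls.prems assms(2) by auto
  then have "ev b r1 m0 = ev b r0 m0" by (intro ev_cong) (auto simp: r1_def)
  moreover have "hoare (agrees (d + 1) r1 m0) (compile b (d + 1))
    (holds (d + 1) (ev b r1 m0) (d + 1) r1 m0) (poly (tm_time b) N)"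
    using Pls \<open>d \<notin> B\<close> by (intro Pls.IH) (auto simp: r1_def)
  ultimately have 2: "hoare (agrees (d + 1) r1 m0) (compile b (d + 1))
    (holds (d + 1) (ev b r0 m0) (d + 1) r1 m0) (poly (tm_time b) N)" by simp
  have 12: "hoare (agrees d r0 m0) (compile a d)
    (agrees (d + 1) r1 m0) (poly (tm_time a) N)"
    by (rule hoare_conseq[OF 1]) (auto simp: r1_def less_Suc_eq)
  show ?case
    unfolding compile.simps seq.simps
    by (rule hoare_time[OF hoare_Seq[OF 12 hoare_Seq[OF 2 hoare_AddI]]]) (auto simp: r1_def)
next
  case (Mns a b)
  have 1: "hoare (agrees d r0 m0) (compile a d)
    (holds d (ev a r0 m0) d r0 m0) (poly (tm_time a) N)"
    using Mns by simp
  define r1 where "r1 = r0(d := ev a r0 m0)"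
  have "d \<notin> fv b" "d \<notin> B" using fv_wf[of D B b] Mns.prems assms(2) by auto
  then have "ev b r1 m0 = ev b r0 m0" by (intro ev_cong) (auto simp: r1_def)
  moreover have "hoare (agrees (d + 1) r1 m0) (compile b (d + 1))
    (holds (d + 1) (ev b r1 m0) (d + 1) r1 m0) (poly (tm_time b) N)"
    using Mns \<open>d \<notin> B\<close> by (intro Mns.IH) (auto simp: r1_def)
  ultimately have 2: "hoare (agrees (d + 1) r1 m0) (compile b (d + 1))
    (holds (d + 1) (ev b r0 m0) (d + 1) r1 m0) (poly (tm_time b) N)" by simp
  have 12: "hoare (agrees d r0 m0) (compile a d)
    (agrees (d + 1) r1 m0) (poly (tm_time a) N)"
    by (rule hoare_conseq[OF 1]) (auto simp: r1_def less_Suc_eq)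
  show ?case
    unfolding compile.simps seq.simps
    by (rule hoare_time[OF hoare_Seq[OF 12 hoare_Seq[OF 2 hoare_SubI]]]) (auto simp: r1_def)
next
  case (Mem a)
  have "hoare (agrees d r0 m0) (compile a d)
    (holds d (ev a r0 m0) d r0 m0) (poly (tm_time a) N)"
    using Mem by simp
  from hoare_time[OF hoare_Seq[OF this hoare_LoadI]]
  show ?case unfolding compile.simps seq.simps by this auto
next
  case (Sm i b a)
  have i: "i < d" "i \<notin> B" "b \<in> B" "b < d" "b \<noteq> i" and wf: "wf_tm D B a" using Sm.prems assms(2) by auto
  define n where "n = r0 b"
  have n: "n \<le> N" using Sm.prems i by (simp add: n_def)
  \<comment> \<open>Register \<open>d + 1\<close> saves the old value of \<open>i\<close>. The test
    register \<open>d + 2\<close> is 0 at the end, so the final addition restores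
    \<open>i\<close>.\<close>
  define I where "I v r m \<longleftrightarrow> m = m0 \<and> r d = (\<Sum>w < v. ev a (r0(i := w)) m0) \<and> r (d + 1) = r0 i \<and>
    r i = v \<and> r (d + 2) = n - v \<and> (\<forall>x < d. x \<noteq> i \<longrightarrow> r x = r0 x)" for v r and m :: "nat \<Rightarrow> nat"
  define body where "body = seq [compile a (d + 3), Add d d (d + 3), Const (d + 3) 1, Add i i (d + 3), Sub (d + 2) b i]"
  have body: "hoare (I v) body (I (Suc v)) (poly (tm_time a) N + 4)" if v: "v < n" for v
  proof (rule hoareI)
    fix r m assume I: "I v r m"
    have "r b \<le> N" if "b \<in> B" for b
    proof -
      have "b \<noteq> i" "b < d" using i that assms(2) Sm.prems by auto
      then have "r b = r0 b" using I by (simp add: I_def)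
      then show ?thesis using Sm.prems that by simp
    qed
    then have "hoare (agrees (d + 3) r m0) (compile a (d + 3))
      (holds (d + 3) (ev a r m0) (d + 3) r m0) (poly (tm_time a) N)"
      using wf Sm.prems by (intro Sm.IH) auto
    note H = this
    have "m = m0 \<and> (\<forall>x < d + 3. r x = r x)" using I by (simp add: I_def)
    from hoareD[OF H, OF this]
    obtain t r1 m1 where "exec (compile a (d + 3)) (r, m) t (r1, m1)" "t \<le> poly (tm_time a) N"
      "m1 = m0" "r1 (d + 3) = ev a r m0" "\<forall>x < d + 3. r1 x = r x" by (elim exE conjE)
    then have r1: "exec (compile a (d + 3)) (r, m) t (r1, m0)" "t \<le> poly (tm_time a) N"
      "r1 (d + 3) = ev a r m0" "\<And>x. x < d + 3 \<Longrightarrow> r1 x = r x" by simp_all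
    have "ev a r m0 = ev a (r0(i := v)) m0"
    proof (rule ev_cong)
      fix x assume "x \<in> fv a"
      then have "x < d" using fv_wf[OF wf assms(2)] Sm.prems by auto
      then show "r x = (r0(i := v)) x" using I by (simp add: I_def)
    qed
    then have "hoare (\<lambda>r m. r = r1 \<and> m = m0) (Seq (Add d d (d + 3)) (Seq (Const (d + 3) 1) (Seq (Add i i (d + 3)) (Sub (d + 2) b i))))
      (I (Suc v)) (1 + (1 + (1 + 1)))"
      by (intro hoare_pre[OF hoare_Seq[OF hoare_Add hoare_Seq[OF hoare_Const hoare_Seq[OF hoare_Add hoare_Sub]]]])
        (use I i r1 in \<open>auto simp: I_def n_def\<close>)
    note H = this
    have "r1 = r1 \<and> m0 = m0" by simp
    from hoareD[OF H, OF this]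
    obtain t' r2 m2 where 2: "exec (Seq (Add d d (d + 3)) (Seq (Const (d + 3) 1) (Seq (Add i i (d + 3)) (Sub (d + 2) b i)))) (r1, m0) t' (r2, m2)"
      "t' \<le> 1 + (1 + (1 + 1))" "I (Suc v) r2 m2" by (elim exE conjE)
    show "\<exists>t r' m'. exec body (r, m) t (r', m') \<and> t \<le> poly (tm_time a) N + 4 \<and> I (Suc v) r' m'"
      unfolding body_def seq.simps
      by (rule exec_witness[where Q = "I (Suc v)", OF exec.Seq[OF r1(1) 2(1)], OF _ 2(3)]) (use r1(2) 2(2) in simp)
  qed
  have w: "hoare (I 0) (While (d + 2) body) (I n) (1 + n * (poly (tm_time a) N + 4 + 1))"
    by (rule hoare_While[where I = I and n = n, OF body]) (auto simp: I_def)
  have "hoare (agrees d r0 m0)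
    (Seq (Const d 0) (Seq (Const (d + 1) 0) (Seq (Add (d + 1) i (d + 1)) (Seq (Const i 0) (Seq (Sub (d + 2) b i)
      (Seq (While (d + 2) body) (Add i (d + 1) (d + 2))))))))
    (holds d (ev (Sm i b a) r0 m0) d r0 m0)
    (1 + (1 + (1 + (1 + (1 + ((1 + n * (poly (tm_time a) N + 4 + 1)) + 1))))))"
    by (rule hoare_pre[OF hoare_Seq[OF hoare_Const hoare_Seq[OF hoare_Const hoare_Seq[OF hoare_Add
       hoare_Seq[OF hoare_Const hoare_Seq[OF hoare_Sub hoare_Seq[OF w hoare_AddI]]]]]]])
      (use i in \<open>auto simp: I_def n_def\<close>)
  then show ?case
    unfolding compile.simps seq.simps body_def
    by (rule hoare_time) (use mult_le_mono1[OF n, of "poly (tm_time a) N + 5"] in \<open>simp add: add.commute\<close>)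
qed

section \<open>Assignments, stores and nested loops\<close>

definition assign :: "nat \<Rightarrow> nat \<Rightarrow> tm \<Rightarrow> prog" where
  "assign D x a = seq [compile a D, Const (D + 1) 0, Add x D (D + 1)]"

definition store :: "nat \<Rightarrow> tm \<Rightarrow> tm \<Rightarrow> prog" where
  "store D a b = seq [compile a D, compile b (D + 1), Store D (D + 1)]"

definition count_loop :: "nat \<Rightarrow> nat \<Rightarrow> nat \<Rightarrow> prog \<Rightarrow> prog" where
  "count_loop D i b c = seq [Const i 0, Sub D b i, While D (seq [c, Const D 1, Add i i D, Sub D b i])]"

definition loops :: "nat \<Rightarrow> nat \<Rightarrow> nat list \<Rightarrow> prog \<Rightarrow> prog" where
  "loops D b vs c = foldr (\<lambda>i. count_loop D i b) vs c"

text \<open>Fixes the initial state, so that intermediate assertions can refer to it.\<close>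

lemma hoare_fixed:
  assumes "\<And>r0 m0. P r0 m0 \<Longrightarrow> hoare (\<lambda>r m. r = r0 \<and> m = m0) c Q T"
  shows "hoare P c Q T"
proof (rule hoareI)
  fix r m assume "P r m"
  have "r = r \<and> m = m" by simp
  from hoareD[OF assms[OF \<open>P r m\<close>], OF this]
  show "\<exists>t r' m'. exec c (r, m) t (r', m') \<and> t \<le> T \<and> Q r' m'" .
qed

lemma hoare_assign:
  assumes "wf_tm D B a" "B \<subseteq> {..<D}" "x < D" "\<And>r m b. P r m \<Longrightarrow> b \<in> B \<Longrightarrow> r b \<le> N"
    and "\<And>r r' m. P r m \<Longrightarrow> (\<And>y. y < D \<Longrightarrow> r' y = (r(x := ev a r m)) y) \<Longrightarrow> Q r' m"
  shows "hoare P (assign D x a) Q (poly (tm_time a) N + 2)"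
proof (rule hoare_fixed)
  fix r0 m0 assume P: "P r0 m0"
  have "hoare (agrees D r0 m0) (compile a D)
    (holds D (ev a r0 m0) D r0 m0) (poly (tm_time a) N)"
    using assms(4)[OF P] by (intro hoare_compile[OF assms(1,2) order.refl])
  then have 1: "hoare (\<lambda>r m. r = r0 \<and> m = m0) (compile a D)
    (holds D (ev a r0 m0) D r0 m0) (poly (tm_time a) N)"
    by (rule hoare_pre) auto
  have 2: "hoare (holds D (ev a r0 m0) D r0 m0) (Seq (Const (D + 1) 0) (Add x D (D + 1))) Q (1 + 1)"
  proof (rule hoare_pre[OF hoare_Seq[OF hoare_Const hoare_Add]])
    fix r m assume "m = m0 \<and> r D = ev a r0 m0 \<and> (\<forall>x < D. r x = r0 x)"
    then show "Q ((r(D + 1 := 0))(x := (r(D + 1 := 0)) D + (r(D + 1 := 0)) (D + 1))) m"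
      using assms(3) by (intro assms(5)[of r0]) (auto simp: P)
  qed simp
  show "hoare (\<lambda>r m. r = r0 \<and> m = m0) (assign D x a) Q (poly (tm_time a) N + 2)"
    unfolding assign_def seq.simps by (rule hoare_time[OF hoare_Seq[OF 1 2]]) simp
qed

lemma hoare_store:
  assumes "wf_tm D B a" "wf_tm D B a'" "B \<subseteq> {..<D}" "\<And>r m b. P r m \<Longrightarrow> b \<in> B \<Longrightarrow> r b \<le> N"
    and "\<And>r r' m. P r m \<Longrightarrow> (\<And>y. y < D \<Longrightarrow> r' y = r y) \<Longrightarrow> Q r' (m(ev a r m := ev a' r m))"
  shows "hoare P (store D a a') Q (poly (tm_time a) N + poly (tm_time a') N + 1)"
proof (rule hoare_fixed)
  fix r0 m0 assume P: "P r0 m0"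
  have "hoare (agrees D r0 m0) (compile a D)
    (holds D (ev a r0 m0) D r0 m0) (poly (tm_time a) N)"
    using assms(4)[OF P] by (intro hoare_compile[OF assms(1,3) order.refl])
  note c = this
  define r1 where "r1 = r0(D := ev a r0 m0)"
  have 1: "hoare (\<lambda>r m. r = r0 \<and> m = m0) (compile a D)
    (agrees (D + 1) r1 m0) (poly (tm_time a) N)"
    by (rule hoare_conseq[OF c]) (auto simp: r1_def less_Suc_eq)
  have "D \<notin> fv a'" "D \<notin> B" using fv_wf[OF assms(2,3)] assms(3) by auto
  then have "ev a' r1 m0 = ev a' r0 m0" by (intro ev_cong) (auto simp: r1_def)
  moreover have "hoare (agrees (D + 1) r1 m0) (compile a' (D + 1))
    (\<lambda>r m. m = m0 \<and> r (D + 1) = ev a' r1 m0 \<and> (\<forall>x < D + 1. r x = r1 x)) (poly (tm_time a') N)"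
    using assms(4)[OF P] \<open>D \<notin> B\<close> by (intro hoare_compile[OF assms(2,3)]) (auto simp: r1_def)
  ultimately have 2: "hoare (agrees (D + 1) r1 m0) (compile a' (D + 1))
    (\<lambda>r m. m = m0 \<and> r (D + 1) = ev a' r0 m0 \<and> (\<forall>x < D + 1. r x = r1 x)) (poly (tm_time a') N)" by simp
  have 3: "hoare (\<lambda>r m. m = m0 \<and> r (D + 1) = ev a' r0 m0 \<and> (\<forall>x < D + 1. r x = r1 x)) (Store D (D + 1)) Q 1"
  proof (rule hoare_StoreI)
    fix r m assume "m = m0 \<and> r (D + 1) = ev a' r0 m0 \<and> (\<forall>x < D + 1. r x = r1 x)"
    then have *: "m = m0" "r (D + 1) = ev a' r0 m0" "r D = ev a r0 m0" "\<And>y. y < D \<Longrightarrow> r y = r0 y"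
      by (simp_all add: r1_def)
    show "Q r (m(r D := r (D + 1)))" unfolding *(1-3) by (rule assms(5)[OF P *(4)])
  qed
  show "hoare (\<lambda>r m. r = r0 \<and> m = m0) (store D a a') Q (poly (tm_time a) N + poly (tm_time a') N + 1)"
    unfolding store_def seq.simps by (rule hoare_time[OF hoare_Seq[OF 1 hoare_Seq[OF 2 3]]]) simp
qed

text \<open>By \<open>ins\<close> the invariant does not depend on \<open>i\<close> or on registers
  from \<open>D\<close> on. So it survives the bookkeeping, which uses register \<open>D\<close>
  both for the loop test and for the constant 1.\<close>

lemma hoare_count_loop:
  assumes body: "\<And>v. v < n \<Longrightarrow> hoare (\<lambda>r m. I v r m \<and> r i = v) c (\<lambda>r m. I (Suc v) r m \<and> r i = v) T"
    and ins: "\<And>v r r' m. I v r m \<Longrightarrow> (\<And>x. x < D \<Longrightarrow> x \<noteq> i \<Longrightarrow> r' x = r x) \<Longrightarrow> I v r' m"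
    and b: "\<And>v r m. I v r m \<Longrightarrow> r b = n" "b \<noteq> i" "b < D" "i < D" and n: "n \<le> N"
  shows "hoare (I 0) (count_loop D i b c) (I n) (3 + N * (T + 4))"
proof -
  define J where "J v r m \<longleftrightarrow> I v r m \<and> r i = v \<and> r D = n - v" for v r and m :: "nat \<Rightarrow> nat"
  have JI: "J w (r(D := 1, i := w, D := n - w)) m" if "I w r m" for r m w
    unfolding J_def using ins[OF that] b(2-4) by simp
  have "hoare (J v) (seq [c, Const D 1, Add i i D, Sub D b i]) (J (Suc v)) (T + 3)" if v: "v < n" for v
  proof -
    have 1: "hoare (J v) c (\<lambda>r m. I (Suc v) r m \<and> r i = v) T"
      by (rule hoare_pre[OF body[OF v]]) (auto simp: J_def)
    have 2: "hoare (\<lambda>r m. I (Suc v) r m \<and> r i = v) (Seq (Const D 1) (Seq (Add i i D) (Sub D b i))) (J (Suc v)) (1 + (1 + 1))"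
    proof (rule hoare_pre[OF hoare_Seq[OF hoare_Const hoare_Seq[OF hoare_Add hoare_Sub]]])
      fix r m assume I: "I (Suc v) r m \<and> r i = v"
      then have "r b = n" using b(1) by blast
      then show "J (Suc v) ((r(D := 1, i := (r(D := 1)) i + (r(D := 1)) D))
           (D := (r(D := 1, i := (r(D := 1)) i + (r(D := 1)) D)) b - (r(D := 1, i := (r(D := 1)) i + (r(D := 1)) D)) i)) m"
        using JI[of "Suc v" r m] I b(2-4) by simp
    qed simp
    show ?thesis unfolding seq.simps by (rule hoare_time[OF hoare_Seq[OF 1 2]]) simp
  qed
  then have w: "hoare (J 0) (While D (seq [c, Const D 1, Add i i D, Sub D b i])) (J n) (1 + n * (T + 3 + 1))"
    by (rule hoare_While) (auto simp: J_def)
  have w': "hoare (J 0) (While D (seq [c, Const D 1, Add i i D, Sub D b i])) (I n) (1 + n * (T + 3 + 1))"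
    by (rule hoare_conseq[OF w]) (auto simp: J_def)
  have "hoare (I 0) (Seq (Const i 0) (Seq (Sub D b i) (While D (seq [c, Const D 1, Add i i D, Sub D b i])))) (I n)
    (1 + (1 + (1 + n * (T + 3 + 1))))"
  proof (rule hoare_pre[OF hoare_Seq[OF hoare_Const hoare_Seq[OF hoare_Sub w']]])
    fix r m assume I: "I 0 r m"
    then have "r b = n" using b(1) by blast
    moreover have "I 0 (r(i := 0, D := n)) m" using I b(3,4) by (intro ins[OF I]) simp
    ultimately show "J 0 ((r(i := 0))(D := (r(i := 0)) b - (r(i := 0)) i)) m"
      using b(2-4) by (simp add: J_def)
  qed simp
  then show ?thesis
    unfolding count_loop_def seq.simps(3)[of "Const i 0"] seq.simps(3)[of "Sub D b i"] seq.simps(2)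
    by (rule hoare_time) (use mult_le_mono1[OF n, of "T + 4"] in \<open>simp add: add.commute\<close>)
qed

primrec loop_time :: "nat \<Rightarrow> nat poly \<Rightarrow> nat poly" where
  "loop_time 0 T = T"
| "loop_time (Suc k) T = [:3:] + [:0, 1:] * (loop_time k T + [:4:])"

definition lists_below :: "nat \<Rightarrow> nat \<Rightarrow> nat list set" where
  "lists_below n k = {xs. set xs \<subseteq> {..<n} \<and> length xs = k}"

lemma lists_below_0: "lists_below n 0 = {[]}"
  by (auto simp: lists_below_def)

lemma lists_below_Suc: "lists_below n (Suc k) = (\<Union>v < n. (#) v ` lists_below n k)"
  by (auto simp: lists_below_def length_Suc_conv image_iff)

text \<open>The invariant is indexed by the set of tuples visited so far, which hides the order of
  enumeration from applications. In the induction the outer counters \<open>us\<close> hold the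
  prefix \<open>pre\<close>, and the inner loops add all tuples that begin with it.\<close>

lemma hoare_loops_aux:
  fixes J :: "nat list set \<Rightarrow> assertion"
  assumes ins: "\<And>Z r r' m. J Z r m \<Longrightarrow> (\<And>x. x < D \<Longrightarrow> x \<notin> set vs \<Longrightarrow> r' x = r x) \<Longrightarrow> J Z r' m"
    and b: "\<And>Z r m. J Z r m \<Longrightarrow> r b = n" "b \<notin> set vs" "b < D" and n: "n \<le> N"
    and vs: "distinct vs" "set vs \<subseteq> {..<D}"
    and body: "\<And>Z xs. xs \<in> lists_below n (length vs) \<Longrightarrow> xs \<notin> Z \<Longrightarrow>
      hoare (\<lambda>r m. J Z r m \<and> map r vs = xs) c (\<lambda>r m. J (insert xs Z) r m \<and> map r vs = xs) (poly T N)"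
  shows "vs = us @ ws \<Longrightarrow> length us = length pre \<Longrightarrow> set pre \<subseteq> {..<n} \<Longrightarrow> Z \<inter> (@) pre ` lists_below n (length ws) = {} \<Longrightarrow>
    hoare (\<lambda>r m. J Z r m \<and> map r us = pre) (loops D b ws c)
      (\<lambda>r m. J (Z \<union> (@) pre ` lists_below n (length ws)) r m \<and> map r us = pre) (poly (loop_time (length ws) T) N)"
proof (induction ws arbitrary: us pre Z)
  case Nil
  then have "pre \<in> lists_below n (length vs)" by (simp add: lists_below_def)
  moreover have "pre \<notin> Z" using Nil(4) by (simp add: lists_below_0)
  ultimately have "pre \<in> lists_below n (length vs)" "pre \<notin> Z" .
  from body[OF this] show ?case using Nil by (simp add: loops_def lists_below_0)
next
  case (Cons i vs')
  let ?L = "\<lambda>v. (@) (pre @ [v]) ` lists_below n (length vs')"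
  define Y where "Y v = Z \<union> (\<Union>w < v. ?L w)" for v
  define I where "I v r m \<longleftrightarrow> J (Y v) r m \<and> map r us = pre" for v r m
  have i: "i \<notin> set us" "i < D" "b \<noteq> i" using Cons.prems(1) vs b by auto
  have "hoare (I 0) (count_loop D i b (loops D b vs' c)) (I n) (3 + N * (poly (loop_time (length vs') T) N + 4))"
  proof (rule hoare_count_loop[where I = I, OF _ _ _ i(3) b(3) i(2) n])
    fix v assume v: "v < n"
    have "Y v \<inter> ?L v = {}"
    proof -
      have "Z \<inter> ?L v = {}"
      proof -
        have "?L v \<subseteq> (@) pre ` lists_below n (length (i # vs'))"
          using v by (force simp: lists_below_Suc)
        then show ?thesis using Cons.prems(4) by blast
      qed
      moreover have "?L w \<inter> ?L v = {}" if "w < v" for w using that by auto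
      ultimately show ?thesis unfolding Y_def by blast
    qed
    then have "hoare (\<lambda>r m. J (Y v) r m \<and> map r (us @ [i]) = pre @ [v]) (loops D b vs' c)
      (\<lambda>r m. J (Y v \<union> ?L v) r m \<and> map r (us @ [i]) = pre @ [v]) (poly (loop_time (length vs') T) N)"
      using Cons.prems v by (intro Cons.IH) auto
    note H = this
    have "Y v \<union> ?L v = Y (Suc v)" by (simp add: Y_def lessThan_Suc Un_ac)
    note H' = H[unfolded this]
    show "hoare (\<lambda>r m. I v r m \<and> r i = v) (loops D b vs' c) (\<lambda>r m. I (Suc v) r m \<and> r i = v)
      (poly (loop_time (length vs') T) N)"
      by (rule hoare_conseq[OF H']) (simp_all add: I_def)
  next
    fix v r r' m assume I: "I v r m" and eq: "\<And>x. x < D \<Longrightarrow> x \<noteq> i \<Longrightarrow> r' x = r x"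
    have "map r' us = map r us" using eq i(1) vs Cons.prems(1) by (intro map_cong) auto
    moreover have "J (Y v) r' m"
    proof (rule ins)
      show "J (Y v) r m" using I by (simp add: I_def)
      show "r' x = r x" if "x < D" "x \<notin> set vs" for x using that eq Cons.prems(1) by auto
    qed
    ultimately show "I v r' m" using I unfolding I_def by metis
  next
    fix v r m assume "I v r m"
    then show "r b = n" using b(1) by (auto simp: I_def)
  qed
  moreover have "Y 0 = Z" by (simp add: Y_def)
  moreover have "Y n = Z \<union> (@) pre ` lists_below n (length (i # vs'))"
    by (auto simp: Y_def lists_below_Suc image_UN image_image)
  ultimately show ?case by (simp add: loops_def I_def[abs_def])
qed

lemma hoare_loops:
  fixes J :: "nat list set \<Rightarrow> assertion"
  assumes ins: "\<And>Z r r' m. J Z r m \<Longrightarrow> (\<And>x. x < D \<Longrightarrow> x \<notin> set vs \<Longrightarrow> r' x = r x) \<Longrightarrow> J Z r' m"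
    and b: "\<And>Z r m. J Z r m \<Longrightarrow> r b = n" "b \<notin> set vs" "b < D" and n: "n \<le> N"
    and vs: "distinct vs" "set vs \<subseteq> {..<D}"
    and body: "\<And>Z xs. xs \<in> lists_below n (length vs) \<Longrightarrow> xs \<notin> Z \<Longrightarrow>
      hoare (\<lambda>r m. J Z r m \<and> map r vs = xs) c (\<lambda>r m. J (insert xs Z) r m \<and> map r vs = xs) (poly T N)"
  shows "hoare (J {}) (loops D b vs c) (J (lists_below n (length vs))) (poly (loop_time (length vs) T) N)"
proof -
  have "hoare (\<lambda>r m. J {} r m \<and> map r [] = []) (loops D b vs c)
      (\<lambda>r m. J ({} \<union> (@) [] ` lists_below n (length vs)) r m \<and> map r [] = []) (poly (loop_time (length vs) T) N)"
  proof (rule hoare_loops_aux[where J = J and vs = vs and D = D and b = b and n = n and N = N and c = c and T = T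
        and us = "[]" and ws = vs and pre = "[]" and Z = "{}"])
    fix Z r r' m assume "J Z r m" "\<And>x. x < D \<Longrightarrow> x \<notin> set vs \<Longrightarrow> r' x = r x"
    then show "J Z r' m" by (rule ins)
  next
    fix Z r m assume "J Z r m"
    then show "r b = n" by (rule b(1))
  next
    fix Z xs assume "xs \<in> lists_below n (length vs)" "xs \<notin> Z"
    then show "hoare (\<lambda>r m. J Z r m \<and> map r vs = xs) c (\<lambda>r m. J (insert xs Z) r m \<and> map r vs = xs) (poly T N)"
      by (rule body)
  qed (use b(2,3) n vs in simp_all)
  then show ?thesis by simp
qed

abbreviation scan_step :: "nat \<Rightarrow> nat \<Rightarrow> prog" where
  "scan_step D x \<equiv> seq [Const (D + 1) 1, Add x x (D + 1), Load D x]"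

text \<open>Reads a number in unary: the address in \<open>x\<close> advances to the first 0, and
  register \<open>D\<close> holds the cell read last.\<close>

definition scan :: "nat \<Rightarrow> nat \<Rightarrow> prog" where
  "scan D x = Seq (Load D x) (While D (scan_step D x))"

lemma hoare_scan:
  assumes "x < D"
  shows "hoare (\<lambda>r m. m = m0 \<and> (\<forall>y < D. r y = r0 y) \<and> (\<forall>j < k. m0 (r0 x + j) = 1) \<and> m0 (r0 x + k) = 0) (scan D x)
    (\<lambda>r m. m = m0 \<and> (\<forall>y < D. r y = (r0(x := r0 x + k)) y)) (2 + k * 4)"
proof (rule hoare_fixed)
  fix r m assume "m = m0 \<and> (\<forall>y < D. r y = r0 y) \<and> (\<forall>j < k. m0 (r0 x + j) = 1) \<and> m0 (r0 x + k) = 0"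
  then have A: "m = m0" "\<And>y. y < D \<Longrightarrow> r y = r0 y" "\<And>j. j < k \<Longrightarrow> m0 (r0 x + j) = 1" "m0 (r0 x + k) = 0" by simp_all
  define I where "I v r m \<longleftrightarrow> m = m0 \<and> (\<forall>y < D. r y = (r0(x := r0 x + v)) y) \<and> r D = m0 (r0 x + v)" for v r m
  have main: "hoare (I (k - l)) (While D (scan_step D x)) (I k) (1 + l * 4)" if "l \<le> k" for l
    using that
  proof (induction l)
    case 0
    show ?case
    proof (rule hoareI)
      fix r m assume I: "I (k - 0) r m"
      then have "fst (r, m) D = 0" using A(4) by (simp add: I_def)
      from exec.WhileFalse[OF this]
      show "\<exists>t r' m'. exec (While D (scan_step D x)) (r, m) t (r', m') \<and> t \<le> 1 + 0 * 4 \<and> I k r' m'"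
        by (rule exec_witness[where Q = "I k"]) (use I in simp_all)
    qed
  next
    case (Suc l)
    have b: "hoare (I (k - Suc l)) (Seq (Const (D + 1) 1) (Seq (Add x x (D + 1)) (Load D x))) (I (k - l)) (1 + (1 + 1))"
    proof (rule hoare_pre[OF hoare_Seq[OF hoare_Const hoare_Seq[OF hoare_Add hoare_Load]]])
      fix r m assume "I (k - Suc l) r m"
      moreover have "k - l = Suc (k - Suc l)" using Suc.prems by simp
      ultimately show "I (k - l) (r(D + 1 := 1, x := (r(D + 1 := 1)) x + (r(D + 1 := 1)) (D + 1),
        D := m ((r(D + 1 := 1, x := (r(D + 1 := 1)) x + (r(D + 1 := 1)) (D + 1))) x))) m"
        using assms by (simp add: I_def)
    qed simp
    have IH: "hoare (I (k - l)) (While D (scan_step D x)) (I k) (1 + l * 4)" using Suc by simp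
    show ?case
    proof (rule hoareI)
      fix r m assume I: "I (k - Suc l) r m"
      from hoareD[OF hoare_Seq[OF b IH], OF I]
      obtain t r' m' where t: "exec (Seq (Seq (Const (D + 1) 1) (Seq (Add x x (D + 1)) (Load D x)))
          (While D (scan_step D x))) (r, m) t (r', m')"
        "t \<le> 1 + (1 + 1) + (1 + l * 4)" "I k r' m'" by (elim exE conjE)
      obtain t1 s t2 where s: "t = t1 + t2" "exec (Seq (Const (D + 1) 1) (Seq (Add x x (D + 1)) (Load D x))) (r, m) t1 s"
        "exec (While D (scan_step D x)) s t2 (r', m')"
        using t(1) by (rule exec_SeqE)
      have "k - Suc l < k" using Suc.prems by simp
      then have "fst (r, m) D \<noteq> 0" using I A(3) by (simp add: I_def)
      from exec.WhileTrue[OF this, of "scan_step D x" t1 s t2 "(r', m')"]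
      have "exec (While D (scan_step D x)) (r, m) (1 + t1 + t2) (r', m')"
        using s by simp
      then show "\<exists>t r' m'. exec (While D (scan_step D x)) (r, m) t (r', m') \<and> t \<le> 1 + Suc l * 4 \<and> I k r' m'"
        by (rule exec_witness[where Q = "I k"]) (use s(1) t(2,3) in simp_all)
    qed
  qed
  have w: "hoare (I 0) (While D (scan_step D x)) (I k) (1 + k * 4)"
    using main[of k] by simp
  have "hoare (\<lambda>r' m'. r' = r \<and> m' = m) (scan D x) (I k) (1 + (1 + k * 4))"
    unfolding scan_def
    by (rule hoare_pre[OF hoare_Seq[OF hoare_Load w]]) (use A assms in \<open>auto simp: I_def\<close>)
  then show "hoare (\<lambda>r' m'. r' = r \<and> m' = m) (scan D x) (\<lambda>r m. m = m0 \<and> (\<forall>y < D. r y = (r0(x := r0 x + k)) y)) (2 + k * 4)"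
    by (rule hoare_conseq) (auto simp: I_def)
qed

section \<open>Refinement as a program\<close>

text \<open>Truth values are 0 and 1. Truncated subtraction gives negation and comparison;
  \<open>and_tm\<close> is conjunction only for arguments that are at most 1.\<close>

abbreviation lt_tm :: "tm \<Rightarrow> tm \<Rightarrow> tm" where "lt_tm a b \<equiv> Mns (Cst 1) (Mns (Cst 1) (Mns b a))"
abbreviation not_tm :: "tm \<Rightarrow> tm" where "not_tm a \<equiv> Mns (Cst 1) a"
abbreviation and_tm :: "tm \<Rightarrow> tm \<Rightarrow> tm" where "and_tm a b \<equiv> Mns (Pls a b) (Cst 1)"
abbreviation diff_tm :: "tm \<Rightarrow> tm \<Rightarrow> tm" where "diff_tm a b \<equiv> Pls (Mns a b) (Mns b a)"
abbreviation eq_tm :: "tm \<Rightarrow> tm \<Rightarrow> tm" where "eq_tm a b \<equiv> not_tm (diff_tm a b)"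

definition ands :: "tm list \<Rightarrow> tm" where "ands ts = foldr and_tm ts (Cst 1)"

lemma ev_not: "ev (not_tm a) r m = of_bool (ev a r m = 0)" by simp
lemma ev_eq: "ev (eq_tm a b) r m = of_bool (ev a r m = ev b r m)" by auto
lemma ev_and: "ev a r m = of_bool P \<Longrightarrow> ev b r m = of_bool Q \<Longrightarrow> ev (and_tm a b) r m = of_bool (P \<and> Q)" by simp

lemma ev_ands:
  "(\<And>i. i \<in> set js \<Longrightarrow> ev (f i) r m = of_bool (P i)) \<Longrightarrow> ev (ands (map f js)) r m = of_bool (\<forall>i \<in> set js. P i)"
proof (induction js)
  case (Cons i js)
  then have "ev (ands (map f js)) r m = of_bool (\<forall>i \<in> set js. P i)" "ev (f i) r m = of_bool (P i)" by simp_all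
  from ev_and[OF this(2,1)] show ?case by (simp add: ands_def)
qed (simp add: ands_def)

lemma wf_ands: "wf_tm D B (ands ts) \<longleftrightarrow> (\<forall>t \<in> set ts. wf_tm D B t)"
  by (induction ts) (auto simp: ands_def)

text \<open>
  Registers 1, 2 and 3 hold \<open>n1\<close>, \<open>n2\<close> and \<open>n = n1 + n2\<close>, registers 4 and 6 the addresses of the two
  adjacency matrices, and registers 7 and 8 the address and the size of the current table. Registers 10 and
  11 are summation variables; sums over 10 replace the missing multiplication. The tuples start at
  register 12.
\<close>

definition index_tm :: "nat list \<Rightarrow> tm" where
  "index_tm vs = foldl (\<lambda>t x. Pls (Sm 10 3 t) (Var x)) (Cst 0) vs"

definition horner :: "nat \<Rightarrow> nat list \<Rightarrow> nat" where
  "horner n xs = foldl (\<lambda>a x. n * a + x) 0 xs"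

lemma ev_index: "10 \<notin> set vs \<Longrightarrow> ev (index_tm vs) r m = horner (r 3) (map r vs)"
proof (induction vs arbitrary: r rule: rev_induct)
  case (snoc x vs)
  have "ev (index_tm vs) (r(10 := v)) m = horner (r 3) (map r vs)" for v
  proof -
    have e: "map (r(10 := v)) vs = map r vs" using snoc.prems by auto
    have "ev (index_tm vs) (r(10 := v)) m = horner ((r(10 := v)) 3) (map (r(10 := v)) vs)"
      by (rule snoc.IH) (use snoc.prems in simp)
    then show ?thesis unfolding e by simp
  qed
  then show ?case by (simp add: index_tm_def horner_def)
qed (simp add: index_tm_def horner_def)

lemma wf_index: "wf_tm D B (index_tm vs) \<longleftrightarrow> set vs \<subseteq> {..<D} \<and> (vs \<noteq> [] \<longrightarrow> 10 < D \<and> 3 \<in> B \<and> 10 \<notin> B)"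
  by (induction vs rule: rev_induct) (auto simp: index_tm_def)

lemma lists_below_snoc: "xs @ [x] \<in> lists_below n k \<longleftrightarrow> x < n \<and> (\<exists>l. k = Suc l \<and> xs \<in> lists_below n l)"
  by (auto simp: lists_below_def)

lemma horner_less: "xs \<in> lists_below n k \<Longrightarrow> horner n xs < n ^ k"
proof (induction xs arbitrary: k rule: rev_induct)
  case (snoc x xs)
  then obtain l where l: "k = Suc l" "xs \<in> lists_below n l" "x < n" by (auto simp: lists_below_snoc)
  then have "Suc (horner n xs) \<le> n ^ l" using snoc.IH by (simp add: Suc_le_eq)
  then have "n * Suc (horner n xs) \<le> n * n ^ l" by (rule mult_le_mono2)
  then show ?case using l(1,3) by (simp add: horner_def)
qed (simp add: lists_below_def horner_def)

text \<open>Base-\<open>n\<close> digits are unique, so different tuples occupy different cells of a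
  table.\<close>

lemma horner_inj: "xs \<in> lists_below n k \<Longrightarrow> ys \<in> lists_below n k \<Longrightarrow> horner n xs = horner n ys \<Longrightarrow> xs = ys"
proof (induction xs arbitrary: ys k rule: rev_induct)
  case Nil
  then show ?case by (simp add: lists_below_def)
next
  case (snoc x xs)
  obtain l where l: "k = Suc l" "xs \<in> lists_below n l" "x < n" using snoc.prems(1) by (auto simp: lists_below_snoc)
  then obtain zs z where ys: "ys = zs @ [z]" using snoc.prems(2) by (cases ys rule: rev_cases) (auto simp: lists_below_def)
  then have z: "zs \<in> lists_below n l" "z < n" using snoc.prems(2) l(1) by (auto simp: lists_below_snoc)
  have eq: "n * horner n xs + x = n * horner n zs + z" using snoc.prems(3) ys by (simp add: horner_def)
  have "x = z" using arg_cong[OF eq, of "\<lambda>a. a mod n"] l(3) z(2) by simp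
  moreover have "horner n xs = horner n zs" using eq \<open>x = z\<close> l(3) by simp
  ultimately show ?case using snoc.IH[OF l(2) z(1)] ys by simp
qed

definition sum_tm :: "nat list \<Rightarrow> tm \<Rightarrow> tm" where "sum_tm vs t = foldr (\<lambda>i. Sm i 3) vs t"

lemma wf_sum_tm: "wf_tm D B (sum_tm vs t) \<longleftrightarrow> set vs \<subseteq> {..<D} \<and> (vs \<noteq> [] \<longrightarrow> 3 \<in> B) \<and> set vs \<inter> B = {} \<and> wf_tm D B t"
  by (induction vs) (auto simp: sum_tm_def)

lemma ev_sum_tm_one: "3 \<notin> set vs \<Longrightarrow> ev (sum_tm vs (Cst 1)) r m = r 3 ^ length vs"
  by (induction vs arbitrary: r) (simp_all add: sum_tm_def)

text \<open>A sum of natural numbers vanishes iff all its terms do: this is the universal quantifier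
  over tuples. The state \<open>r'\<close> ranges over the assignments to the summation
  variables.\<close>

lemma ev_sum_tm_zero:
  assumes "3 \<notin> set vs" "distinct vs"
  shows "ev (sum_tm vs t) r m = 0 \<longleftrightarrow>
    (\<forall>r'. (\<forall>x. x \<notin> set vs \<longrightarrow> r' x = r x) \<longrightarrow> map r' vs \<in> lists_below (r 3) (length vs) \<longrightarrow> ev t r' m = 0)"
  using assms
proof (induction vs arbitrary: r)
  case Nil
  have "r' = r" if "\<forall>x. r' x = r x" for r' using that by blast
  then show ?case by (auto simp: sum_tm_def lists_below_def)
next
  case (Cons i vs)
  have mem: "map r' (i # vs) \<in> lists_below (r 3) (length (i # vs)) \<longleftrightarrow>
      r' i < r 3 \<and> map r' vs \<in> lists_below (r 3) (length vs)" for r'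
    by (auto simp: lists_below_def)
  have "ev (sum_tm (i # vs) t) r m = 0 \<longleftrightarrow> (\<forall>v < r 3. ev (sum_tm vs t) (r(i := v)) m = 0)"
    by (auto simp: sum_tm_def)
  also have "\<dots> \<longleftrightarrow> (\<forall>v < r 3. \<forall>r'. (\<forall>x. x \<notin> set vs \<longrightarrow> r' x = (r(i := v)) x) \<longrightarrow>
      map r' vs \<in> lists_below (r 3) (length vs) \<longrightarrow> ev t r' m = 0)"
    using Cons by simp
  also have "\<dots> \<longleftrightarrow> (\<forall>r'. (\<forall>x. x \<notin> set (i # vs) \<longrightarrow> r' x = r x) \<longrightarrow>
      map r' (i # vs) \<in> lists_below (r 3) (length (i # vs)) \<longrightarrow> ev t r' m = 0)" (is "?L \<longleftrightarrow> ?R")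
  proof
    assume L: ?L
    show ?R
    proof (intro allI impI)
      fix r' assume r': "\<forall>x. x \<notin> set (i # vs) \<longrightarrow> r' x = r x" "map r' (i # vs) \<in> lists_below (r 3) (length (i # vs))"
      have "\<forall>x. x \<notin> set vs \<longrightarrow> r' x = (r(i := r' i)) x" using r'(1) by simp
      then show "ev t r' m = 0" using L r'(2) unfolding mem by blast
    qed
  next
    assume R: ?R
    show ?L
    proof (intro allI impI)
      fix v r' assume v: "v < r 3" "\<forall>x. x \<notin> set vs \<longrightarrow> r' x = (r(i := v)) x" "map r' vs \<in> lists_below (r 3) (length vs)"
      have "r' i = v" using v(2) Cons.prems(2) by simp
      moreover have "\<forall>x. x \<notin> set (i # vs) \<longrightarrow> r' x = r x" using v(2) by simp
      ultimately show "ev t r' m = 0" using R v(1,3) unfolding mem by blast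
    qed
  qed
  finally show ?case .
qed

lemma registers_exist:
  assumes "distinct vs" "length xs = length vs"
  shows "\<exists>r' :: nat \<Rightarrow> nat. map r' vs = xs \<and> (\<forall>x. x \<notin> set vs \<longrightarrow> r' x = r x)"
proof -
  define r' where "r' a = (case map_of (zip vs xs) a of None \<Rightarrow> r a | Some v \<Rightarrow> v)" for a
  have "map r' vs = xs"
    using assms by (intro nth_equalityI) (simp_all add: r'_def map_of_zip_nth)
  moreover have "r' x = r x" if "x \<notin> set vs" for x
    using that assms by (simp add: r'_def map_of_zip_is_None[THEN iffD2])
  ultimately show ?thesis by blast
qed

definition in_state :: "nat \<Rightarrow> (nat \<Rightarrow> nat) \<Rightarrow> (nat \<Rightarrow> nat) \<Rightarrow> assertion" where
  "in_state D r0 m0 r m \<longleftrightarrow> m = m0 \<and> (\<forall>y < D. r y = r0 y)"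

lemma hoare_assign_in_state:
  assumes "wf_tm D B a" "B \<subseteq> {..<D}" "x < D" "\<And>b. b \<in> B \<Longrightarrow> r0 b \<le> N" "r1 = r0(x := ev a r0 m0)"
  shows "hoare (in_state D r0 m0) (assign D x a) (in_state D r1 m0) (poly (tm_time a) N + 2)"
proof (rule hoare_assign[OF assms(1-3)])
  show "r b \<le> N" if "in_state D r0 m0 r m" "b \<in> B" for r m b
    using that assms(2,4) by (auto simp: in_state_def)
  show "in_state D r1 m0 r' m" if P: "in_state D r0 m0 r m" and r': "\<And>y. y < D \<Longrightarrow> r' y = (r(x := ev a r m)) y" for r r' m
  proof -
    have "ev a r m = ev a r0 m0"
      using P fv_wf[OF assms(1,2)] unfolding in_state_def by (metis ev_cong lessThan_iff subsetD)
    then show ?thesis using P r' by (simp add: in_state_def assms(5))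
  qed
qed

text \<open>The values may depend on memory below \<open>lo\<close> only, which is not written here.
  So the new entries can be computed from the input and from earlier tables.\<close>

lemma hoare_fill:
  assumes wf: "wf_tm D B a" "wf_tm D B t" "B \<subseteq> {..<D}" "\<And>b. b \<in> B \<Longrightarrow> r0 b \<le> N" "3 \<in> B" "set vs \<inter> B = {}"
    and vs: "distinct vs" "set vs \<subseteq> {..<D}"
    and val: "\<And>r m. (\<And>x. x < D \<Longrightarrow> x \<notin> set vs \<Longrightarrow> r x = r0 x) \<Longrightarrow> map r vs \<in> lists_below (r0 3) (length vs) \<Longrightarrow>
      (\<And>z. z < lo \<Longrightarrow> m z = m0 z) \<Longrightarrow> ev a r m = lo + horner (r0 3) (map r vs) \<and> ev t r m = f (map r vs)"
  shows "hoare (\<lambda>r m. (\<forall>x < D. x \<notin> set vs \<longrightarrow> r x = r0 x) \<and> (\<forall>z < lo. m z = m0 z))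
    (loops D 3 vs (store D a t))
    (\<lambda>r m. (\<forall>x < D. x \<notin> set vs \<longrightarrow> r x = r0 x) \<and> (\<forall>z < lo. m z = m0 z) \<and>
      (\<forall>p \<in> lists_below (r0 3) (length vs). m (lo + horner (r0 3) p) = f p))
    (poly (loop_time (length vs) (tm_time a + tm_time t + [:1:])) N)"
proof -
  let ?n = "r0 3"
  define J where "J Z r m \<longleftrightarrow> (\<forall>x < D. x \<notin> set vs \<longrightarrow> r x = r0 x) \<and> (\<forall>z < lo. m z = m0 z) \<and>
      (\<forall>p \<in> Z \<inter> lists_below ?n (length vs). m (lo + horner ?n p) = f p)" for Z r m
  have "hoare (J {}) (loops D 3 vs (store D a t)) (J (lists_below ?n (length vs)))
    (poly (loop_time (length vs) (tm_time a + tm_time t + [:1:])) N)"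
  proof (rule hoare_loops)
    show "J Z r' m" if "J Z r m" "\<And>x. x < D \<Longrightarrow> x \<notin> set vs \<Longrightarrow> r' x = r x" for Z r r' m
      using that by (simp add: J_def)
    show "r 3 = ?n" if "J Z r m" for Z r m
      using that wf(3,5,6) by (auto simp: J_def)
    show "3 \<notin> set vs" "3 < D" "?n \<le> N" using wf(3-6) by auto
    show "distinct vs" "set vs \<subseteq> {..<D}" by (rule vs)+
    fix Z xs assume xs: "xs \<in> lists_below ?n (length vs)" "xs \<notin> Z"
    have "hoare (\<lambda>r m. J Z r m \<and> map r vs = xs) (store D a t) (\<lambda>r m. J (insert xs Z) r m \<and> map r vs = xs)
      (poly (tm_time a) N + poly (tm_time t) N + 1)"
    proof (rule hoare_store[OF wf(1-3)])
      show "r b \<le> N" if "J Z r m \<and> map r vs = xs" "b \<in> B" for r m b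
      proof -
        have "b < D" "b \<notin> set vs" using that(2) wf(3,6) by auto
        then show ?thesis using that wf(4)[OF that(2)] by (simp add: J_def)
      qed
      fix r r' m assume P: "J Z r m \<and> map r vs = xs" and r': "\<And>y. y < D \<Longrightarrow> r' y = r y"
      have v: "ev a r m = lo + horner ?n xs" "ev t r m = f xs"
        using val[of r m] P xs(1) by (simp_all add: J_def)
      have "map r' vs = map r vs" using r' vs(2) by (intro map_cong) auto
      moreover have "J (insert xs Z) r' (m(lo + horner ?n xs := f xs))"
        unfolding J_def
      proof (intro conjI ballI allI impI)
        show "r' x = r0 x" if "x < D" "x \<notin> set vs" for x using that r' P by (simp add: J_def)
        show "(m(lo + horner ?n xs := f xs)) z = m0 z" if "z < lo" for z using that P by (simp add: J_def)
        fix p assume p: "p \<in> insert xs Z \<inter> lists_below ?n (length vs)"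
        show "(m(lo + horner ?n xs := f xs)) (lo + horner ?n p) = f p"
        proof (cases "p = xs")
          case False
          then have "horner ?n p \<noteq> horner ?n xs" using horner_inj[of p ?n "length vs" xs] p xs(1) by blast
          then show ?thesis using False p P by (simp add: J_def)
        qed simp
      qed
      ultimately show "J (insert xs Z) r' (m(ev a r m := ev t r m)) \<and> map r' vs = xs"
        using P by (simp add: v)
    qed
    then show "hoare (\<lambda>r m. J Z r m \<and> map r vs = xs) (store D a t) (\<lambda>r m. J (insert xs Z) r m \<and> map r vs = xs)
      (poly (tm_time a + tm_time t + [:1:]) N)" by simp
  qed
  then show ?thesis by (rule hoare_conseq) (auto simp: J_def)
qed

text \<open>Both matrix entries are evaluated for all \<open>u\<close> and \<open>w\<close>, also
  for pairs that fail the range test, where the cell read may contain anything. The double negation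
  reduces its content to 0 or 1, so that a failed range test makes the conjunction 0.\<close>

definition edge_tm :: "nat \<Rightarrow> nat \<Rightarrow> tm" where
  "edge_tm u w = Pls
     (and_tm (and_tm (lt_tm (Var u) (Var 1)) (lt_tm (Var w) (Var 1)))
       (not_tm (not_tm (Mem (Pls (Var 4) (Pls (Sm 10 1 (Var u)) (Var w)))))))
     (and_tm (and_tm (not_tm (lt_tm (Var u) (Var 1))) (not_tm (lt_tm (Var w) (Var 1))))
       (not_tm (not_tm (Mem (Pls (Var 6) (Pls (Sm 10 2 (Mns (Var u) (Var 1))) (Mns (Var w) (Var 1))))))))"

definition side_tm :: "nat \<Rightarrow> nat \<Rightarrow> tm" where
  "side_tm u w = eq_tm (lt_tm (Var u) (Var 1)) (lt_tm (Var w) (Var 1))"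

definition table_tm :: "nat list \<Rightarrow> tm" where
  "table_tm vs = Mem (Pls (Var 7) (index_tm vs))"

lemma lists_below_append:
  "length xs = k \<Longrightarrow> xs @ ys \<in> lists_below n (k + l) \<longleftrightarrow> xs \<in> lists_below n k \<and> ys \<in> lists_below n l"
  by (auto simp: lists_below_def)

lemma ev_table:
  assumes "10 \<notin> set vs" "10 \<notin> set ws" "map r vs \<in> lists_below (r 3) k" "map r ws \<in> lists_below (r 3) k"
    and "\<And>x y. x \<in> lists_below (r 3) k \<Longrightarrow> y \<in> lists_below (r 3) k \<Longrightarrow> m (r 7 + horner (r 3) (x @ y)) = of_bool (Q x y)"
  shows "ev (table_tm (vs @ ws)) r m = of_bool (Q (map r vs) (map r ws))"
  using assms by (simp add: table_tm_def ev_index)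

text \<open>Five blocks of \<open>K\<close> registers: the tuples \<open>x\<close>,
  \<open>y\<close>, \<open>z\<close> of the recursion for \<open>W\<close> in blocks 0 to 2, and the
  counters of the rounds in blocks 3 and 4.\<close>

definition vars :: "nat \<Rightarrow> nat \<Rightarrow> nat list" where "vars K i = [12 + i * K..<12 + Suc i * K]"

definition regs :: "nat \<Rightarrow> nat" where "regs K = 12 + 5 * K"

definition atomic_tm :: "nat \<Rightarrow> tm" where
  "atomic_tm K = ands (map (\<lambda>(i, j). let u = vars K 0 ! i; w = vars K 0 ! j; u' = vars K 1 ! i; w' = vars K 1 ! j in
     and_tm (eq_tm (eq_tm (Var u) (Var w)) (eq_tm (Var u') (Var w')))
      (and_tm (eq_tm (edge_tm u w) (edge_tm u' w')) (eq_tm (side_tm u w) (side_tm u' w'))))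
     (List.product [0..<K] [0..<K]))"

text \<open>Updating a tuple is a renaming: the register at position \<open>i\<close> is replaced by
  the summation variable 11, so the inner sums are the counts in the recursion for \<open>W\<close>.
  The outer sum of absolute differences is 0 iff the counts agree for all \<open>z\<close>.\<close>

definition round_tm :: "nat \<Rightarrow> tm" where
  "round_tm K = and_tm (table_tm (vars K 0 @ vars K 1))
     (ands (map (\<lambda>i. not_tm (sum_tm (vars K 2) (diff_tm
        (Sm 11 3 (table_tm ((vars K 0)[i := 11] @ vars K 2))) (Sm 11 3 (table_tm ((vars K 1)[i := 11] @ vars K 2)))))) [0..<K]))"

text \<open>The sum counts the witnesses, \<open>not_tm (Var 3)\<close> accounts for two null
  graphs, and the double negation turns a positive total into 1.\<close>

definition answer_tm :: "nat \<Rightarrow> tm" where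
  "answer_tm K = not_tm (not_tm (Pls (not_tm (Var 3)) (sum_tm (vars K 0 @ vars K 1)
     (and_tm (and_tm (lt_tm (Var 12) (Var 1)) (not_tm (lt_tm (Var (12 + K)) (Var 1)))) (table_tm (vars K 0 @ vars K 1))))))"

lemma length_vars: "length (vars K i) = K" by (simp add: vars_def)

lemma set_vars: "set (vars K i) = {12 + i * K..<12 + Suc i * K}" by (simp add: vars_def)

lemma vars_disjoint: "i \<noteq> j \<Longrightarrow> set (vars K i) \<inter> set (vars K j) = {}"
proof -
  have "set (vars K i) \<inter> set (vars K j) = {}" if "i < j" for i j
  proof -
    have "Suc i * K \<le> j * K" using that by (intro mult_le_mono1) simp
    then show ?thesis by (auto simp: set_vars)
  qed
  then show "i \<noteq> j \<Longrightarrow> set (vars K i) \<inter> set (vars K j) = {}" by (metis Int_commute linorder_neqE_nat)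
qed

lemma vars_top: "i < 5 \<Longrightarrow> set (vars K i) \<subseteq> {12..<regs K}"
proof -
  assume "i < 5"
  then have "Suc i * K \<le> 5 * K" by (intro mult_le_mono1) simp
  then show ?thesis by (auto simp: set_vars regs_def)
qed

lemma vars_nth: "j < K \<Longrightarrow> vars K i ! j \<in> set (vars K i)"
  by (simp add: length_vars)

lemma small_notin_vars: "x < 12 \<Longrightarrow> x \<notin> set (vars K i)" by (simp add: set_vars)

lemma distinct_vars: "distinct (vars K i)" by (simp add: vars_def)

lemma wf_edge: "u < D \<Longrightarrow> w < D \<Longrightarrow> 12 \<le> D \<Longrightarrow> wf_tm D {1, 2, 3} (edge_tm u w)"
  by (simp add: edge_tm_def)

lemma wf_side: "u < D \<Longrightarrow> w < D \<Longrightarrow> 12 \<le> D \<Longrightarrow> wf_tm D {1, 2, 3} (side_tm u w)"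
  by (simp add: side_tm_def)

lemma wf_table: "set vs \<subseteq> {..<D} \<Longrightarrow> 12 \<le> D \<Longrightarrow> wf_tm D {1, 2, 3} (table_tm vs)"
  by (simp add: table_tm_def wf_index)

lemma vars_below: "i < 5 \<Longrightarrow> set (vars K i) \<subseteq> {..<regs K}"
  using vars_top[of i K] by auto

lemma wf_atomic: "wf_tm (regs K) {1, 2, 3} (atomic_tm K)"
proof -
  have "vars K i ! j < regs K" if "i < 5" "j < K" for i j
    using vars_below[OF that(1), of K] vars_nth[OF that(2), of i] by auto
  moreover have "12 \<le> regs K" by (simp add: regs_def)
  ultimately show ?thesis by (auto simp: atomic_tm_def wf_ands Let_def wf_edge[simplified] wf_side[simplified])
qed

lemma wf_round: "wf_tm (regs K) {1, 2, 3} (round_tm K)"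
proof -
  have D: "12 \<le> regs K" by (simp add: regs_def)
  have upd: "set ((vars K i)[j := 11]) \<subseteq> {..<regs K}" if "i < 5" for i j
    using set_update_subset_insert[of "vars K i" j 11] vars_below[OF that, of K] D by auto
  have 3: "set (vars K 2) \<inter> {1, 2, 3} = {}" by (auto simp: set_vars)
  have t: "wf_tm (regs K) {1, 2, 3} (table_tm (vars K 0 @ vars K 1))"
    "wf_tm (regs K) {1, 2, 3} (table_tm ((vars K i)[j := 11] @ vars K 2))" if "i < 5" for i j
    using D upd[OF that] vars_below[of 0 K] vars_below[of 1 K] vars_below[of 2 K] by (intro wf_table; simp)+
  note t = t[of 0, simplified] t[of 1, simplified]
  show ?thesis
    unfolding round_tm_def wf_tm.simps wf_ands
    using D t vars_below[of 2 K] 3 by (auto simp: wf_sum_tm)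
qed

lemma wf_answer: "K > 0 \<Longrightarrow> wf_tm (regs K) {1, 2, 3} (answer_tm K)"
proof -
  assume K: "K > 0"
  have D: "12 \<le> regs K" "12 + K < regs K" using K by (simp_all add: regs_def)
  have 3: "set (vars K 0 @ vars K 1) \<inter> {1, 2, 3} = {}" by (auto simp: set_vars)
  have t: "wf_tm (regs K) {1, 2, 3} (table_tm (vars K 0 @ vars K 1))"
    using D vars_below[of 0 K] vars_below[of 1 K] by (intro wf_table; simp)
  show ?thesis
    unfolding answer_tm_def wf_tm.simps wf_sum_tm
    using D t 3 vars_below[of 0 K] vars_below[of 1 K] by auto
qed

section \<open>The refinement program\<close>

definition xy_vars :: "nat \<Rightarrow> nat list" where "xy_vars K = vars K 0 @ vars K 1"
definition round_vars :: "nat \<Rightarrow> nat list" where "round_vars K = vars K 3 @ vars K 4"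

definition init_table :: "nat \<Rightarrow> prog" where
  "init_table K = loops (regs K) 3 (xy_vars K) (store (regs K) (Pls (Var 7) (index_tm (xy_vars K))) (atomic_tm K))"

text \<open>A round reads the table at the address in register 7 and writes the next one right behind it.\<close>

definition wl_round :: "nat \<Rightarrow> prog" where
  "wl_round K = Seq (loops (regs K) 3 (xy_vars K)
     (store (regs K) (Pls (Pls (Var 7) (Var 8)) (index_tm (xy_vars K))) (round_tm K)))
     (assign (regs K) 7 (Pls (Var 7) (Var 8)))"

text \<open>The first scan yields \<open>n1\<close>. Register 9 then skips the first matrix and
  scans the second unary number, whose start is kept in register 5, so that the difference is
  \<open>n2\<close>. The table size is a sum of ones over all pairs of tuples. The loops over
  \<open>round_vars\<close> merely count: \<open>2 * K\<close> nested counters below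
  \<open>n\<close> give exactly the number of rounds after which the refinement is stable.\<close>

definition wl_program :: "nat \<Rightarrow> prog" where
  "wl_program K = (let D = regs K in seq [
     scan D 1,
     assign D 4 (Pls (Var 1) (Cst 1)),
     assign D 9 (Pls (Var 4) (Sm 10 1 (Var 1))),
     assign D 5 (Var 9),
     scan D 9,
     assign D 2 (Mns (Var 9) (Var 5)),
     assign D 3 (Pls (Var 1) (Var 2)),
     assign D 6 (Pls (Var 9) (Cst 1)),
     assign D 7 (Pls (Var 6) (Sm 10 2 (Var 2))),
     assign D 8 (sum_tm (xy_vars K) (Cst 1)),
     init_table K,
     loops D 3 (round_vars K) (wl_round K),
     assign D 0 (answer_tm K)])"

lemma round_vars: "set (round_vars K) \<inter> set (xy_vars K) = {}" "distinct (xy_vars K)" "distinct (round_vars K)"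
  "set (xy_vars K) \<subseteq> {12..<regs K}" "set (round_vars K) \<subseteq> {12..<regs K}"
  "length (xy_vars K) = 2 * K" "length (round_vars K) = 2 * K"
  using vars_disjoint[of 0 1 K] vars_disjoint[of 0 3 K] vars_disjoint[of 0 4 K] vars_disjoint[of 1 3 K] vars_disjoint[of 1 4 K]
    vars_disjoint[of 3 4 K] vars_top[of 0 K] vars_top[of 1 K] vars_top[of 3 K] vars_top[of 4 K]
  by (auto simp: xy_vars_def round_vars_def distinct_vars length_vars)

abbreviation table_time :: "nat \<Rightarrow> nat poly" where
  "table_time K \<equiv> loop_time (2 * K) (tm_time (Pls (Pls (Var 7) (Var 8)) (index_tm (xy_vars K))) + tm_time (round_tm K) + [:1:])"

abbreviation init_time :: "nat \<Rightarrow> nat poly" where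
  "init_time K \<equiv> loop_time (2 * K) (tm_time (Pls (Var 7) (index_tm (xy_vars K))) + tm_time (atomic_tm K) + [:1:])"

abbreviation round_time :: "nat \<Rightarrow> nat poly" where
  "round_time K \<equiv> loop_time (2 * K) (tm_time (Pls (Pls (Var 7) (Var 8)) (index_tm (xy_vars K))) + tm_time (round_tm K) + [:1:])
       + tm_time (Pls (Var 7) (Var 8)) + [:2:]"

lemma index_bound: "u < k \<Longrightarrow> w < k \<Longrightarrow> k * u + w < k * k" for k :: nat
proof -
  assume "u < k" "w < k"
  then have "k * u + w < k * u + k" by simp
  also have "\<dots> = k * Suc u" by simp
  also have "\<dots> \<le> k * k" using \<open>u < k\<close> by (intro mult_le_mono2) simp
  finally show ?thesis .
qed

section \<open>Correctness of the program on encoded graphs\<close>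

locale wl_input =
  fixes K n1 n2 :: nat and A A' :: "nat rel" and m0 :: "nat \<Rightarrow> nat"
  assumes K_pos: "0 < K"
    and sym: "\<And>u w. (u, w) \<in> A \<Longrightarrow> (w, u) \<in> A" "\<And>u w. (u, w) \<in> A' \<Longrightarrow> (w, u) \<in> A'"
    and unary1: "\<And>j. j < n1 \<Longrightarrow> m0 j = 1" "m0 n1 = 0"
    and adj1: "\<And>u w. u < n1 \<Longrightarrow> w < n1 \<Longrightarrow> m0 (n1 + 1 + (n1 * u + w)) = of_bool ((u, w) \<in> A)"
    and unary2: "\<And>j. j < n2 \<Longrightarrow> m0 (n1 + 1 + n1 * n1 + j) = 1" "m0 (n1 + 1 + n1 * n1 + n2) = 0"
    and adj2: "\<And>u w. u < n2 \<Longrightarrow> w < n2 \<Longrightarrow> m0 (n1 + 1 + n1 * n1 + n2 + 1 + (n2 * u + w)) = of_bool ((u, w) \<in> A')"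
begin

abbreviation "n \<equiv> n1 + n2"
abbreviation "L \<equiv> n1 + 1 + n1 * n1 + n2 + 1 + n2 * n2"
abbreviation "D \<equiv> regs K"

sublocale r: refinement "{..<n}" "union_edge n1 A A'" "side n1" K
proof
  show "finite {..<n}" by simp
  show "union_edge n1 A A' w u" if "union_edge n1 A A' u w" for u w
    using that sym by (auto simp: union_edge_def)
  show "equivp (side n1)" by (auto simp: side_def intro!: equivpI reflpI sympI transpI)
qed

abbreviation accepts :: "nat \<Rightarrow> bool" where
  "accepts t \<equiv> n = 0 \<or> (\<exists>x \<in> r.tuples. \<exists>y \<in> r.tuples. x ! 0 < n1 \<and> n1 \<le> y ! 0 \<and> r.W t x y)"

lemma tuples_eq: "r.tuples = lists_below n K" by (simp add: r.tuples_def lists_below_def)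

lemma stab_eq: "r.stab = n ^ (2 * K)" by (simp add: r.stab_def)

text \<open>The part of the state that all rounds keep. Register 7, the address of the current
  table, is left out because it moves.\<close>

definition base :: "assertion" where
  "base r m \<longleftrightarrow> r 1 = n1 \<and> r 2 = n2 \<and> r 3 = n \<and> r 4 = n1 + 1 \<and> r 6 = n1 + 1 + n1 * n1 + n2 + 1 \<and>
     r 8 = n ^ (2 * K) \<and> (\<forall>a < L. m a = m0 a)"

definition has_table :: "nat \<Rightarrow> nat \<Rightarrow> (nat \<Rightarrow> nat) \<Rightarrow> bool" where
  "has_table t cur m \<longleftrightarrow> (\<forall>x \<in> lists_below n K. \<forall>y \<in> lists_below n K. m (cur + horner n (x @ y)) = of_bool (r.W t x y))"

lemma ev_edge:
  assumes "base r m" "u \<noteq> 10" "w \<noteq> 10" "r u < n" "r w < n"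
  shows "ev (edge_tm u w) r m = of_bool (union_edge n1 A A' (r u) (r w))"
proof -
  have r: "r 1 = n1" "r 2 = n2" "r 4 = n1 + 1" "r 6 = n1 + 1 + n1 * n1 + n2 + 1" and m: "\<And>a. a < L \<Longrightarrow> m a = m0 a"
    using assms(1) by (simp_all add: base_def)
  have m1: "m (n1 + 1 + (n1 * r u + r w)) = of_bool ((r u, r w) \<in> A)" if "r u < n1" "r w < n1"
    using that index_bound[OF that] by (subst m) (simp_all add: adj1[simplified])
  have m2: "m (n1 + 1 + n1 * n1 + n2 + 1 + (n2 * (r u - n1) + (r w - n1))) = of_bool ((r u - n1, r w - n1) \<in> A')"
    if "n1 \<le> r u" "n1 \<le> r w"
  proof -
    have lt: "r u - n1 < n2" "r w - n1 < n2" using that assms(4,5) by auto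
    then show ?thesis using index_bound[OF lt] by (subst m) (simp_all add: adj2[simplified])
  qed
  have ur: "(r(10 := v)) u = r u" "(r(10 := v)) 1 = n1" for v using assms(2) r(1) by simp_all
  have e1: "ev (Mem (Pls (Var 4) (Pls (Sm 10 1 (Var u)) (Var w)))) r m = m (n1 + 1 + (n1 * r u + r w))"
    unfolding ev.simps ur r by simp
  have e2: "ev (Mem (Pls (Var 6) (Pls (Sm 10 2 (Mns (Var u) (Var 1))) (Mns (Var w) (Var 1))))) r m =
      m (n1 + 1 + n1 * n1 + n2 + 1 + (n2 * (r u - n1) + (r w - n1)))"
    unfolding ev.simps ur r by simp
  consider "r u < n1" "r w < n1" | "r u < n1" "n1 \<le> r w" | "n1 \<le> r u" "r w < n1" | "n1 \<le> r u" "n1 \<le> r w" by linarith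
  then show ?thesis
  proof cases
    case 1
    have "ev (edge_tm u w) r m = 1 - (1 - m (n1 + 1 + (n1 * r u + r w)))"
      unfolding edge_tm_def ev.simps(3,4) e1 e2 using 1 r(1) by simp
    then show ?thesis using m1[OF 1] 1 by (simp add: union_edge_def)
  next
    case 2
    then show ?thesis using r(1) unfolding edge_tm_def ev.simps(3,4) e1 e2 by (simp add: union_edge_def)
  next
    case 3
    then show ?thesis using r(1) unfolding edge_tm_def ev.simps(3,4) e1 e2 by (simp add: union_edge_def)
  next
    case 4
    have "ev (edge_tm u w) r m = 1 - (1 - m (n1 + 1 + n1 * n1 + n2 + 1 + (n2 * (r u - n1) + (r w - n1))))"
      unfolding edge_tm_def ev.simps(3,4) e1 e2 using 4 r(1) by simp
    then show ?thesis using m2[OF 4] 4 by (simp add: union_edge_def)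
  qed
qed

lemma ev_side: "base r m \<Longrightarrow> ev (side_tm u w) r m = of_bool (side n1 (r u) (r w))"
  unfolding side_tm_def by (auto simp: base_def side_def)

lemma map_vars:
  assumes "map r (vars K i) \<in> lists_below n K" "j < K"
  shows "r (vars K i ! j) = map r (vars K i) ! j" "r (vars K i ! j) < n" "vars K i ! j \<noteq> 10"
proof -
  show *: "r (vars K i ! j) = map r (vars K i) ! j" using assms(2) by (simp add: length_vars)
  have "map r (vars K i) ! j \<in> set (map r (vars K i))" using assms(2) by (intro nth_mem) (simp add: length_vars)
  then show "r (vars K i ! j) < n" using assms(1) * by (auto simp: lists_below_def)
  show "vars K i ! j \<noteq> 10" using vars_nth[OF assms(2), of i] by (auto simp: set_vars)
qed

lemma ev_atomic:
  assumes "base r m" "map r (vars K 0) \<in> lists_below n K" "map r (vars K 1) \<in> lists_below n K"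
  shows "ev (atomic_tm K) r m = of_bool (r.atomic (map r (vars K 0)) (map r (vars K 1)))"
proof -
  let ?x = "map r (vars K 0)" and ?y = "map r (vars K 1)"
  define f where "f = (\<lambda>(i, j). let u = vars K 0 ! i; w = vars K 0 ! j; u' = vars K 1 ! i; w' = vars K 1 ! j in
     and_tm (eq_tm (eq_tm (Var u) (Var w)) (eq_tm (Var u') (Var w')))
      (and_tm (eq_tm (edge_tm u w) (edge_tm u' w')) (eq_tm (side_tm u w) (side_tm u' w'))))"
  define P where "P i j \<longleftrightarrow> (?x ! i = ?x ! j \<longleftrightarrow> ?y ! i = ?y ! j) \<and>
     (union_edge n1 A A' (?x ! i) (?x ! j) \<longleftrightarrow> union_edge n1 A A' (?y ! i) (?y ! j)) \<and>
     (side n1 (?x ! i) (?x ! j) \<longleftrightarrow> side n1 (?y ! i) (?y ! j))" for i j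
  have f: "ev (f (i, j)) r m = of_bool (P i j)" if ij: "i < K" "j < K" for i j
  proof -
    note x = map_vars[OF assms(2) ij(1)] map_vars[OF assms(2) ij(2)]
    note y = map_vars[OF assms(3) ij(1)] map_vars[OF assms(3) ij(2)]
    have e: "ev (edge_tm (vars K 0 ! i) (vars K 0 ! j)) r m = of_bool (union_edge n1 A A' (?x ! i) (?x ! j))"
      "ev (edge_tm (vars K 1 ! i) (vars K 1 ! j)) r m = of_bool (union_edge n1 A A' (?y ! i) (?y ! j))"
      using ev_edge[OF assms(1) x(3,6,2,5)] ev_edge[OF assms(1) y(3,6,2,5)] unfolding x(1,4) y(1,4) by simp_all
    have s: "ev (side_tm (vars K 0 ! i) (vars K 0 ! j)) r m = of_bool (side n1 (?x ! i) (?x ! j))"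
      "ev (side_tm (vars K 1 ! i) (vars K 1 ! j)) r m = of_bool (side n1 (?y ! i) (?y ! j))"
      unfolding ev_side[OF assms(1)] x(1,4) y(1,4) by simp_all
    have "ev (eq_tm (eq_tm (Var (vars K 0 ! i)) (Var (vars K 0 ! j))) (eq_tm (Var (vars K 1 ! i)) (Var (vars K 1 ! j)))) r m
      = of_bool (?x ! i = ?x ! j \<longleftrightarrow> ?y ! i = ?y ! j)"
      unfolding ev_eq ev.simps(1) x(1,4) y(1,4) by simp
    moreover have "ev (eq_tm (edge_tm (vars K 0 ! i) (vars K 0 ! j)) (edge_tm (vars K 1 ! i) (vars K 1 ! j))) r m
      = of_bool (union_edge n1 A A' (?x ! i) (?x ! j) \<longleftrightarrow> union_edge n1 A A' (?y ! i) (?y ! j))"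
      unfolding ev_eq e by simp
    moreover have "ev (eq_tm (side_tm (vars K 0 ! i) (vars K 0 ! j)) (side_tm (vars K 1 ! i) (vars K 1 ! j))) r m
      = of_bool (side n1 (?x ! i) (?x ! j) \<longleftrightarrow> side n1 (?y ! i) (?y ! j))"
      unfolding ev_eq s by simp
    ultimately show ?thesis unfolding f_def Let_def prod.case P_def by (intro ev_and)
  qed
  have "ev (ands (map f (List.product [0..<K] [0..<K]))) r m = of_bool (\<forall>k \<in> set (List.product [0..<K] [0..<K]). P (fst k) (snd k))"
    by (rule ev_ands) (use f in auto)
  also have "(\<forall>k \<in> set (List.product [0..<K] [0..<K]). P (fst k) (snd k)) \<longleftrightarrow> r.atomic ?x ?y"
    by (auto simp: P_def r.atomic_def)
  finally show ?thesis unfolding atomic_tm_def f_def .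
qed

lemma ev_count:
  assumes "base r m" "has_table t (r 7) m" "map r (vars K i) \<in> lists_below n K" "map r (vars K 2) \<in> lists_below n K" "j < K"
  shows "ev (Sm 11 3 (table_tm ((vars K i)[j := 11] @ vars K 2))) r m =
    card {v \<in> {..<n}. r.W t ((map r (vars K i))[j := v]) (map r (vars K 2))}"
proof -
  have r3: "r 3 = n" using assms(1) by (simp add: base_def)
  have "ev (table_tm ((vars K i)[j := 11] @ vars K 2)) (r(11 := v)) m = of_bool (r.W t ((map r (vars K i))[j := v]) (map r (vars K 2)))"
    if v: "v < n" for v
  proof -
    have m1: "map (r(11 := v)) ((vars K i)[j := 11]) = (map r (vars K i))[j := v]"
      using small_notin_vars[of 11 K i] by (simp add: map_update)
    have m2: "map (r(11 := v)) (vars K 2) = map r (vars K 2)"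
      using small_notin_vars[of 11 K 2] by simp
    have n10: "10 \<notin> set ((vars K i)[j := 11])" "10 \<notin> set (vars K 2)"
      using set_update_subset_insert[of "vars K i" j 11] small_notin_vars[of 10 K] by auto
    have mem: "map (r(11 := v)) ((vars K i)[j := 11]) \<in> lists_below ((r(11 := v)) 3) K"
      "map (r(11 := v)) (vars K 2) \<in> lists_below ((r(11 := v)) 3) K"
      unfolding m1 m2 using assms(3,4) v set_update_subset_insert[of "map r (vars K i)" j v] r3 by (auto simp: lists_below_def)
    have tab: "m ((r(11 := v)) 7 + horner ((r(11 := v)) 3) (x @ y)) = of_bool (r.W t x y)"
      if "x \<in> lists_below ((r(11 := v)) 3) K" "y \<in> lists_below ((r(11 := v)) 3) K" for x y
      using that assms(2) r3 by (simp add: has_table_def)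
    show ?thesis using ev_table[OF n10 mem, of m "r.W t"] tab unfolding m1 m2 by blast
  qed
  then have "ev (Sm 11 3 (table_tm ((vars K i)[j := 11] @ vars K 2))) r m =
      (\<Sum>v < n. of_bool (r.W t ((map r (vars K i))[j := v]) (map r (vars K 2))))"
    unfolding ev.simps r3 by (intro sum.cong) auto
  also have "\<dots> = card {v \<in> {..<n}. r.W t ((map r (vars K i))[j := v]) (map r (vars K 2))}"
    by (simp add: sum_of_bool_eq Int_def)
  finally show ?thesis .
qed

lemma ev_round:
  assumes b: "base r m" and t: "has_table t (r 7) m"
    and xy: "map r (vars K 0) \<in> lists_below n K" "map r (vars K 1) \<in> lists_below n K"
  shows "ev (round_tm K) r m = of_bool (r.W (Suc t) (map r (vars K 0)) (map r (vars K 1)))"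
proof -
  let ?x = "map r (vars K 0)" and ?y = "map r (vars K 1)"
  have r3: "r 3 = n" using b by (simp add: base_def)
  define cnt where "cnt i j = Sm 11 3 (table_tm ((vars K i)[j := 11] @ vars K 2))" for i j
  have 1: "ev (table_tm (vars K 0 @ vars K 1)) r m = of_bool (r.W t ?x ?y)"
    using xy t r3 small_notin_vars[of 10 K] by (intro ev_table) (auto simp: has_table_def)
  have 2: "ev (not_tm (sum_tm (vars K 2) (diff_tm (cnt 0 j) (cnt 1 j)))) r m =
      of_bool (\<forall>z \<in> lists_below n K. card {v \<in> {..<n}. r.W t (?x[j := v]) z} = card {v \<in> {..<n}. r.W t (?y[j := v]) z})"
    if j: "j < K" for j
  proof -
    have val: "ev (diff_tm (cnt 0 j) (cnt 1 j)) r' m = 0 \<longleftrightarrow>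
        card {v \<in> {..<n}. r.W t (?x[j := v]) z} = card {v \<in> {..<n}. r.W t (?y[j := v]) z}"
      if r': "\<forall>x. x \<notin> set (vars K 2) \<longrightarrow> r' x = r x" "map r' (vars K 2) = z" "z \<in> lists_below n K" for r' z
    proof -
      have other: "map r' (vars K i) = map r (vars K i)" if "i \<noteq> 2" for i
        using vars_disjoint[OF that, of K] r'(1) by (intro map_cong) auto
      have eq: "map r' (vars K 0) = ?x" "map r' (vars K 1) = ?y" by (rule other; simp)+
      have small: "r' x = r x" if "x < 12" for x using r'(1) small_notin_vars[OF that] by blast
      then have b': "base r' m" "r' 7 = r 7" using b by (simp_all add: base_def)
      have "ev (cnt 0 j) r' m = card {v \<in> {..<n}. r.W t (?x[j := v]) z}"
        "ev (cnt 1 j) r' m = card {v \<in> {..<n}. r.W t (?y[j := v]) z}"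
        using ev_count[OF b'(1), of t 0 j] ev_count[OF b'(1), of t 1 j] t j xy r'(2,3) unfolding b'(2) eq cnt_def by simp_all
      then show ?thesis by auto
    qed
    have "ev (sum_tm (vars K 2) (diff_tm (cnt 0 j) (cnt 1 j))) r m = 0 \<longleftrightarrow>
      (\<forall>z \<in> lists_below n K. card {v \<in> {..<n}. r.W t (?x[j := v]) z} = card {v \<in> {..<n}. r.W t (?y[j := v]) z})"
      unfolding ev_sum_tm_zero[OF small_notin_vars[of 3 K 2, simplified] distinct_vars] length_vars r3
    proof (intro iffI ballI allI impI)
      fix z assume H: "\<forall>r'. (\<forall>x. x \<notin> set (vars K 2) \<longrightarrow> r' x = r x) \<longrightarrow> map r' (vars K 2) \<in> lists_below n K \<longrightarrow>
          ev (diff_tm (cnt 0 j) (cnt 1 j)) r' m = 0" and z: "z \<in> lists_below n K"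
      have "length z = length (vars K 2)" using z by (simp add: lists_below_def length_vars)
      then obtain r' where r': "map r' (vars K 2) = z" "\<forall>x. x \<notin> set (vars K 2) \<longrightarrow> r' x = r x"
        using registers_exist[OF distinct_vars, of z K 2 r] by blast
      then have "ev (diff_tm (cnt 0 j) (cnt 1 j)) r' m = 0" using H z by blast
      then show "card {v \<in> {..<n}. r.W t (?x[j := v]) z} = card {v \<in> {..<n}. r.W t (?y[j := v]) z}"
        using val[OF r'(2,1) z] by blast
    next
      fix r' assume "\<forall>z \<in> lists_below n K. card {v \<in> {..<n}. r.W t (?x[j := v]) z} = card {v \<in> {..<n}. r.W t (?y[j := v]) z}"
        "\<forall>x. x \<notin> set (vars K 2) \<longrightarrow> r' x = r x" "map r' (vars K 2) \<in> lists_below n K"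
      then show "ev (diff_tm (cnt 0 j) (cnt 1 j)) r' m = 0" using val[OF _ refl] by blast
    qed
    then show ?thesis unfolding ev_not by simp
  qed
  define f where "f j = not_tm (sum_tm (vars K 2) (diff_tm (cnt 0 j) (cnt 1 j)))" for j
  have "ev (ands (map f [0..<K])) r m = of_bool (\<forall>j \<in> set [0..<K]. \<forall>z \<in> lists_below n K.
      card {v \<in> {..<n}. r.W t (?x[j := v]) z} = card {v \<in> {..<n}. r.W t (?y[j := v]) z})"
    unfolding f_def by (rule ev_ands[OF 2]) simp
  then have "ev (ands (map f [0..<K])) r m = of_bool (\<forall>j < K. \<forall>z \<in> lists_below n K.
      card {v \<in> {..<n}. r.W t (?x[j := v]) z} = card {v \<in> {..<n}. r.W t (?y[j := v]) z})"
    by (simp add: Ball_def)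
  from ev_and[OF 1 this] show ?thesis
    unfolding round_tm_def f_def cnt_def r.W.simps(2) tuples_eq .
qed

text \<open>The bound on register 7 keeps the tables off the input.\<close>

definition state :: "nat \<Rightarrow> assertion" where
  "state t r m \<longleftrightarrow> base r m \<and> L \<le> r 7 \<and> has_table t (r 7) m"

lemma base_cong:
  assumes "base r m" "\<And>x. x < 12 \<Longrightarrow> x \<noteq> 7 \<Longrightarrow> r' x = r x" "\<And>z. z < L \<Longrightarrow> m' z = m z"
  shows "base r' m'"
  using assms by (simp add: base_def)

lemma bounds: "base r m \<Longrightarrow> b \<in> {1, 2, 3} \<Longrightarrow> r b \<le> L"
  by (auto simp: base_def)

lemma D_ge: "12 \<le> D" by (simp add: regs_def)

lemma small_notin_xy: "x < 12 \<Longrightarrow> x \<notin> set (xy_vars K)"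
  using round_vars(4)[of K] by auto

lemma xy_split:
  "map r (xy_vars K) \<in> lists_below n (2 * K) \<longleftrightarrow>
     map r (vars K 0) \<in> lists_below n K \<and> map r (vars K 1) \<in> lists_below n K"
  "take K (map r (xy_vars K)) = map r (vars K 0)" "drop K (map r (xy_vars K)) = map r (vars K 1)"
  using lists_below_append[of "map r (vars K 0)" K "map r (vars K 1)" n K]
  by (simp_all add: xy_vars_def length_vars mult_2)

lemma has_table_fill:
  assumes "\<forall>p \<in> lists_below n (2 * K). m (cur + horner n p) = of_bool (r.W t (take K p) (drop K p))"
  shows "has_table t cur m"
  unfolding has_table_def
proof (intro ballI)
  fix x y assume "x \<in> lists_below n K" "y \<in> lists_below n K"
  moreover from this have "length x = K" by (simp add: lists_below_def)
  ultimately show "m (cur + horner n (x @ y)) = of_bool (r.W t x y)"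
    using assms lists_below_append[of x K y n K] by (auto simp: mult_2)
qed

lemma wf_xy_address:
  "wf_tm D {1, 2, 3} (Pls (Var 7) (index_tm (xy_vars K)))"
  "wf_tm D {1, 2, 3} (Pls (Pls (Var 7) (Var 8)) (index_tm (xy_vars K)))"
  using round_vars(4)[of K] D_ge by (auto simp: wf_index)

lemma xy_facts: "3 \<in> {1, 2, 3 :: nat}" "{1, 2, 3} \<subseteq> {..<D}" "set (xy_vars K) \<inter> {1, 2, 3} = {}" "set (xy_vars K) \<subseteq> {..<D}"
  using round_vars(4)[of K] D_ge by auto

lemma init_table_correct:
  assumes b: "base r0 m1" and cur: "L \<le> r0 7"
  shows "hoare (\<lambda>r m. r = r0 \<and> m = m1) (init_table K) (state 0)
    (poly (init_time K) L)"
proof -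
  have r3: "r0 3 = n" using b by (simp add: base_def)
  have "hoare (\<lambda>r m. (\<forall>x < D. x \<notin> set (xy_vars K) \<longrightarrow> r x = r0 x) \<and> (\<forall>z < r0 7. m z = m1 z))
    (loops D 3 (xy_vars K) (store D (Pls (Var 7) (index_tm (xy_vars K))) (atomic_tm K)))
    (\<lambda>r m. (\<forall>x < D. x \<notin> set (xy_vars K) \<longrightarrow> r x = r0 x) \<and> (\<forall>z < r0 7. m z = m1 z) \<and>
      (\<forall>p \<in> lists_below (r0 3) (length (xy_vars K)). m (r0 7 + horner (r0 3) p) = of_bool (r.W 0 (take K p) (drop K p))))
    (poly (loop_time (length (xy_vars K)) (tm_time (Pls (Var 7) (index_tm (xy_vars K))) + tm_time (atomic_tm K) + [:1:])) L)"
  proof (rule hoare_fill[OF wf_xy_address(1) wf_atomic xy_facts(2) bounds[OF b] xy_facts(1,3) round_vars(2) xy_facts(4)])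
    fix r m assume r: "\<And>x. x < D \<Longrightarrow> x \<notin> set (xy_vars K) \<Longrightarrow> r x = r0 x"
      and mem: "map r (xy_vars K) \<in> lists_below (r0 3) (length (xy_vars K))" and m: "\<And>z. z < r0 7 \<Longrightarrow> m z = m1 z"
    have small: "r x = r0 x" if "x < 12" for x using r small_notin_xy that D_ge by simp
    have base: "base r m" by (rule base_cong[OF b]) (use small m cur in simp_all)
    have xy: "map r (vars K 0) \<in> lists_below n K" "map r (vars K 1) \<in> lists_below n K"
      using mem xy_split(1) unfolding r3 round_vars(6) by simp_all
    show "ev (Pls (Var 7) (index_tm (xy_vars K))) r m = r0 7 + horner (r0 3) (map r (xy_vars K)) \<and>
      ev (atomic_tm K) r m = of_bool (r.W 0 (take K (map r (xy_vars K))) (drop K (map r (xy_vars K))))"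
      using ev_atomic[OF base xy] small ev_index[OF small_notin_xy[of 10], of r m] unfolding xy_split by simp
  qed
  then show ?thesis
    unfolding init_table_def
  proof (rule hoare_conseq)
    fix r m assume Q: "(\<forall>x < D. x \<notin> set (xy_vars K) \<longrightarrow> r x = r0 x) \<and> (\<forall>z < r0 7. m z = m1 z) \<and>
      (\<forall>p \<in> lists_below (r0 3) (length (xy_vars K)). m (r0 7 + horner (r0 3) p) = of_bool (r.W 0 (take K p) (drop K p)))"
    have small: "r x = r0 x" if "x < 12" for x using Q small_notin_xy[OF that] that D_ge by simp
    have "base r m" by (rule base_cong[OF b]) (use small Q cur in simp_all)
    moreover have "has_table 0 (r0 7) m" using Q unfolding r3 round_vars(6) by (intro has_table_fill) blast
    ultimately show "state 0 r m" using small[of 7] cur by (simp add: state_def)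
  qed (simp_all add: round_vars(6))
qed

lemma round_correct:
  assumes st: "state t r0 m1"
  shows "hoare (\<lambda>r m. r = r0 \<and> m = m1) (wl_round K)
    (\<lambda>r m. state (Suc t) r m \<and> (\<forall>x < D. x \<notin> set (xy_vars K) \<and> x \<noteq> 7 \<longrightarrow> r x = r0 x))
    (poly (round_time K) L)"
proof -
  let ?lo = "r0 7 + n ^ (2 * K)"
  define Q where "Q r m \<longleftrightarrow> (\<forall>x < D. x \<notin> set (xy_vars K) \<longrightarrow> r x = r0 x) \<and> (\<forall>z < ?lo. m z = m1 z) \<and>
      (\<forall>p \<in> lists_below (r0 3) (length (xy_vars K)). m (?lo + horner (r0 3) p) = of_bool (r.W (Suc t) (take K p) (drop K p)))" for r m
  have b: "base r0 m1" and cur: "L \<le> r0 7" and tab: "has_table t (r0 7) m1" using st by (simp_all add: state_def)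
  have r3: "r0 3 = n" and r8: "r0 8 = n ^ (2 * K)" using b by (simp_all add: base_def)
  have "hoare (\<lambda>r m. (\<forall>x < D. x \<notin> set (xy_vars K) \<longrightarrow> r x = r0 x) \<and> (\<forall>z < ?lo. m z = m1 z))
    (loops D 3 (xy_vars K) (store D (Pls (Pls (Var 7) (Var 8)) (index_tm (xy_vars K))) (round_tm K))) Q
    (poly (loop_time (length (xy_vars K)) (tm_time (Pls (Pls (Var 7) (Var 8)) (index_tm (xy_vars K))) + tm_time (round_tm K) + [:1:])) L)"
    unfolding Q_def
  proof (rule hoare_fill[OF wf_xy_address(2) wf_round xy_facts(2) bounds[OF b] xy_facts(1,3) round_vars(2) xy_facts(4)])
    fix r m assume r: "\<And>x. x < D \<Longrightarrow> x \<notin> set (xy_vars K) \<Longrightarrow> r x = r0 x"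
      and mem: "map r (xy_vars K) \<in> lists_below (r0 3) (length (xy_vars K))" and m: "\<And>z. z < ?lo \<Longrightarrow> m z = m1 z"
    have small: "r x = r0 x" if "x < 12" for x using r small_notin_xy that D_ge by simp
    have base: "base r m" by (rule base_cong[OF b]) (use small m cur in simp_all)
    have xy: "map r (vars K 0) \<in> lists_below n K" "map r (vars K 1) \<in> lists_below n K"
      using mem xy_split(1) unfolding r3 round_vars(6) by simp_all
    \<comment> \<open>Offsets in a table are below \<open>n ^ (2 * K)\<close>, so the old table ends
      before the first cell that is written.\<close>
    have "has_table t (r 7) m"
      unfolding has_table_def
    proof (intro ballI)
      fix x y assume xy: "x \<in> lists_below n K" "y \<in> lists_below n K"
      then have "length x = K" by (simp add: lists_below_def)
      then have "horner n (x @ y) < n ^ (2 * K)"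
        using xy lists_below_append[of x K y n K] by (intro horner_less) (simp add: mult_2)
      then show "m (r 7 + horner n (x @ y)) = of_bool (r.W t x y)"
        using tab xy m small[of 7] by (simp add: has_table_def)
    qed
    from ev_round[OF base this xy]
    show "ev (Pls (Pls (Var 7) (Var 8)) (index_tm (xy_vars K))) r m = ?lo + horner (r0 3) (map r (xy_vars K)) \<and>
      ev (round_tm K) r m = of_bool (r.W (Suc t) (take K (map r (xy_vars K))) (drop K (map r (xy_vars K))))"
      using small ev_index[OF small_notin_xy[of 10], of r m] r8 unfolding xy_split by simp
  qed
  then have 1: "hoare (\<lambda>r m. r = r0 \<and> m = m1)
    (loops D 3 (xy_vars K) (store D (Pls (Pls (Var 7) (Var 8)) (index_tm (xy_vars K))) (round_tm K))) Q
    (poly (table_time K) L)"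
    unfolding round_vars(6) by (rule hoare_pre) simp_all
  have 2: "hoare Q (assign D 7 (Pls (Var 7) (Var 8)))
    (\<lambda>r m. state (Suc t) r m \<and> (\<forall>x < D. x \<notin> set (xy_vars K) \<and> x \<noteq> 7 \<longrightarrow> r x = r0 x)) (poly (tm_time (Pls (Var 7) (Var 8))) L + 2)"
  proof (rule hoare_assign[OF _ xy_facts(2)])
    show "wf_tm D {1, 2, 3} (Pls (Var 7) (Var 8))" "7 < D" using D_ge by simp_all
    have small: "r x = r0 x" if "Q r m" "x < 12" for r m x
      using that small_notin_xy[OF that(2)] D_ge by (simp add: Q_def)
    show "r b \<le> L" if "Q r m" "b \<in> {1, 2, 3}" for r m b
      using bounds[OF b that(2)] small[OF that(1), of b] that(2) by auto
    fix r r' m assume Q: "Q r m" and r': "\<And>y. y < D \<Longrightarrow> r' y = (r(7 := ev (Pls (Var 7) (Var 8)) r m)) y"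
    have r7: "r' 7 = ?lo" using r'[of 7] small[OF Q] D_ge r8 by simp
    have "r' x = r0 x" if "x < 12" "x \<noteq> 7" for x using r'[of x] small[OF Q that(1)] that D_ge by simp
    then have "base r' m" by (rule base_cong[OF b]) (use Q cur in \<open>simp_all add: Q_def\<close>)
    moreover have "has_table (Suc t) ?lo m"
      using Q unfolding Q_def r3 round_vars(6) by (intro has_table_fill) blast
    moreover have "r' x = r0 x" if "x < D" "x \<notin> set (xy_vars K)" "x \<noteq> 7" for x
      using r'[OF that(1)] that Q by (simp add: Q_def)
    ultimately show "state (Suc t) r' m \<and> (\<forall>x < D. x \<notin> set (xy_vars K) \<and> x \<noteq> 7 \<longrightarrow> r' x = r0 x)"
      using cur by (simp add: state_def r7)
  qed
  show ?thesis unfolding wl_round_def by (rule hoare_time[OF hoare_Seq[OF 1 2]]) simp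
qed

text \<open>Of the visited counter tuples only the number matters: the stage reached is
  \<open>card Z\<close>, and there are \<open>stab\<close> counter tuples in all.\<close>

lemma rounds_correct:
  "hoare (state 0) (loops D 3 (round_vars K) (wl_round K)) (state r.stab)
    (poly (loop_time (2 * K) (round_time K)) L)"
proof -
  define J where "J Z r m \<longleftrightarrow> finite Z \<and> state (card Z) r m" for Z :: "nat list set" and r m
  have small: "x \<notin> set (round_vars K)" if "x < 12" for x using round_vars(5)[of K] that by auto
  have "hoare (J {}) (loops D 3 (round_vars K) (wl_round K)) (J (lists_below n (length (round_vars K))))
    (poly (loop_time (length (round_vars K)) (round_time K)) L)"
  proof (rule hoare_loops)
    show "J Z r' m" if J: "J Z r m" and eq: "\<And>x. x < D \<Longrightarrow> x \<notin> set (round_vars K) \<Longrightarrow> r' x = r x" for Z :: "nat list set" and r r' m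
    proof -
      have s: "r' x = r x" if "x < 12" for x using eq[of x] small[OF that] that D_ge by simp
      then have "base r' m" using J by (intro base_cong[of r m r' m]) (simp_all add: J_def state_def)
      then show ?thesis using J s[of 7] by (simp add: J_def state_def)
    qed
    show "r 3 = n" if "J Z r m" for Z :: "nat list set" and r m using that by (simp add: J_def state_def base_def)
    show "3 \<notin> set (round_vars K)" "3 < D" "n \<le> L" using small[of 3] D_ge by simp_all
    show "distinct (round_vars K)" by (rule round_vars(3))
    show "set (round_vars K) \<subseteq> {..<D}" using round_vars(5)[of K] by auto
    fix Z :: "nat list set" and xs assume xs: "xs \<notin> Z"
    show "hoare (\<lambda>r m. J Z r m \<and> map r (round_vars K) = xs) (wl_round K) (\<lambda>r m. J (insert xs Z) r m \<and> map r (round_vars K) = xs)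
      (poly (round_time K) L)"
    proof (rule hoare_fixed)
      fix r0 m1 assume J: "J Z r0 m1 \<and> map r0 (round_vars K) = xs"
      then have "state (card Z) r0 m1" by (simp add: J_def)
      from round_correct[OF this]
      show "hoare (\<lambda>r m. r = r0 \<and> m = m1) (wl_round K) (\<lambda>r m. J (insert xs Z) r m \<and> map r (round_vars K) = xs)
        (poly (round_time K) L)"
      proof (rule hoare_conseq)
        fix r m assume s: "state (Suc (card Z)) r m \<and> (\<forall>x < D. x \<notin> set (xy_vars K) \<and> x \<noteq> 7 \<longrightarrow> r x = r0 x)"
        have "map r (round_vars K) = map r0 (round_vars K)"
        proof (intro map_cong refl)
          fix x assume x: "x \<in> set (round_vars K)"
          have "x < D" "x \<noteq> 7" using round_vars(5)[of K] x by auto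
          moreover have "x \<notin> set (xy_vars K)" using round_vars(1)[of K] x by blast
          ultimately show "r x = r0 x" using s by simp
        qed
        then show "J (insert xs Z) r m \<and> map r (round_vars K) = xs"
          using s J xs by (simp add: J_def)
      qed simp_all
    qed
  qed
  then show ?thesis
    unfolding round_vars(7)
  proof (rule hoare_conseq)
    show "J {} r m" if "state 0 r m" for r m using that by (simp add: J_def)
    have "card (lists_below n (2 * K)) = r.stab"
      unfolding lists_below_def stab_eq using card_lists_length_eq[of "{..<n}" "2 * K"] by simp
    then show "state r.stab r m" if "J (lists_below n (2 * K)) r m" for r m using that by (simp add: J_def)
  qed simp
qed

lemma ev_answer:
  assumes st: "state t r m"
  shows "ev (answer_tm K) r m = of_bool (accepts t)"
proof -
  define body where "body = and_tm (and_tm (lt_tm (Var 12) (Var 1)) (not_tm (lt_tm (Var (12 + K)) (Var 1)))) (table_tm (vars K 0 @ vars K 1))"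
  have b: "base r m" and tab: "has_table t (r 7) m" using st by (simp_all add: state_def)
  have r3: "r 3 = n" using b by (simp add: base_def)
  have v0: "vars K 0 ! 0 = 12" "vars K 1 ! 0 = 12 + K" using K_pos by (simp_all add: vars_def)
  have val: "ev body r' m = of_bool (x ! 0 < n1 \<and> n1 \<le> y ! 0 \<and> r.W t x y)"
    if r': "\<And>x. x \<notin> set (xy_vars K) \<Longrightarrow> r' x = r x" and xy: "map r' (vars K 0) = x" "map r' (vars K 1) = y"
      "x \<in> lists_below n K" "y \<in> lists_below n K" for r' x y
  proof -
    have small: "r' x = r x" if "x < 12" for x using r' small_notin_xy[OF that] by blast
    then have b': "base r' m" "r' 7 = r 7" "r' 3 = n" "r' 1 = n1" using b by (simp_all add: base_def)
    have heads: "r' 12 = x ! 0" "r' (12 + K) = y ! 0"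
      using xy(1,2) v0 K_pos length_vars by (metis nth_map)+
    have 1: "ev (table_tm (vars K 0 @ vars K 1)) r' m = of_bool (r.W t x y)"
      using ev_table[of "vars K 0" "vars K 1" r' K m "r.W t"] xy tab b'(2,3) small_notin_vars[of 10 K]
      by (auto simp: has_table_def)
    have 2: "ev (and_tm (lt_tm (Var 12) (Var 1)) (not_tm (lt_tm (Var (12 + K)) (Var 1)))) r' m = of_bool (x ! 0 < n1 \<and> n1 \<le> y ! 0)"
      unfolding ev.simps b'(4) heads by auto
    from ev_and[OF 2 1] show ?thesis unfolding body_def by simp
  qed
  have "ev (sum_tm (vars K 0 @ vars K 1) body) r m \<noteq> 0 \<longleftrightarrow>
     (\<exists>x \<in> lists_below n K. \<exists>y \<in> lists_below n K. x ! 0 < n1 \<and> n1 \<le> y ! 0 \<and> r.W t x y)"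
    (is "?L \<longleftrightarrow> ?R")
  proof -
    have 3: "3 \<notin> set (vars K 0 @ vars K 1)" using small_notin_vars[of 3 K] by simp
    have zero: "ev (sum_tm (vars K 0 @ vars K 1) body) r m = 0 \<longleftrightarrow>
      (\<forall>r'. (\<forall>x. x \<notin> set (vars K 0 @ vars K 1) \<longrightarrow> r' x = r x) \<longrightarrow>
        map r' (vars K 0 @ vars K 1) \<in> lists_below n (length (vars K 0 @ vars K 1)) \<longrightarrow> ev body r' m = 0)"
      by (simp only: ev_sum_tm_zero[OF 3 round_vars(2)[of K, unfolded xy_vars_def]] r3)
    have len: "length (vars K 0 @ vars K 1) = 2 * K" by (simp add: length_vars)
    show ?thesis
    proof
      assume ?L
      then obtain r' where r': "\<forall>x. x \<notin> set (xy_vars K) \<longrightarrow> r' x = r x" "map r' (xy_vars K) \<in> lists_below n (2 * K)" "ev body r' m \<noteq> 0"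
        unfolding zero len xy_vars_def by blast
      then have xy: "map r' (vars K 0) \<in> lists_below n K" "map r' (vars K 1) \<in> lists_below n K" using xy_split(1) by blast+
      have "map r' (vars K 0) ! 0 < n1 \<and> n1 \<le> map r' (vars K 1) ! 0 \<and> r.W t (map r' (vars K 0)) (map r' (vars K 1))"
        using val[OF _ refl refl xy] r'(1,3) by (metis of_bool_eq(1))
      then show ?R using xy by blast
    next
      assume ?R
      then obtain x y where xy: "x \<in> lists_below n K" "y \<in> lists_below n K" "x ! 0 < n1" "n1 \<le> y ! 0" "r.W t x y" by blast
      have lxy: "length x = K" "length y = K" using xy by (simp_all add: lists_below_def)
      then obtain r' where r': "map r' (xy_vars K) = x @ y" "\<forall>z. z \<notin> set (xy_vars K) \<longrightarrow> r' z = r z"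
        using registers_exist[OF round_vars(2), of "x @ y" K r] by (auto simp: round_vars(6))
      then have m: "map r' (vars K 0) = x" "map r' (vars K 1) = y"
        using lxy by (simp_all add: xy_vars_def length_vars)
      have nz: "ev body r' m \<noteq> 0" using val[OF _ m xy(1,2)] r'(2) xy(3-5) by simp
      have mem: "map r' (xy_vars K) \<in> lists_below n (2 * K)" using xy(1,2) m xy_split(1) by simp
      show ?L
      proof
        assume "ev (sum_tm (vars K 0 @ vars K 1) body) r m = 0"
        note H = zero[THEN iffD1, OF this, folded xy_vars_def, unfolded round_vars(6), rule_format]
        have "ev body r' m = 0" by (rule H[OF _ mem]) (use r'(2) in blast)
        then show False using nz by simp
      qed
    qed
  qed
  then show ?thesis
    unfolding answer_tm_def body_def[symmetric] tuples_eq using r3 by auto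
qed

end

text \<open>One summand for each command of \<open>wl_program\<close>, in order;
  \<open>[:2, 4:]\<close> belongs to the scans. The argument will be the input length, which bounds
  registers 1, 2 and 3.\<close>

definition wl_time :: "nat \<Rightarrow> nat poly" where
  "wl_time K = [:2, 4:] + (tm_time (Pls (Var 1) (Cst 1)) + [:2:]) + (tm_time (Pls (Var 4) (Sm 10 1 (Var 1))) + [:2:]) +
     (tm_time (Var 9) + [:2:]) + [:2, 4:] + (tm_time (Mns (Var 9) (Var 5)) + [:2:]) + (tm_time (Pls (Var 1) (Var 2)) + [:2:]) +
     (tm_time (Pls (Var 9) (Cst 1)) + [:2:]) + (tm_time (Pls (Var 6) (Sm 10 2 (Var 2))) + [:2:]) +
     (tm_time (sum_tm (xy_vars K) (Cst 1)) + [:2:]) +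
     init_time K +
     loop_time (2 * K) (round_time K) +
     (tm_time (answer_tm K) + [:2:])"

context wl_input begin

lemma wl_program_correct:
  "hoare (in_state D (\<lambda>_. 0) m0) (wl_program K)
    (\<lambda>r m. r 0 = of_bool (accepts r.stab))
    (poly (wl_time K) L)"
proof -
  let ?B = "{1, 2, 3 :: nat}"
  let ?s = "n1 + 1 + n1 * n1"
  define r1 where "r1 = (\<lambda>_ :: nat. 0 :: nat)(1 := n1)"
  define r2 where "r2 = r1(4 := n1 + 1)"
  define r3 where "r3 = r2(9 := ?s)"
  define r4 where "r4 = r3(5 := ?s)"
  define r5 where "r5 = r4(9 := ?s + n2)"
  define r6 where "r6 = r5(2 := n2)"
  define r7 where "r7 = r6(3 := n)"
  define r8 where "r8 = r7(6 := ?s + n2 + 1)"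
  define r9 where "r9 = r8(7 := L)"
  define r10 where "r10 = r9(8 := n ^ (2 * K))"
  note rs = r1_def r2_def r3_def r4_def r5_def r6_def r7_def r8_def r9_def r10_def
  note B = xy_facts(2)
  have D: "x < D" if "x < 12" for x using D_ge that by simp
  have h1: "hoare (in_state D (\<lambda>_. 0) m0) (scan D 1) (in_state D r1 m0) (2 + n1 * 4)"
    by (rule hoare_conseq[OF hoare_scan[of 1 D m0 "\<lambda>_. 0" n1]])
      (use D[of 1] unary1 in \<open>auto simp: in_state_def r1_def\<close>)
  have h2: "hoare (in_state D r1 m0) (assign D 4 (Pls (Var 1) (Cst 1))) (in_state D r2 m0) (poly (tm_time (Pls (Var 1) (Cst 1))) L + 2)"
    by (rule hoare_assign_in_state[OF _ B D]) (use D in \<open>auto simp: rs\<close>)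
  have h3: "hoare (in_state D r2 m0) (assign D 9 (Pls (Var 4) (Sm 10 1 (Var 1)))) (in_state D r3 m0) (poly (tm_time (Pls (Var 4) (Sm 10 1 (Var 1)))) L + 2)"
    by (rule hoare_assign_in_state[OF _ B D]) (use D in \<open>auto simp: rs\<close>)
  have h4: "hoare (in_state D r3 m0) (assign D 5 (Var 9)) (in_state D r4 m0) (poly (tm_time (Var 9)) L + 2)"
    by (rule hoare_assign_in_state[OF _ B D]) (use D in \<open>auto simp: rs\<close>)
  have r49: "r4 9 = ?s" by (simp add: rs)
  have h5: "hoare (in_state D r4 m0) (scan D 9) (in_state D r5 m0) (2 + n2 * 4)"
    by (rule hoare_conseq[OF hoare_scan[OF D[of 9], of m0 r4 n2, unfolded r49]])
      (use unary2 in \<open>simp_all add: in_state_def r5_def\<close>)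
  have h6: "hoare (in_state D r5 m0) (assign D 2 (Mns (Var 9) (Var 5))) (in_state D r6 m0) (poly (tm_time (Mns (Var 9) (Var 5))) L + 2)"
    by (rule hoare_assign_in_state[OF _ B D]) (use D in \<open>auto simp: rs\<close>)
  have h7: "hoare (in_state D r6 m0) (assign D 3 (Pls (Var 1) (Var 2))) (in_state D r7 m0) (poly (tm_time (Pls (Var 1) (Var 2))) L + 2)"
    by (rule hoare_assign_in_state[OF _ B D]) (use D in \<open>auto simp: rs\<close>)
  have h8: "hoare (in_state D r7 m0) (assign D 6 (Pls (Var 9) (Cst 1))) (in_state D r8 m0) (poly (tm_time (Pls (Var 9) (Cst 1))) L + 2)"
    by (rule hoare_assign_in_state[OF _ B D]) (use D in \<open>auto simp: rs\<close>)
  have h9: "hoare (in_state D r8 m0) (assign D 7 (Pls (Var 6) (Sm 10 2 (Var 2)))) (in_state D r9 m0) (poly (tm_time (Pls (Var 6) (Sm 10 2 (Var 2)))) L + 2)"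
    by (rule hoare_assign_in_state[OF _ B D]) (use D in \<open>auto simp: rs\<close>)
  have r93: "r9 3 = n" "3 \<notin> set (xy_vars K)" using small_notin_xy[of 3] by (simp_all add: rs)
  have h10: "hoare (in_state D r9 m0) (assign D 8 (sum_tm (xy_vars K) (Cst 1))) (in_state D r10 m0) (poly (tm_time (sum_tm (xy_vars K) (Cst 1))) L + 2)"
  proof (rule hoare_assign_in_state[OF _ B D])
    show "wf_tm D ?B (sum_tm (xy_vars K) (Cst 1))" using xy_facts(3,4) by (auto simp: wf_sum_tm)
    show "r9 b \<le> L" if "b \<in> ?B" for b using that by (auto simp: rs)
    show "r10 = r9(8 := ev (sum_tm (xy_vars K) (Cst 1)) r9 m0)"
      unfolding ev_sum_tm_one[OF r93(2)] r93(1) round_vars(6) r10_def ..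
  qed simp
  have h11: "hoare (in_state D r10 m0) (init_table K) (state 0)
    (poly (init_time K) L)"
  proof (rule hoare_fixed)
    fix r m assume r: "in_state D r10 m0 r m"
    then have "r x = r10 x" if "x < 12" for x using D[OF that] by (simp add: in_state_def)
    moreover have "m = m0" using r by (simp add: in_state_def)
    moreover have "base r10 m0" "r10 7 = L" by (simp_all add: base_def rs)
    ultimately have "base r m" "L \<le> r 7" using base_cong[of r10 m0 r m] by simp_all
    then show "hoare (\<lambda>r' m'. r' = r \<and> m' = m) (init_table K) (state 0)
      (poly (init_time K) L)"
      by (rule init_table_correct)
  qed
  have h13: "hoare (state r.stab) (assign D 0 (answer_tm K))
    (\<lambda>r m. r 0 = of_bool (accepts r.stab))
    (poly (tm_time (answer_tm K)) L + 2)"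
  proof (rule hoare_assign[OF wf_answer[OF K_pos] B D])
    show "r b \<le> L" if "state r.stab r m" "b \<in> ?B" for r m b
      by (rule bounds[OF _ that(2), where m = m]) (use that(1) in \<open>simp add: state_def\<close>)
    show "r' 0 = of_bool (accepts r.stab)"
      if st: "state r.stab r m" and r': "\<And>y. y < D \<Longrightarrow> r' y = (r(0 := ev (answer_tm K) r m)) y" for r r' m
      using r'[of 0] D[of 0] ev_answer[OF st] by simp
  qed simp
  from hoare_Seq[OF h1 hoare_Seq[OF h2 hoare_Seq[OF h3 hoare_Seq[OF h4 hoare_Seq[OF h5 hoare_Seq[OF h6 hoare_Seq[OF h7
    hoare_Seq[OF h8 hoare_Seq[OF h9 hoare_Seq[OF h10 hoare_Seq[OF h11 hoare_Seq[OF rounds_correct h13]]]]]]]]]]]]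
  show ?thesis
    unfolding wl_program_def Let_def seq.simps
    by (rule hoare_time) (simp add: wl_time_def)
qed

end

section \<open>The encoding in memory and the conclusion\<close>

lemma nth_concat_rows:
  assumes "\<And>u. length (f u) = n" "u < k" "v < n"
  shows "length (concat (map f [0..<k])) = n * k \<and> concat (map f [0..<k]) ! (n * u + v) = f u ! v"
  using assms(2)
proof (induction k)
  case (Suc k)
  have len: "length (concat (map f [0..<j])) = n * j" for j
    using assms(1) by (induction j) simp_all
  show ?case
  proof (cases "u < k")
    case True
    have "n * u + v < n * Suc u" using assms(3) by simp
    also have "\<dots> \<le> n * k" using True by (intro mult_le_mono2) simp
    finally have "n * u + v < n * k" .
    then show ?thesis using Suc.IH[OF True] len[of "Suc k"] by (simp add: nth_append len)
  next
    case False
    then have "u = k" using Suc.prems by simp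
    then show ?thesis using len[of "Suc k"] by (simp add: nth_append len)
  qed
qed simp

lemma encode_graph_nth:
  assumes "card (pverts G) = n"
  shows "length (encode_graph G) = n + 1 + n * n"
    "j < n \<Longrightarrow> encode_graph G ! j" "\<not> encode_graph G ! n"
    "u < n \<Longrightarrow> v < n \<Longrightarrow> encode_graph G ! (n + 1 + (n * u + v)) \<longleftrightarrow> (u, v) \<in> parcs G"
proof -
  define f where "f u = map (\<lambda>v. (u, v) \<in> parcs G) [0..<n]" for u
  have enc: "encode_graph G = replicate n True @ [False] @ concat (map f [0..<n])"
    by (simp add: encode_graph_def assms Let_def f_def[abs_def])
  have len: "length (concat (map f [0..<n])) = n * n"
    by (simp add: length_concat f_def comp_def sum_list_triv)
  show "length (encode_graph G) = n + 1 + n * n" by (simp add: enc len)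
  show "j < n \<Longrightarrow> encode_graph G ! j" "\<not> encode_graph G ! n" by (simp_all add: enc nth_append)
  show "encode_graph G ! (n + 1 + (n * u + v)) \<longleftrightarrow> (u, v) \<in> parcs G" if "u < n" "v < n"
    using nth_concat_rows[of f n u n v] that by (simp add: enc nth_append f_def)
qed

theorem theorem3:
  shows "\<exists>c :: prog. decides_in_poly_time c encode_graph_pair
    {(G, H). input_graph G \<and> input_graph H \<and> clique_width G \<le> 3 \<and> clique_width H \<le> 3}
    (\<lambda>(G, H). digraph_iso (with_proj G) (with_proj H))"
proof -
  \<comment> \<open>The dimension 22 does not depend on the input, so one program and one polynomial
    serve all pairs of graphs.\<close>
  have "\<exists>t r m. exec (wl_program 22) (initial_state (encode_graph_pair (G, H))) t (r, m) \<and>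
      t \<le> poly (wl_time 22) (length (encode_graph_pair (G, H))) \<and>
      r 0 = (if digraph_iso (with_proj G) (with_proj H) then 1 else 0)"
    if G: "input_graph G" "clique_width G \<le> 3" and H: "input_graph H" for G H
  proof -
    define n1 n2 where n: "n1 = card (pverts G)" "n2 = card (pverts H)"
    note eG = encode_graph_nth[OF n(1)[symmetric]] and eH = encode_graph_nth[OF n(2)[symmetric]]
    define w where "w = encode_graph G @ encode_graph H"
    define m0 where "m0 a = (if a < length w then of_bool (w ! a) else 0 :: nat)" for a
    have init: "initial_state w = (\<lambda>_. 0, m0)" by (simp add: initial_state_def m0_def fun_eq_iff)
    have len: "length w = n1 + 1 + n1 * n1 + n2 + 1 + n2 * n2" by (simp add: w_def eG(1) eH(1))
    have m1: "m0 a = of_bool (encode_graph G ! a)" if "a < n1 + 1 + n1 * n1" for a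
      using that by (simp add: m0_def len w_def nth_append eG(1))
    have m2: "m0 (n1 + 1 + n1 * n1 + a) = of_bool (encode_graph H ! a)" if "a < n2 + 1 + n2 * n2" for a
      using that by (simp add: m0_def len w_def nth_append eG(1) eH(1))
    interpret wl_input 22 n1 n2 "parcs G" "parcs H" m0
    proof
      show "(v, u) \<in> parcs G" if "(u, v) \<in> parcs G" for u v by (rule input_graphD(3)[OF G(1) that])
      show "(v, u) \<in> parcs H" if "(u, v) \<in> parcs H" for u v by (rule input_graphD(3)[OF H that])
      show "m0 j = 1" if "j < n1" for j using that m1[of j] eG(2)[OF that] by simp
      show "m0 n1 = 0" using m1[of n1] eG(3) by simp
      show "m0 (n1 + 1 + (n1 * u + v)) = of_bool ((u, v) \<in> parcs G)" if "u < n1" "v < n1" for u v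
        using m1[of "n1 + 1 + (n1 * u + v)"] index_bound[OF that] eG(4)[OF that] by simp
      show "m0 (n1 + 1 + n1 * n1 + j) = 1" if "j < n2" for j using that m2[of j] eH(2)[OF that] by simp
      show "m0 (n1 + 1 + n1 * n1 + n2) = 0" using m2[of n2] eH(3) by simp
      show "m0 (n1 + 1 + n1 * n1 + n2 + 1 + (n2 * u + v)) = of_bool ((u, v) \<in> parcs H)" if "u < n2" "v < n2" for u v
        using m2[of "n2 + 1 + (n2 * u + v)"] index_bound[OF that] eH(4)[OF that] by (simp add: add.assoc)
    qed simp
    have "in_state (regs 22) (\<lambda>_. 0) m0 (\<lambda>_. 0) m0" by (simp add: in_state_def)
    from hoareD[OF wl_program_correct, OF this]
    have ex: "\<exists>t r m. exec (wl_program 22) (initial_state w) t (r, m) \<and> t \<le> poly (wl_time 22) (length w) \<and>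
        r 0 = of_bool (accepts r.stab)"
      unfolding len init .
    have iff: "digraph_iso (with_proj G) (with_proj H) \<longleftrightarrow>
        accepts r.stab"
      unfolding stab_eq by (rule digraph_iso_iff_W[OF G H order_refl n])
    show ?thesis
      unfolding encode_graph_pair_def prod.case w_def[symmetric] by (rule ex[folded iff, unfolded of_bool_def])
  qed
  then show ?thesis
    unfolding decides_in_poly_time_def
    by (intro exI[of _ "wl_program 22"] exI[of _ "wl_time 22"]) auto
qed

end
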